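(* Let $n$ be a positive integer and $G$ a countable group. Assume that every minimal finite abelian normal subgroup of $G$ is central. Then $G$ does not have Property $P(n)$ if and only if $G$ contains a central subgroup isomorphic to $C_p \times C_p$ for some prime $p \le n-1$.
   Context: Countable means finite or countably infinite. $C_p$ is the cyclic group of order $p$. A minimal finite abelian normal subgroup of $G$ is a finite abelian normal subgroup of $G$ that is minimal among the non-trivial normal subgroups of $G$. A subset $F$ of a group $G$ is irreducibly faithful if there exists an irreducible unitary representation $\pi$ of $G$ (in a Hilbert space) such that $\pi(x) \ne \mathrm{id}$ for all $x \in F$ with $x \ne e$. For $n \ge 1$, $G$ has Property $P(n)$ if every subset of $G$ of size at most $n$ is irreducibly faithful. *)

theory Defs
  imports "HOL-Algebra.Algebra" "HOL-Algebra.Algebraic_Closure_Type" "HOL-Analysis.Analysis"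
begin

section \<open>Hilbert spaces with explicit carrier\<close>

record 'h inner_space = "(complex, 'h) module" +
  inprod :: "'h \<Rightarrow> 'h \<Rightarrow> complex"

locale complex_inner_space = module "ring_of_type_algebra :: complex ring" H
  for H :: "'h inner_space" +
  assumes inprod_add_left:
      "\<lbrakk>u \<in> carrier H; v \<in> carrier H; w \<in> carrier H\<rbrakk>
       \<Longrightarrow> inprod H (u \<oplus>\<^bsub>H\<^esub> v) w = inprod H u w + inprod H v w"
    and inprod_smult_left:
      "\<lbrakk>v \<in> carrier H; w \<in> carrier H\<rbrakk> \<Longrightarrow> inprod H (a \<odot>\<^bsub>H\<^esub> v) w = a * inprod H v w"
    and inprod_commute:
      "\<lbrakk>v \<in> carrier H; w \<in> carrier H\<rbrakk> \<Longrightarrow> inprod H w v = cnj (inprod H v w)"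
    and inprod_pos:
      "\<lbrakk>v \<in> carrier H; v \<noteq> \<zero>\<^bsub>H\<^esub>\<rbrakk> \<Longrightarrow> Re (inprod H v v) > 0"

text \<open>
  The value 0 off the carrier is needed because \<open>Metric_space\<close> requires the distance
  to be symmetric and nonnegative on the whole type.
\<close>
definition hdist :: "'h inner_space \<Rightarrow> 'h \<Rightarrow> 'h \<Rightarrow> real" where
  "hdist H v w =
     (if v \<in> carrier H \<and> w \<in> carrier H
      then sqrt (Re (inprod H (v \<ominus>\<^bsub>H\<^esub> w) (v \<ominus>\<^bsub>H\<^esub> w))) else 0)"

locale hilbert_space = complex_inner_space +
  assumes complete: "Metric_space.mcomplete (carrier H) (hdist H)"

definition closed_subspace :: "'h set \<Rightarrow> 'h inner_space \<Rightarrow> bool" where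
  "closed_subspace W H \<longleftrightarrow>
     submodule W (ring_of_type_algebra :: complex ring) H \<and>
     closedin (Metric_space.mtopology (carrier H) (hdist H)) W"


section \<open>Irreducible unitary representations\<close>

text \<open>
  Through \<open>group_action\<close>, each \<open>\<pi> x\<close> is a bijection of the carrier, hence a unitary
  operator, and it is \<open>undefined\<close> off the carrier.
\<close>
locale unitary_rep = hilbert_space H + group_action G "carrier H" \<pi>
  for G :: "('a, 'b) monoid_scheme" and H :: "'h inner_space" and \<pi> :: "'a \<Rightarrow> 'h \<Rightarrow> 'h" +
  assumes rep_add:
      "\<lbrakk>x \<in> carrier G; v \<in> carrier H; w \<in> carrier H\<rbrakk> \<Longrightarrow> \<pi> x (v \<oplus>\<^bsub>H\<^esub> w) = \<pi> x v \<oplus>\<^bsub>H\<^esub> \<pi> x w"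
    and rep_smult:
      "\<lbrakk>x \<in> carrier G; v \<in> carrier H\<rbrakk> \<Longrightarrow> \<pi> x (a \<odot>\<^bsub>H\<^esub> v) = a \<odot>\<^bsub>H\<^esub> \<pi> x v"
    and rep_inprod:
      "\<lbrakk>x \<in> carrier G; v \<in> carrier H; w \<in> carrier H\<rbrakk> \<Longrightarrow> inprod H (\<pi> x v) (\<pi> x w) = inprod H v w"

locale irreducible_unitary_rep = unitary_rep +
  assumes nonzero: "carrier H \<noteq> {\<zero>\<^bsub>H\<^esub>}"
    and irreducible:
      "\<lbrakk>closed_subspace W H; \<forall>x\<in>carrier G. \<pi> x ` W \<subseteq> W\<rbrakk> \<Longrightarrow> W = {\<zero>\<^bsub>H\<^esub>} \<or> W = carrier H"

text \<open>
  HOL cannot quantify existentially over the type of the vectors, so the Hilbert space is taken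
  with carrier in \<open>'a \<Rightarrow> complex\<close> and otherwise arbitrary structure. This is no
  restriction: see \<open>irreducibly_faithful_any_type\<close> below.
\<close>
definition irreducibly_faithful :: "('a, 'b) monoid_scheme \<Rightarrow> 'a set \<Rightarrow> bool" where
  "irreducibly_faithful G F \<longleftrightarrow>
     (\<exists>(H :: ('a \<Rightarrow> complex) inner_space) \<pi>. irreducible_unitary_rep G H \<pi> \<and>
        (\<forall>x\<in>F. x \<noteq> \<one>\<^bsub>G\<^esub> \<longrightarrow> \<pi> x \<noteq> (\<lambda>v\<in>carrier H. v)))"

definition property_P :: "nat \<Rightarrow> ('a, 'b) monoid_scheme \<Rightarrow> bool" where
  "property_P n G \<longleftrightarrow>
     (\<forall>F. F \<subseteq> carrier G \<and> finite F \<and> card F \<le> n \<longrightarrow> irreducibly_faithful G F)"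


section \<open>Subgroups\<close>

definition minimal_finite_abelian_normal :: "'a set \<Rightarrow> ('a, 'b) monoid_scheme \<Rightarrow> bool" where
  "minimal_finite_abelian_normal N G \<longleftrightarrow>
     N \<lhd> G \<and> finite N \<and> comm_group (G\<lparr>carrier := N\<rparr>) \<and> N \<noteq> {\<one>\<^bsub>G\<^esub>} \<and>
     (\<forall>M. M \<lhd> G \<and> M \<noteq> {\<one>\<^bsub>G\<^esub>} \<and> M \<subseteq> N \<longrightarrow> M = N)"

definition central_subgroup :: "'a set \<Rightarrow> ('a, 'b) monoid_scheme \<Rightarrow> bool" where
  "central_subgroup K G \<longleftrightarrow>
     subgroup K G \<and> (\<forall>x\<in>K. \<forall>g\<in>carrier G. x \<otimes>\<^bsub>G\<^esub> g = g \<otimes>\<^bsub>G\<^esub> x)"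


section \<open>The type of the Hilbert space is immaterial\<close>

lemma ring_of_type_algebra_simps [simp]:
  "carrier ring_of_type_algebra = UNIV"
  "x \<otimes>\<^bsub>ring_of_type_algebra\<^esub> y = x * y"
  "x \<oplus>\<^bsub>ring_of_type_algebra\<^esub> y = x + y"
  "\<one>\<^bsub>ring_of_type_algebra\<^esub> = 1"
  "\<zero>\<^bsub>ring_of_type_algebra\<^esub> = 0"
  by (simp_all add: ring_of_type_algebra_def)

context complex_inner_space
begin

lemma inprod_zero_left [simp]: "w \<in> carrier H \<Longrightarrow> inprod H \<zero>\<^bsub>H\<^esub> w = 0"
  using inprod_add_left[of "\<zero>\<^bsub>H\<^esub>" "\<zero>\<^bsub>H\<^esub>" w] by simp

lemma inprod_minus_left [simp]:
  assumes "v \<in> carrier H" "w \<in> carrier H"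
  shows "inprod H (\<ominus>\<^bsub>H\<^esub> v) w = - inprod H v w"
  using inprod_add_left[of v "\<ominus>\<^bsub>H\<^esub> v" w] assms
  by (simp add: M.r_neg add_eq_0_iff)

lemma inprod_diff_left:
  assumes "u \<in> carrier H" "v \<in> carrier H" "w \<in> carrier H"
  shows "inprod H (u \<ominus>\<^bsub>H\<^esub> v) w = inprod H u w - inprod H v w"
  using assms by (simp add: a_minus_def inprod_add_left)

lemma inprod_add_right:
  assumes "u \<in> carrier H" "v \<in> carrier H" "w \<in> carrier H"
  shows "inprod H w (u \<oplus>\<^bsub>H\<^esub> v) = inprod H w u + inprod H w v"
  using assms inprod_commute[of "u \<oplus>\<^bsub>H\<^esub> v" w] inprod_commute[of u w] inprod_commute[of v w]
  by (simp add: inprod_add_left)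

lemma inprod_diff_right:
  assumes "u \<in> carrier H" "v \<in> carrier H" "w \<in> carrier H"
  shows "inprod H w (u \<ominus>\<^bsub>H\<^esub> v) = inprod H w u - inprod H w v"
  using assms inprod_commute[of "u \<ominus>\<^bsub>H\<^esub> v" w] inprod_commute[of u w] inprod_commute[of v w]
  by (simp add: inprod_diff_left)

lemma inprod_smult_right:
  assumes "v \<in> carrier H" "w \<in> carrier H"
  shows "inprod H w (a \<odot>\<^bsub>H\<^esub> v) = cnj a * inprod H w v"
  using assms inprod_commute[of "a \<odot>\<^bsub>H\<^esub> v" w] inprod_commute[of v w]
  by (simp add: inprod_smult_left)

lemma inprod_nonneg: "v \<in> carrier H \<Longrightarrow> Re (inprod H v v) \<ge> 0"
  using inprod_pos[of v] by (cases "v = \<zero>\<^bsub>H\<^esub>") auto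

lemma inprod_self_real: "v \<in> carrier H \<Longrightarrow> inprod H v v = of_real (Re (inprod H v v))"
  using inprod_commute[of v v] by (simp add: complex_eq_iff)

lemma inprod_self_eq_0: "v \<in> carrier H \<Longrightarrow> Re (inprod H v v) = 0 \<longleftrightarrow> v = \<zero>\<^bsub>H\<^esub>"
  using inprod_pos[of v] by (cases "v = \<zero>\<^bsub>H\<^esub>") auto

lemma Cauchy_Schwarz:
  assumes v: "v \<in> carrier H" and w: "w \<in> carrier H"
  shows "cmod (inprod H v w) \<le> sqrt (Re (inprod H v v)) * sqrt (Re (inprod H w w))"
proof (cases "w = \<zero>\<^bsub>H\<^esub>")
  case True
  then show ?thesis using v inprod_commute[OF w v] by simp
next
  case False
  define c where "c = inprod H v w"
  define N where "N = Re (inprod H w w)"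
  have N: "N > 0" "inprod H w w = of_real N"
    using False w inprod_pos inprod_self_real by (auto simp: N_def)
  define a where "a = c / of_real N"
  define u where "u = v \<ominus>\<^bsub>H\<^esub> a \<odot>\<^bsub>H\<^esub> w"
  have u: "u \<in> carrier H" using v w by (simp add: u_def)
  have wv: "inprod H w v = cnj c" using inprod_commute[OF v w] by (simp add: c_def)
  have "inprod H u u = inprod H v v - cnj a * c - (a * cnj c - a * (cnj a * of_real N))"
    using v w by (simp add: u_def inprod_diff_left inprod_diff_right inprod_smult_left
        inprod_smult_right wv c_def[symmetric] N(2) algebra_simps)
  also have "\<dots> = inprod H v v - cnj a * c"
    using N by (simp add: a_def)
  also have "cnj a * c = of_real ((cmod c)\<^sup>2 / N)"
    by (simp add: a_def complex_norm_square mult.commute del: of_real_power)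
  finally have "inprod H u u = inprod H v v - of_real ((cmod c)\<^sup>2 / N)" .
  then have "0 \<le> Re (inprod H v v) - (cmod c)\<^sup>2 / N"
    using inprod_nonneg[OF u] by (metis Re_complex_of_real minus_complex.sel(1))
  then have "(cmod c)\<^sup>2 \<le> Re (inprod H v v) * N"
    using N by (simp add: field_simps)
  then show ?thesis
    unfolding c_def[symmetric] N_def[symmetric] real_sqrt_mult[symmetric]
    by (rule real_le_rsqrt)
qed

lemma minus_eq_zero_iff:
  assumes "v \<in> carrier H" "w \<in> carrier H"
  shows "v \<ominus>\<^bsub>H\<^esub> w = \<zero>\<^bsub>H\<^esub> \<longleftrightarrow> v = w"
proof
  assume "v \<ominus>\<^bsub>H\<^esub> w = \<zero>\<^bsub>H\<^esub>"
  then have "(v \<ominus>\<^bsub>H\<^esub> w) \<oplus>\<^bsub>H\<^esub> w = w" using assms by simp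
  then show "v = w" using assms by (simp add: a_minus_def M.a_assoc M.l_neg)
qed (use assms in \<open>simp add: a_minus_def M.r_neg\<close>)

lemma hdist_triangle:
  assumes "u \<in> carrier H" "v \<in> carrier H" "w \<in> carrier H"
  shows "hdist H u w \<le> hdist H u v + hdist H v w"
proof -
  define p where "p = u \<ominus>\<^bsub>H\<^esub> v"
  define q where "q = v \<ominus>\<^bsub>H\<^esub> w"
  have pq: "p \<in> carrier H" "q \<in> carrier H" using assms by (auto simp: p_def q_def)
  let ?n = "\<lambda>v. sqrt (Re (inprod H v v))"
  have sq: "(?n v)\<^sup>2 = Re (inprod H v v)" if "v \<in> carrier H" for v
    using inprod_nonneg[OF that] by simp
  have "inprod H (u \<ominus>\<^bsub>H\<^esub> w) (u \<ominus>\<^bsub>H\<^esub> w) = inprod H (p \<oplus>\<^bsub>H\<^esub> q) (p \<oplus>\<^bsub>H\<^esub> q)"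
    using assms pq unfolding p_def q_def
    by (simp add: inprod_diff_left inprod_diff_right inprod_add_left inprod_add_right)
  also have "\<dots> = inprod H p p + inprod H q q + (inprod H p q + cnj (inprod H p q))"
    using pq inprod_commute[of p q] by (simp add: inprod_add_left inprod_add_right)
  finally have "Re (inprod H (u \<ominus>\<^bsub>H\<^esub> w) (u \<ominus>\<^bsub>H\<^esub> w)) = (?n p)\<^sup>2 + (?n q)\<^sup>2 + 2 * Re (inprod H p q)"
    using pq sq by simp
  also have "\<dots> \<le> (?n p)\<^sup>2 + (?n q)\<^sup>2 + 2 * (?n p * ?n q)"
    using Cauchy_Schwarz[OF pq] complex_Re_le_cmod[of "inprod H p q"] by linarith
  also have "\<dots> = (?n p + ?n q)\<^sup>2" by (simp add: power2_sum)
  finally have "?n (u \<ominus>\<^bsub>H\<^esub> w) \<le> ?n p + ?n q"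
    using pq inprod_nonneg by (intro real_le_lsqrt) auto
  then show ?thesis using assms by (simp add: hdist_def p_def q_def)
qed

lemma hdist_Metric_space: "Metric_space (carrier H) (hdist H)"
proof
  show "0 \<le> hdist H x y" for x y
    using inprod_nonneg[of "x \<ominus>\<^bsub>H\<^esub> y"] by (simp add: hdist_def)
  show "hdist H x y = hdist H y x" for x y
    by (simp add: hdist_def inprod_diff_left inprod_diff_right)
  show "hdist H x y = 0 \<longleftrightarrow> x = y" if "x \<in> carrier H" "y \<in> carrier H" for x y
    using that by (simp add: hdist_def inprod_self_eq_0 minus_eq_zero_iff)
  show "hdist H x z \<le> hdist H x y + hdist H y z"
    if "x \<in> carrier H" "y \<in> carrier H" "z \<in> carrier H" for x y z
    using that by (rule hdist_triangle)
qed

end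

text \<open>
  The type chosen in \<open>irreducibly_faithful\<close> is harmless: mapping \<open>v\<close> to its matrix coefficients
  \<open>x \<mapsto> inprod H v (\<pi> x \<xi>)\<close>, for any fixed nonzero \<open>\<xi>\<close>, is injective by irreducibility.
\<close>

lemma (in unitary_rep) rep_closed:
  "\<lbrakk>x \<in> carrier G; v \<in> carrier H\<rbrakk> \<Longrightarrow> \<pi> x v \<in> carrier H"
  using surj_prop by blast

lemma (in irreducible_unitary_rep) matrix_coefficients_inj:
  assumes \<xi>: "\<xi> \<in> carrier H" "\<xi> \<noteq> \<zero>\<^bsub>H\<^esub>"
  shows "inj_on (\<lambda>v x. if x \<in> carrier G then inprod H v (\<pi> x \<xi>) else 0) (carrier H)"
proof -
  interpret G: group G using group_hom group_hom.axioms(1) by blast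
  interpret MS: Metric_space "carrier H" "hdist H" by (rule hdist_Metric_space)
  define W where "W = {v \<in> carrier H. \<forall>x\<in>carrier G. inprod H v (\<pi> x \<xi>) = 0}"
  have sub: "submodule W (ring_of_type_algebra :: complex ring) H"
    by (rule submoduleI) (auto simp: W_def inprod_add_left inprod_smult_left \<xi> rep_closed)
  have clo: "closedin MS.mtopology W"
    unfolding MS.closedin_metric
  proof (intro conjI allI impI)
    show "W \<subseteq> carrier H" by (auto simp: W_def)
    fix v assume "v \<in> carrier H - W"
    then obtain x where v: "v \<in> carrier H" and x: "x \<in> carrier G" and c: "inprod H v (\<pi> x \<xi>) \<noteq> 0"
      by (auto simp: W_def)
    define u where "u = \<pi> x \<xi>"
    have u: "u \<in> carrier H" using x \<xi> by (simp add: u_def rep_closed)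
    define N where "N = sqrt (Re (inprod H u u))"
    have "N \<noteq> 0"
      using Cauchy_Schwarz[OF v u] c by (auto simp: N_def u_def[symmetric])
    then have N: "N > 0" using inprod_nonneg[OF u] by (simp add: N_def less_le)
    define r where "r = cmod (inprod H v u) / N"
    have "r > 0" using N c by (simp add: r_def u_def)
    moreover have "disjnt W (MS.mball v r)"
    proof -
      have False if w: "w \<in> W" "hdist H v w < r" for w
      proof -
        have wH: "w \<in> carrier H" and w0: "inprod H w u = 0" using w x by (auto simp: W_def u_def)
        have "cmod (inprod H v u) = cmod (inprod H (v \<ominus>\<^bsub>H\<^esub> w) u)"
          using v wH u w0 by (simp add: inprod_diff_left)
        also have "\<dots> \<le> hdist H v w * N"
          using Cauchy_Schwarz[of "v \<ominus>\<^bsub>H\<^esub> w" u] v wH u by (simp add: hdist_def N_def)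
        also have "\<dots> < r * N" using w(2) N by simp
        also have "\<dots> = cmod (inprod H v u)" using N by (simp add: r_def)
        finally show False by simp
      qed
      then show ?thesis by (auto simp: disjnt_iff)
    qed
    ultimately show "\<exists>r>0. disjnt W (MS.mball v r)" by blast
  qed
  have inv: "\<pi> y ` W \<subseteq> W" if y: "y \<in> carrier G" for y
  proof safe
    fix v assume v: "v \<in> W"
    then have vH: "v \<in> carrier H" by (simp add: W_def)
    have "inprod H (\<pi> y v) (\<pi> x \<xi>) = 0" if x: "x \<in> carrier G" for x
    proof -
      have "\<pi> x \<xi> = \<pi> (y \<otimes>\<^bsub>G\<^esub> (inv\<^bsub>G\<^esub> y \<otimes>\<^bsub>G\<^esub> x)) \<xi>"
        using x y by (simp add: G.m_assoc[symmetric])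
      also have "\<dots> = \<pi> y (\<pi> (inv\<^bsub>G\<^esub> y \<otimes>\<^bsub>G\<^esub> x) \<xi>)"
        using x y \<xi> by (intro composition_rule) auto
      finally show ?thesis
        using v vH x y \<xi> by (simp add: rep_inprod rep_closed W_def)
    qed
    then show "\<pi> y v \<in> W" using vH y by (simp add: W_def rep_closed)
  qed
  have "\<xi> \<notin> W"
  proof
    assume "\<xi> \<in> W"
    then have "inprod H \<xi> (\<pi> \<one>\<^bsub>G\<^esub> \<xi>) = 0" by (simp add: W_def)
    then have "inprod H \<xi> \<xi> = 0"
      using id_eq_one[symmetric] \<xi> by simp
    then show False using inprod_pos[OF \<xi>] by simp
  qed
  then have W: "W = {\<zero>\<^bsub>H\<^esub>}"
    using irreducible[of W] sub clo inv \<xi> unfolding closed_subspace_def by blast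
  show ?thesis
  proof (rule inj_onI)
    fix v w assume v: "v \<in> carrier H" and w: "w \<in> carrier H"
      and eq: "(\<lambda>x. if x \<in> carrier G then inprod H v (\<pi> x \<xi>) else 0) =
               (\<lambda>x. if x \<in> carrier G then inprod H w (\<pi> x \<xi>) else 0)"
    have "inprod H v (\<pi> x \<xi>) = inprod H w (\<pi> x \<xi>)" if "x \<in> carrier G" for x
      using fun_cong[OF eq, of x] that by simp
    then have "v \<ominus>\<^bsub>H\<^esub> w \<in> W" using v w \<xi> by (simp add: W_def inprod_diff_left rep_closed)
    then show "v = w" using W v w by (simp add: minus_eq_zero_iff)
  qed
qed

lemma (in irreducible_unitary_rep) transport:
  fixes f :: "'c \<Rightarrow> 'k"
  assumes inj: "inj_on f (carrier H)"
  obtains K \<rho> where "irreducible_unitary_rep G K \<rho>" "carrier K = f ` carrier H"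
    "\<And>x v. \<lbrakk>x \<in> carrier G; v \<in> carrier H\<rbrakk> \<Longrightarrow> \<rho> x (f v) = f (\<pi> x v)"
proof -
  interpret G: group G using group_hom group_hom.axioms(1) by blast
  interpret MS: Metric_space "carrier H" "hdist H" by (rule hdist_Metric_space)
  define g where "g = inv_into (carrier H) f"
  have gf [simp]: "g (f v) = v" if "v \<in> carrier H" for v
    using that inj by (simp add: g_def)
  define K :: "'k inner_space" where
    "K = \<lparr>carrier = f ` carrier H, monoid.mult = undefined, one = undefined, ring.zero = f \<zero>\<^bsub>H\<^esub>,
          add = (\<lambda>u v. f (g u \<oplus>\<^bsub>H\<^esub> g v)), module.smult = (\<lambda>a u. f (a \<odot>\<^bsub>H\<^esub> g u)),
          inprod = (\<lambda>u v. inprod H (g u) (g v))\<rparr>"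
  define \<rho> where "\<rho> = (\<lambda>x. \<lambda>u\<in>f ` carrier H. f (\<pi> x (g u)))"
  have K [simp]: "carrier K = f ` carrier H" "\<zero>\<^bsub>K\<^esub> = f \<zero>\<^bsub>H\<^esub>"
    "u \<oplus>\<^bsub>K\<^esub> v = f (g u \<oplus>\<^bsub>H\<^esub> g v)" "a \<odot>\<^bsub>K\<^esub> u = f (a \<odot>\<^bsub>H\<^esub> g u)"
    "inprod K u v = inprod H (g u) (g v)" for u v a
    by (simp_all add: K_def)
  have f_eq [simp]: "f v = f w \<longleftrightarrow> v = w" if "v \<in> carrier H" "w \<in> carrier H" for v w
    using that inj by (auto simp: inj_on_def)
  have abK: "abelian_group K"
    by (rule abelian_groupI) (auto simp: M.a_ac intro: bexI[of _ "\<ominus>\<^bsub>H\<^esub> _"] M.l_neg)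
  have modK: "module (ring_of_type_algebra :: complex ring) K"
    by (rule moduleI[OF R.is_cring abK])
      (use smult_l_distr smult_r_distr smult_assoc1 smult_one in auto)
  interpret K: complex_inner_space K
    by (intro complex_inner_space.intro modK complex_inner_space_axioms.intro)
      (auto simp: inprod_add_left inprod_smult_left inprod_pos intro: inprod_commute)
  interpret MK: Metric_space "carrier K" "hdist K" by (rule K.hdist_Metric_space)
  have minusK: "\<ominus>\<^bsub>K\<^esub> f v = f (\<ominus>\<^bsub>H\<^esub> v)" if "v \<in> carrier H" for v
    by (rule K.M.minus_equality) (use that in \<open>auto simp: M.l_neg\<close>)
  have dist: "hdist K (f v) (f w) = hdist H v w" if "v \<in> carrier H" "w \<in> carrier H" for v w
    using that by (simp add: hdist_def a_minus_def minusK)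
  have complK: "MK.mcomplete"
    unfolding MK.mcomplete_def
  proof (intro allI impI)
    fix \<sigma> assume \<sigma>: "MK.MCauchy \<sigma>"
    have r: "\<sigma> n \<in> f ` carrier H" for n using \<sigma> unfolding MK.MCauchy_def by auto
    then have gr: "g (\<sigma> n) \<in> carrier H" "f (g (\<sigma> n)) = \<sigma> n" for n
      by (auto simp: g_def inv_into_into f_inv_into_f)
    have "hdist H (g (\<sigma> n)) (g (\<sigma> m)) = hdist K (\<sigma> n) (\<sigma> m)" for n m
      using dist[of "g (\<sigma> n)" "g (\<sigma> m)"] gr by simp
    then have "MS.MCauchy (\<lambda>n. g (\<sigma> n))"
      using \<sigma> gr unfolding MK.MCauchy_def MS.MCauchy_def by auto
    then obtain l where l: "limitin MS.mtopology (\<lambda>n. g (\<sigma> n)) l sequentially"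
      using complete by (auto simp: MS.mcomplete_def)
    then have "limitin MK.mtopology \<sigma> (f l) sequentially"
      using r gr dist[of "g (\<sigma> _)" l]
      unfolding MK.limit_metric_sequentially MS.limit_metric_sequentially by auto
    then show "\<exists>x. limitin MK.mtopology \<sigma> x sequentially" by blast
  qed
  have \<rho>f [simp]: "\<rho> x (f v) = f (\<pi> x v)" if "v \<in> carrier H" for x v
    using that by (simp add: \<rho>_def)
  have \<rho>_ext: "\<rho> x \<in> extensional (carrier K)" for x by (simp add: \<rho>_def)
  have \<rho>_bij: "\<rho> x \<in> Bij (carrier K)" if x: "x \<in> carrier G" for x
  proof -
    have "inj_on (\<rho> x) (f ` carrier H)"
      using inj_prop[OF x] x by (auto simp: inj_on_def rep_closed)
    moreover have "\<rho> x ` f ` carrier H = f ` \<pi> x ` carrier H"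
      by (auto simp: image_image)
    ultimately show ?thesis
      using \<rho>_ext surj_prop[OF x] by (simp add: Bij_def bij_betw_def)
  qed
  have ga: "group_action G (carrier K) \<rho>"
  proof (intro group_action.intro group_hom.intro group_hom_axioms.intro homI)
    show "group G" by (rule G.is_group)
    show "group (BijGroup (carrier K))" by (rule group_BijGroup)
    show "\<rho> x \<in> carrier (BijGroup (carrier K))" if "x \<in> carrier G" for x
      using \<rho>_bij[OF that] by (simp add: BijGroup_def)
    fix x y assume xy: "x \<in> carrier G" "y \<in> carrier G"
    have "\<rho> (x \<otimes>\<^bsub>G\<^esub> y) = compose (carrier K) (\<rho> x) (\<rho> y)"
    proof (rule extensionalityI[OF \<rho>_ext compose_extensional])
      fix u assume "u \<in> carrier K"
      then show "\<rho> (x \<otimes>\<^bsub>G\<^esub> y) u = compose (carrier K) (\<rho> x) (\<rho> y) u"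
        using xy by (auto simp: compose_eq rep_closed composition_rule)
    qed
    then show "\<rho> (x \<otimes>\<^bsub>G\<^esub> y) = \<rho> x \<otimes>\<^bsub>BijGroup (carrier K)\<^esub> \<rho> y"
      using xy \<rho>_bij by (simp add: BijGroup_def)
  qed
  have "unitary_rep G K \<rho>"
    by (intro unitary_rep.intro hilbert_space.intro hilbert_space_axioms.intro
        unitary_rep_axioms.intro K.complex_inner_space_axioms complK ga)
      (auto simp: rep_add rep_smult rep_inprod rep_closed)
  moreover have "irreducible_unitary_rep_axioms G K \<rho>"
  proof
    show "carrier K \<noteq> {\<zero>\<^bsub>K\<^esub>}"
    proof
      assume "carrier K = {\<zero>\<^bsub>K\<^esub>}"
      then have "v = \<zero>\<^bsub>H\<^esub>" if "v \<in> carrier H" for v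
        using that f_eq[OF that M.zero_closed] by (metis K(1,2) imageI singletonD)
      then show False using nonzero by auto
    qed
    fix W assume W: "closed_subspace W K" and inv: "\<forall>x\<in>carrier G. \<rho> x ` W \<subseteq> W"
    have sub: "submodule W (ring_of_type_algebra :: complex ring) K"
      and clo: "closedin MK.mtopology W" using W by (auto simp: closed_subspace_def)
    have WK: "W \<subseteq> f ` carrier H" using K.submoduleE(1)[OF sub] by simp
    define V where "V = {v \<in> carrier H. f v \<in> W}"
    have WV: "W = f ` V" using WK by (auto simp: V_def)
    have z: "f \<zero>\<^bsub>H\<^esub> \<in> W"
      using subgroup.one_closed[OF submodule.axioms(1)[OF sub]] by simp
    have subV: "submodule V (ring_of_type_algebra :: complex ring) H"
    proof (rule submoduleI)
      show "V \<subseteq> carrier H" "\<zero>\<^bsub>H\<^esub> \<in> V" using z by (auto simp: V_def)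
      show "\<ominus>\<^bsub>H\<^esub> a \<in> V" if "a \<in> V" for a
        using that K.submoduleE(3)[OF sub, of "f a"] by (auto simp: V_def minusK)
      show "a \<oplus>\<^bsub>H\<^esub> b \<in> V" if "a \<in> V" "b \<in> V" for a b
        using that K.submoduleE(5)[OF sub, of "f a" "f b"] by (auto simp: V_def)
      show "a \<odot>\<^bsub>H\<^esub> x \<in> V" if "a \<in> carrier ring_of_type_algebra" "x \<in> V" for a x
        using that K.submoduleE(4)[OF sub, of a "f x"] by (auto simp: V_def)
    qed
    have "closedin MS.mtopology V"
      unfolding MS.closedin_metric
    proof (intro conjI allI impI)
      show "V \<subseteq> carrier H" by (auto simp: V_def)
      fix v assume v: "v \<in> carrier H - V"
      then have "f v \<in> carrier K - W" by (auto simp: V_def)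
      then obtain r where "r > 0" "disjnt W (MK.mball (f v) r)"
        using clo unfolding MK.closedin_metric by blast
      then show "\<exists>r>0. disjnt V (MS.mball v r)"
        using v unfolding disjnt_iff MS.in_mball MK.in_mball
        by (intro exI[of _ r]) (auto simp: V_def dist)
    qed
    then have "closed_subspace V H" using subV by (simp add: closed_subspace_def)
    moreover have "\<forall>x\<in>carrier G. \<pi> x ` V \<subseteq> V"
    proof (intro ballI subsetI)
      fix x u assume x: "x \<in> carrier G" and "u \<in> \<pi> x ` V"
      then obtain v where v: "v \<in> carrier H" "f v \<in> W" "u = \<pi> x v" by (auto simp: V_def)
      then have "\<rho> x (f v) \<in> W" using inv x by blast
      then show "u \<in> V" using v x by (simp add: V_def rep_closed)
    qed
    ultimately have "V = {\<zero>\<^bsub>H\<^esub>} \<or> V = carrier H" by (rule irreducible)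
    then show "W = {\<zero>\<^bsub>K\<^esub>} \<or> W = carrier K" using WV by auto
  qed
  ultimately have "irreducible_unitary_rep G K \<rho>" by (rule irreducible_unitary_rep.intro)
  then show thesis using K(1) by (rule that) simp
qed

theorem irreducibly_faithful_any_type:
  fixes H :: "'h inner_space" and G :: "('a, 'b) monoid_scheme"
  assumes "irreducible_unitary_rep G H \<pi>" and F: "F \<subseteq> carrier G"
    and faithful: "\<forall>x\<in>F. x \<noteq> \<one>\<^bsub>G\<^esub> \<longrightarrow> \<pi> x \<noteq> (\<lambda>v\<in>carrier H. v)"
  shows "irreducibly_faithful G F"
proof -
  interpret irreducible_unitary_rep G H \<pi> by fact
  obtain \<xi> where \<xi>: "\<xi> \<in> carrier H" "\<xi> \<noteq> \<zero>\<^bsub>H\<^esub>"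
    using nonzero M.zero_closed by blast
  define f where "f = (\<lambda>v x. if x \<in> carrier G then inprod H v (\<pi> x \<xi>) else 0)"
  have inj: "inj_on f (carrier H)"
    unfolding f_def by (rule matrix_coefficients_inj[OF \<xi>])
  obtain K \<rho> where K: "irreducible_unitary_rep G K \<rho>" "carrier K = f ` carrier H"
    and \<rho>: "\<And>x v. \<lbrakk>x \<in> carrier G; v \<in> carrier H\<rbrakk> \<Longrightarrow> \<rho> x (f v) = f (\<pi> x v)"
    by (rule transport[OF inj]) blast
  have "\<rho> x \<noteq> (\<lambda>v\<in>carrier K. v)" if x: "x \<in> F" "x \<noteq> \<one>\<^bsub>G\<^esub>" for x
  proof
    assume eq: "\<rho> x = (\<lambda>v\<in>carrier K. v)"
    have xG: "x \<in> carrier G" using x F by blast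
    have "\<pi> x v = v" if v: "v \<in> carrier H" for v
    proof -
      have "f (\<pi> x v) = f v" using \<rho>[OF xG v] v by (simp add: eq K)
      then show ?thesis using inj v xG rep_closed by (auto simp: inj_on_def)
    qed
    moreover have "\<pi> x \<in> extensional (carrier H)"
      using bij_prop0[OF xG] by (simp add: Bij_def)
    ultimately have "\<pi> x = (\<lambda>v\<in>carrier H. v)"
      by (intro extensionalityI[of _ "carrier H"]) auto
    then show False using faithful x by blast
  qed
  then show ?thesis using K(1) unfolding irreducibly_faithful_def by blast
qed

end

theory Submission
  imports Defs
begin

text \<open>
  For the forward direction let \<open>F\<close> be a finite set of nontrivial elements and attach to each
  \<open>x \<in> F\<close> the uniform probability \<open>a\<^sub>x\<close> on a finite subset of its normal closure. A
  representation trivial on \<open>x\<close> gives \<open>\<phi>(a\<^sub>x\<^sup>* a\<^sub>x) = 1\<close> for each of its states \<open>\<phi>\<close>, so an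
  extreme state with \<open>\<Sum>\<^sub>x \<phi>(a\<^sub>x\<^sup>* a\<^sub>x) < 1\<close> yields, by the construction of Gelfand, Naimark and
  Segal, an irreducible representation trivial on no element of \<open>F\<close>. Extreme states with this
  property exist as soon as some state has it: subtract from the sum a small strictly convex term,
  available since \<open>G\<close> is countable, and minimise over the compact set of states.

  The starting state is the autocorrelation of a finitely supported function \<open>q\<close>. Elements with
  infinite normal closure contribute arbitrarily little. The others have a finite minimal normal
  subgroup \<open>M\<close> in their normal closure, which is noncommutative or central of prime order. Those of
  the first kind and the central ones of order less than \<open>n\<close>, of which there is at most one for
  each prime, are independent, so that \<open>q\<close> can be chosen with vanishing sums over all their
  cosets. The remaining ones contribute \<open>1 / |M| \<le> 1 / n\<close> each; if all \<open>n\<close> elements are of this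
  last kind, \<open>q\<close> is chosen to annihilate one of the subgroups.

  Conversely, if \<open>x\<close> and \<open>y\<close> generate a central \<open>C\<^sub>p \<times> C\<^sub>p\<close>, then in an irreducible representation
  nontrivial on \<open>y\<close> and on all \<open>x y\<^sup>j\<close> the sums over the \<open>p + 1\<close> subgroups generated by these
  elements vanish, and adding them up gives \<open>p \<cdot> id = 0\<close>.
\<close>

section \<open>Completion of a semi-inner product space\<close>

text \<open>The bound \<open>1\<close> is a budget shared by at most \<open>n\<close> elements, so
  each may spend \<open>1 / n\<close> and one must spend strictly less. Averaging over a finite
  normal subgroup \<open>M\<close> projects to the \<open>M\<close>-fixed part: a vector
  \<open>q\<close> of the right regular representation whose sums over the cosets of
  \<open>M\<close> vanish pays nothing, while a state that vanishes on \<open>M\<close> outside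
  \<open>\<one>\<close> pays \<open>1 / |M|\<close>. The obstacle is that not all subgroups can be
  annihilated at once: inside a central square of order \<open>p * p\<close> the
  \<open>p + 1\<close> subgroups of order \<open>p\<close> force \<open>q = 0\<close>, and for
  \<open>p \<ge> n\<close> such squares are allowed. Annihilation therefore needs independence, and
  what is left out must have order at least \<open>n\<close>. The bound \<open>p \<le> n - 1\<close>
  has the same origin: \<open>p + 1\<close> elements, one for each subgroup of order
  \<open>p\<close>, form the obstruction. Passing to an irreducible representation needs no direct
  integral, because the total is affine in the state. Normal closures enter because the kernel of a
  representation is normal; their minimal subgroups are where commutativity and order can be
  controlled.\<close>

locale semi_inner_space =
  fixes ip :: "'v \<Rightarrow> 'v \<Rightarrow> complex" and plus :: "'v \<Rightarrow> 'v \<Rightarrow> 'v" and scale :: "complex \<Rightarrow> 'v \<Rightarrow> 'v"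
  assumes ip_plus_left: "ip (plus f g) h = ip f h + ip g h"
    and ip_scale_left: "ip (scale a f) h = a * ip f h"
    and ip_commute: "ip g f = cnj (ip f g)"
    and ip_nonneg: "0 \<le> Re (ip f f)"
begin

lemma ip_plus_right: "ip h (plus f g) = ip h f + ip h g"
  using ip_commute[of h "plus f g"] ip_commute[of h f] ip_commute[of h g] by (simp add: ip_plus_left)

lemma ip_scale_right: "ip h (scale a f) = cnj a * ip h f"
  using ip_commute[of h "scale a f"] ip_commute[of h f] by (simp add: ip_scale_left)

text \<open>The type \<open>'v\<close> need not carry a vector space: for lists under
  \<open>(@)\<close>, \<open>sub f f\<close> is not a fixed zero vector. Identities between vectors
  are therefore used only after applying \<open>ip\<close>.\<close>

definition sub :: "'v \<Rightarrow> 'v \<Rightarrow> 'v" where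
  "sub f g = plus f (scale (-1) g)"

definition nrm :: "'v \<Rightarrow> real" where
  "nrm f = sqrt (Re (ip f f))"

lemma ip_sub_left: "ip (sub f g) h = ip f h - ip g h"
  by (simp add: sub_def ip_plus_left ip_scale_left)

lemma ip_sub_right: "ip h (sub f g) = ip h f - ip h g"
  by (simp add: sub_def ip_plus_right ip_scale_right)

lemma ip_self: "ip f f = of_real ((nrm f)\<^sup>2)"
  using ip_commute[of f f] by (simp add: nrm_def ip_nonneg complex_eq_iff)

lemma nrm_nonneg [simp]: "0 \<le> nrm f"
  by (simp add: nrm_def ip_nonneg)

text \<open>A null vector \<open>g\<close> need not be zero, so division by \<open>nrm g\<close> may
  be impossible. Positivity of \<open>ip\<close> at \<open>sub f (scale (s * c) g)\<close> for every
  real \<open>s\<close>, with \<open>c = ip f g\<close> absorbing the phase, covers both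
  cases.\<close>

lemma cmod_ip_le: "cmod (ip f g) \<le> nrm f * nrm g"
proof -
  define c where "c = ip f g"
  have gf: "ip g f = cnj c" using ip_commute[of g f] by (simp add: c_def)
  have key: "2 * s * (cmod c)\<^sup>2 \<le> (nrm f)\<^sup>2 + s\<^sup>2 * (cmod c)\<^sup>2 * (nrm g)\<^sup>2" for s :: real
  proof -
    define a where "a = of_real s * c"
    have "ip (sub f (scale a g)) (sub f (scale a g)) =
        ip f f - cnj a * c - (a * cnj c - a * (cnj a * ip g g))"
      by (simp add: ip_sub_left ip_sub_right ip_scale_left ip_scale_right gf c_def[symmetric] algebra_simps)
    also have "\<dots> = ip f f - of_real (2 * s) * (c * cnj c) + of_real (s\<^sup>2) * (c * cnj c) * ip g g"
      by (simp add: a_def power2_eq_square algebra_simps del: complex_mult_cnj)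
    also have "\<dots> = of_real ((nrm f)\<^sup>2 - 2 * s * (cmod c)\<^sup>2 + s\<^sup>2 * (cmod c)\<^sup>2 * (nrm g)\<^sup>2)"
      unfolding ip_self complex_norm_square[symmetric] by simp
    finally show ?thesis using ip_nonneg[of "sub f (scale a g)"] by simp
  qed
  have "(cmod c)\<^sup>2 \<le> (nrm f)\<^sup>2 * (nrm g)\<^sup>2"
  proof (cases "nrm g = 0")
    case True
    have "cmod c = 0"
    proof (rule ccontr)
      assume "cmod c \<noteq> 0"
      \<comment> \<open>For this \<open>s\<close> the left side of \<open>key\<close> is
        \<open>2 + 2 * (nrm f)\<^sup>2\<close>, while the right side is
        \<open>(nrm f)\<^sup>2\<close>.\<close>
      then show False using key[of "(1 + (nrm f)\<^sup>2) / (cmod c)\<^sup>2"] True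
        by (simp add: field_simps) (use zero_le_power2[of "nrm f"] in linarith)
    qed
    then show ?thesis by simp
  next
    case False
    then have N: "(nrm g)\<^sup>2 > 0" by simp
    then have "(1 / (nrm g)\<^sup>2)\<^sup>2 * (cmod c)\<^sup>2 * (nrm g)\<^sup>2 = (cmod c)\<^sup>2 / (nrm g)\<^sup>2"
      by (simp add: power2_eq_square)
    then have "(cmod c)\<^sup>2 / (nrm g)\<^sup>2 \<le> (nrm f)\<^sup>2"
      using key[of "1 / (nrm g)\<^sup>2"] by simp
    then show ?thesis using N by (simp add: pos_divide_le_eq)
  qed
  then have "(cmod c)\<^sup>2 \<le> (nrm f * nrm g)\<^sup>2" by (simp add: power_mult_distrib)
  then show ?thesis unfolding c_def by (rule power2_le_imp_le) simp
qed

lemma nrm_plus_le: "nrm (plus f g) \<le> nrm f + nrm g"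
proof (rule power2_le_imp_le)
  have "ip (plus f g) (plus f g) = ip f f + ip g g + (ip f g + cnj (ip f g))"
    using ip_commute[of g f] by (simp add: ip_plus_left ip_plus_right)
  then have "(nrm (plus f g))\<^sup>2 = (nrm f)\<^sup>2 + (nrm g)\<^sup>2 + 2 * Re (ip f g)"
    using ip_nonneg[of f] ip_nonneg[of g] ip_nonneg[of "plus f g"] by (simp add: nrm_def)
  moreover have "Re (ip f g) \<le> nrm f * nrm g"
    using cmod_ip_le[of f g] complex_Re_le_cmod[of "ip f g"] by linarith
  ultimately show "(nrm (plus f g))\<^sup>2 \<le> (nrm f + nrm g)\<^sup>2"
    by (simp add: power2_sum)
qed simp

lemma nrm_le_sub: "nrm f \<le> nrm (sub f g) + nrm g"
proof -
  have "nrm f = nrm (plus (sub f g) g)"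
    by (simp add: nrm_def ip_sub_left ip_sub_right ip_plus_left ip_plus_right)
  then show ?thesis using nrm_plus_le by simp
qed

section \<open>Cauchy sequences and their inner products\<close>

definition cauchy_seq :: "(nat \<Rightarrow> 'v) \<Rightarrow> bool" where
  "cauchy_seq f \<longleftrightarrow> (\<forall>e>0. \<exists>N. \<forall>m\<ge>N. \<forall>n\<ge>N. nrm (sub (f m) (f n)) < e)"

lemma cauchy_seq_const: "cauchy_seq (\<lambda>_. f)"
proof -
  have "nrm (sub f f) = 0" by (simp add: nrm_def ip_sub_left)
  then show ?thesis by (simp add: cauchy_seq_def)
qed

lemma cauchy_seq_plus:
  assumes "cauchy_seq f" "cauchy_seq g"
  shows "cauchy_seq (\<lambda>n. plus (f n) (g n))"
  unfolding cauchy_seq_def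
proof (intro allI impI)
  fix e :: real assume "e > 0"
  then obtain N M where N: "\<forall>m\<ge>N. \<forall>n\<ge>N. nrm (sub (f m) (f n)) < e/2"
    and M: "\<forall>m\<ge>M. \<forall>n\<ge>M. nrm (sub (g m) (g n)) < e/2"
    using assms unfolding cauchy_seq_def by (meson half_gt_zero)
  have "nrm (sub (plus (f m) (g m)) (plus (f n) (g n))) < e" if "m \<ge> max N M" "n \<ge> max N M" for m n
  proof -
    have "nrm (sub (plus (f m) (g m)) (plus (f n) (g n))) =
        nrm (plus (sub (f m) (f n)) (sub (g m) (g n)))"
      by (simp add: nrm_def ip_sub_left ip_sub_right ip_plus_left ip_plus_right algebra_simps)
    also have "\<dots> \<le> nrm (sub (f m) (f n)) + nrm (sub (g m) (g n))" by (rule nrm_plus_le)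
    also have "\<dots> < e/2 + e/2" using N M that by (intro add_strict_mono) auto
    finally show ?thesis by simp
  qed
  then show "\<exists>N. \<forall>m\<ge>N. \<forall>n\<ge>N. nrm (sub (plus (f m) (g m)) (plus (f n) (g n))) < e" by blast
qed

lemma nrm_scale: "nrm (scale a f) = cmod a * nrm f"
proof -
  have "ip (scale a f) (scale a f) = of_real ((cmod a)\<^sup>2) * ip f f"
    by (simp add: ip_scale_left ip_scale_right complex_norm_square mult.assoc
        del: complex_mult_cnj of_real_power)
  then have "Re (ip (scale a f) (scale a f)) = (cmod a)\<^sup>2 * Re (ip f f)"
    by (simp only: Re_complex_of_real mult.commute times_complex.sel Im_complex_of_real)
  then show ?thesis by (simp add: nrm_def real_sqrt_mult)
qed

lemma cauchy_seq_scale: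
  assumes "cauchy_seq f"
  shows "cauchy_seq (\<lambda>n. scale a (f n))"
  unfolding cauchy_seq_def
proof (intro allI impI)
  fix e :: real assume "e > 0"
  then obtain N where N: "\<forall>m\<ge>N. \<forall>n\<ge>N. nrm (sub (f m) (f n)) < e / (cmod a + 1)"
    using assms unfolding cauchy_seq_def
    by (metis add_nonneg_pos divide_pos_pos norm_ge_zero zero_less_one)
  have "nrm (sub (scale a (f m)) (scale a (f n))) < e" if "m \<ge> N" "n \<ge> N" for m n
  proof -
    have "nrm (sub (scale a (f m)) (scale a (f n))) = nrm (scale a (sub (f m) (f n)))"
      by (simp add: nrm_def ip_sub_left ip_sub_right ip_scale_left ip_scale_right algebra_simps)
    also have "\<dots> = cmod a * nrm (sub (f m) (f n))" by (rule nrm_scale)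
    also have "\<dots> \<le> cmod a * (e / (cmod a + 1))"
      using N that by (intro mult_left_mono) (auto intro: less_imp_le)
    also have "\<dots> < e"
    proof -
      have "cmod a / (cmod a + 1) < 1" by (simp add: divide_less_eq add_nonneg_pos)
      from mult_strict_left_mono[OF this \<open>e > 0\<close>] show ?thesis by (simp add: mult.commute)
    qed
    finally show ?thesis .
  qed
  then show "\<exists>N. \<forall>m\<ge>N. \<forall>n\<ge>N. nrm (sub (scale a (f m)) (scale a (f n))) < e" by blast
qed

lemma cauchy_seq_sub:
  "cauchy_seq f \<Longrightarrow> cauchy_seq g \<Longrightarrow> cauchy_seq (\<lambda>n. sub (f n) (g n))"
  unfolding sub_def by (intro cauchy_seq_plus cauchy_seq_scale)

lemma cauchy_seq_bounded:
  assumes "cauchy_seq f"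
  obtains B where "B > 0" "eventually (\<lambda>n. nrm (f n) \<le> B) sequentially"
proof -
  obtain N where N: "\<forall>m\<ge>N. \<forall>n\<ge>N. nrm (sub (f m) (f n)) < 1"
    using assms unfolding cauchy_seq_def by (meson zero_less_one)
  have "nrm (f n) \<le> 1 + nrm (f N)" if "n \<ge> N" for n
    using nrm_le_sub[of "f n" "f N"] N that by (smt (verit) order_refl)
  then have "eventually (\<lambda>n. nrm (f n) \<le> 1 + nrm (f N)) sequentially"
    unfolding eventually_sequentially by blast
  then show thesis by (rule that[rotated]) (simp add: add_pos_nonneg)
qed

lemma tendsto_ip_null:
  assumes "(\<lambda>n. nrm (f n)) \<longlonglongrightarrow> 0" "cauchy_seq g"
  shows "(\<lambda>n. ip (f n) (g n)) \<longlonglongrightarrow> 0" "(\<lambda>n. ip (g n) (f n)) \<longlonglongrightarrow> 0"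
proof -
  obtain B where B: "eventually (\<lambda>n. nrm (g n) \<le> B) sequentially"
    using cauchy_seq_bounded[OF assms(2)] by blast
  have lim: "(\<lambda>n. nrm (f n) * B) \<longlonglongrightarrow> 0"
    using tendsto_mult_right[OF assms(1), of B] by simp
  have 1: "eventually (\<lambda>n. norm (ip (f n) (g n)) \<le> nrm (f n) * B) sequentially"
    using B
  proof eventually_elim
    case (elim n)
    then show ?case
      using cmod_ip_le[of "f n" "g n"] mult_left_mono[OF elim nrm_nonneg[of "f n"]] by linarith
  qed
  show "(\<lambda>n. ip (f n) (g n)) \<longlonglongrightarrow> 0"
    by (rule Lim_null_comparison[OF 1 lim])
  have 2: "eventually (\<lambda>n. norm (ip (g n) (f n)) \<le> nrm (f n) * B) sequentially"
    using 1 by eventually_elim (metis complex_mod_cnj ip_commute)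
  show "(\<lambda>n. ip (g n) (f n)) \<longlonglongrightarrow> 0"
    by (rule Lim_null_comparison[OF 2 lim])
qed

lemma convergent_ip:
  assumes f: "cauchy_seq f" and g: "cauchy_seq g"
  shows "convergent (\<lambda>n. ip (f n) (g n))"
proof -
  obtain B where B: "B > 0" "eventually (\<lambda>n. nrm (f n) \<le> B) sequentially"
    using cauchy_seq_bounded[OF f] by blast
  obtain C where C: "C > 0" "eventually (\<lambda>n. nrm (g n) \<le> C) sequentially"
    using cauchy_seq_bounded[OF g] by blast
  obtain K where K: "\<forall>n\<ge>K. nrm (f n) \<le> B \<and> nrm (g n) \<le> C"
    using eventually_conj[OF B(2) C(2)] unfolding eventually_sequentially by blast
  have "Cauchy (\<lambda>n. ip (f n) (g n))"
  proof (rule CauchyI)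
    fix e :: real assume "e > 0"
    then have "e / 2 / B > 0" "e / 2 / C > 0" using B(1) C(1) by auto
    then obtain N M where N: "\<forall>m\<ge>N. \<forall>n\<ge>N. nrm (sub (f m) (f n)) < e / 2 / C"
      and M: "\<forall>m\<ge>M. \<forall>n\<ge>M. nrm (sub (g m) (g n)) < e / 2 / B"
      using f g unfolding cauchy_seq_def by meson
    have "norm (ip (f m) (g m) - ip (f n) (g n)) < e"
      if "m \<ge> max K (max N M)" "n \<ge> max K (max N M)" for m n
    proof -
      have "ip (f m) (g m) - ip (f n) (g n) =
          ip (sub (f m) (f n)) (g m) + ip (f n) (sub (g m) (g n))"
        by (simp add: ip_sub_left ip_sub_right)
      then have "norm (ip (f m) (g m) - ip (f n) (g n)) \<le>
          norm (ip (sub (f m) (f n)) (g m)) + norm (ip (f n) (sub (g m) (g n)))"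
        by (metis norm_triangle_ineq)
      also have "\<dots> \<le> nrm (sub (f m) (f n)) * nrm (g m) + nrm (f n) * nrm (sub (g m) (g n))"
        by (intro add_mono cmod_ip_le)
      also have "\<dots> \<le> nrm (sub (f m) (f n)) * C + B * nrm (sub (g m) (g n))"
        using K that by (intro add_mono mult_left_mono mult_right_mono) auto
      also have "\<dots> < (e / 2 / C) * C + B * (e / 2 / B)"
        using N M that B C by (intro add_strict_mono mult_strict_left_mono mult_strict_right_mono) auto
      also have "\<dots> = e" using B C by simp
      finally show ?thesis .
    qed
    then show "\<exists>M. \<forall>m\<ge>M. \<forall>n\<ge>M. norm (ip (f m) (g m) - ip (f n) (g n)) < e" by blast
  qed
  then show ?thesis by (rule Cauchy_convergent)
qed

text \<open>Splits \<open>ip (h n) (h n)\<close> into \<open>ip (h n) (sub (h n) (h N))\<close>,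
  small by the Cauchy property and boundedness, and \<open>ip (h n) (h N)\<close>, small by weak
  convergence at the single vector \<open>h N\<close>. Hence Cauchy sequences inducing the same
  functional are equivalent, and the functional can stand for their class.\<close>

lemma weakly_null_imp_null:
  assumes h: "cauchy_seq h" and w: "\<And>w. (\<lambda>n. ip (h n) w) \<longlonglongrightarrow> 0"
  shows "(\<lambda>n. nrm (h n)) \<longlonglongrightarrow> 0"
proof -
  obtain B where B: "B > 0" "eventually (\<lambda>n. nrm (h n) \<le> B) sequentially"
    using cauchy_seq_bounded[OF h] by blast
  have "(\<lambda>n. (nrm (h n))\<^sup>2) \<longlonglongrightarrow> 0"
  proof (rule LIMSEQ_I)
    fix e :: real assume "e > 0"
    then have e: "e / 2 / B > 0" using B(1) by simp
    then obtain N where N: "\<forall>m\<ge>N. \<forall>n\<ge>N. nrm (sub (h m) (h n)) < e / 2 / B"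
      using h unfolding cauchy_seq_def by meson
    obtain M where M: "\<forall>n\<ge>M. norm (ip (h n) (h N)) < e / 2"
      using LIMSEQ_D[OF w[of "h N"], of "e/2"] \<open>e > 0\<close> by auto
    obtain K where K: "\<forall>n\<ge>K. nrm (h n) \<le> B" using B(2) unfolding eventually_sequentially by blast
    have "(nrm (h n))\<^sup>2 < e" if n: "n \<ge> max N (max M K)" for n
    proof -
      have "of_real ((nrm (h n))\<^sup>2) = ip (h n) (sub (h n) (h N)) + ip (h n) (h N)"
        by (simp add: ip_sub_right ip_self)
      from arg_cong[OF this, of norm]
      have "(nrm (h n))\<^sup>2 = norm (ip (h n) (sub (h n) (h N)) + ip (h n) (h N))"
        by (simp only: norm_of_real abs_power2)
      also have "\<dots> \<le> norm (ip (h n) (sub (h n) (h N))) + norm (ip (h n) (h N))"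
        by (rule norm_triangle_ineq)
      also have "\<dots> \<le> nrm (h n) * nrm (sub (h n) (h N)) + norm (ip (h n) (h N))"
        by (intro add_right_mono cmod_ip_le)
      also have "\<dots> \<le> B * (e / 2 / B) + norm (ip (h n) (h N))"
        using K N n B(1) by (intro add_right_mono mult_mono) (auto intro: less_imp_le)
      also have "B * (e / 2 / B) = e / 2" using B(1) by simp
      also have "e / 2 + norm (ip (h n) (h N)) < e" using M n by force
      finally show ?thesis .
    qed
    then show "\<exists>no. \<forall>n\<ge>no. norm ((nrm (h n))\<^sup>2 - 0) < e"
      by (intro exI[of _ "max N (max M K)"]) auto
  qed
  from tendsto_real_sqrt[OF this] show ?thesis by simp
qed

section \<open>The completion as a space of functionals\<close>

definition represents :: "(nat \<Rightarrow> 'v) \<Rightarrow> ('v \<Rightarrow> complex) \<Rightarrow> bool" where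
  "represents f u \<longleftrightarrow> cauchy_seq f \<and> (\<forall>w. (\<lambda>n. ip (f n) w) \<longlonglongrightarrow> u w)"

definition completion_ip :: "('v \<Rightarrow> complex) \<Rightarrow> ('v \<Rightarrow> complex) \<Rightarrow> complex" where
  "completion_ip u v =
     lim (\<lambda>n. ip ((SOME f. represents f u) n) ((SOME g. represents g v) n))"

lemma represents_unique:
  assumes "represents f u" "represents f' u"
  shows "(\<lambda>n. nrm (sub (f n) (f' n))) \<longlonglongrightarrow> 0"
proof (rule weakly_null_imp_null)
  show "cauchy_seq (\<lambda>n. sub (f n) (f' n))"
    using assms by (simp add: represents_def cauchy_seq_sub)
  show "(\<lambda>n. ip (sub (f n) (f' n)) w) \<longlonglongrightarrow> 0" for w
    using assms tendsto_diff[of "\<lambda>n. ip (f n) w" "u w" sequentially "\<lambda>n. ip (f' n) w" "u w"]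
    by (simp add: represents_def ip_sub_left)
qed

text \<open>Makes the \<open>SOME\<close> in \<open>completion_ip\<close> harmless: two sequences
  representing the same functional differ by a null sequence, and a null sequence paired with a
  Cauchy sequence tends to zero.\<close>

lemma tendsto_completion_ip:
  assumes f: "represents f u" and g: "represents g v"
  shows "(\<lambda>n. ip (f n) (g n)) \<longlonglongrightarrow> completion_ip u v"
proof -
  define f' where "f' = (SOME f. represents f u)"
  define g' where "g' = (SOME g. represents g v)"
  have f': "represents f' u" unfolding f'_def by (rule someI[of "\<lambda>f. represents f u", OF f])
  have g': "represents g' v" unfolding g'_def by (rule someI[of "\<lambda>f. represents f v", OF g])
  have c: "cauchy_seq f" "cauchy_seq g" "cauchy_seq f'" "cauchy_seq g'"
    using f g f' g' by (auto simp: represents_def)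
  have 1: "(\<lambda>n. ip (f' n) (g' n)) \<longlonglongrightarrow> completion_ip u v"
    using convergent_ip[OF c(3,4)]
    by (simp only: completion_ip_def f'_def[symmetric] g'_def[symmetric] convergent_LIMSEQ_iff)
  have 2: "(\<lambda>n. ip (sub (f n) (f' n)) (g n) + ip (f' n) (sub (g n) (g' n))) \<longlonglongrightarrow> 0 + 0"
    using represents_unique[OF f f'] represents_unique[OF g g'] c
    by (intro tendsto_add tendsto_ip_null)
  have "(\<lambda>n. (ip (sub (f n) (f' n)) (g n) + ip (f' n) (sub (g n) (g' n))) + ip (f' n) (g' n))
      \<longlonglongrightarrow> (0 + 0) + completion_ip u v"
    by (intro tendsto_add[OF 2 1])
  then show ?thesis by (simp add: ip_sub_left ip_sub_right)
qed

lemma represents_const: "represents (\<lambda>_. f) (ip f)"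
  by (simp add: represents_def cauchy_seq_const)

lemma represents_plus:
  "represents f u \<Longrightarrow> represents g v \<Longrightarrow> represents (\<lambda>n. plus (f n) (g n)) (\<lambda>w. u w + v w)"
  by (auto simp: represents_def cauchy_seq_plus ip_plus_left intro: tendsto_add)

lemma represents_scale:
  "represents f u \<Longrightarrow> represents (\<lambda>n. scale a (f n)) (\<lambda>w. a * u w)"
  by (auto simp: represents_def cauchy_seq_scale ip_scale_left intro: tendsto_mult)

lemma represents_zero: "represents (\<lambda>_. scale 0 undefined) (\<lambda>_. 0)"
proof -
  have "ip (scale 0 undefined) = (\<lambda>_. 0)" by (simp add: fun_eq_iff ip_scale_left)
  then show ?thesis using represents_const[of "scale 0 undefined"] by simp
qed

text \<open>A vector of the completion is encoded by the functional it induces on the given space.\<close>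
definition completion :: "('v \<Rightarrow> complex) inner_space" where
  "completion = \<lparr>carrier = {u. \<exists>f. represents f u}, monoid.mult = undefined, one = undefined,
     ring.zero = (\<lambda>_. 0), add = (\<lambda>u v w. u w + v w), module.smult = (\<lambda>a u w. a * u w),
     inprod = completion_ip\<rparr>"

lemma completion_simps [simp]:
  "carrier completion = {u. \<exists>f. represents f u}"
  "\<zero>\<^bsub>completion\<^esub> = (\<lambda>_. 0)"
  "u \<oplus>\<^bsub>completion\<^esub> v = (\<lambda>w. u w + v w)"
  "a \<odot>\<^bsub>completion\<^esub> u = (\<lambda>w. a * u w)"
  "inprod completion = completion_ip"
  by (simp_all add: completion_def)

lemma complex_inner_space_completion: "complex_inner_space completion"
proof (intro complex_inner_space.intro complex_inner_space_axioms.intro)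
  have neg: "\<exists>f. represents f (\<lambda>w. - u w)" if "represents f u" for f u
    using represents_scale[OF that, of "-1"] by auto
  have ab: "abelian_group completion"
  proof (rule abelian_groupI)
    fix u assume "u \<in> carrier completion"
    then show "\<exists>v\<in>carrier completion. v \<oplus>\<^bsub>completion\<^esub> u = \<zero>\<^bsub>completion\<^esub>"
      by (intro bexI[of _ "\<lambda>w. - u w"]) (auto intro: neg)
  qed (auto simp: add_ac intro: represents_plus represents_zero)
  have "cring (ring_of_type_algebra :: complex ring)"
  proof (rule cringI)
    show "abelian_group (ring_of_type_algebra :: complex ring)"
      by (rule abelian_groupI) (auto simp: add_ac intro: exI[of _ "- _"])
    show "comm_monoid (ring_of_type_algebra :: complex ring)"
      by (rule comm_monoidI) (auto simp: mult_ac)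
  qed (auto simp: algebra_simps)
  then show "Module.module (ring_of_type_algebra :: complex ring) completion"
    by (rule moduleI[OF _ ab]) (auto simp: algebra_simps intro: represents_scale)
next
  fix u v w assume uvw: "u \<in> carrier completion" "v \<in> carrier completion" "w \<in> carrier completion"
  then obtain f g h where r: "represents f u" "represents g v" "represents h w" by auto
  have "(\<lambda>n. ip (plus (f n) (g n)) (h n)) \<longlonglongrightarrow> completion_ip u w + completion_ip v w"
    using r by (auto simp: ip_plus_left intro!: tendsto_add tendsto_completion_ip)
  then show "inprod completion (u \<oplus>\<^bsub>completion\<^esub> v) w = inprod completion u w + inprod completion v w"
    using LIMSEQ_unique[OF tendsto_completion_ip[OF represents_plus[OF r(1,2)] r(3)]] by simp
next
  fix v w a assume "v \<in> carrier completion" "w \<in> carrier completion"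
  then obtain g h where r: "represents g v" "represents h w" by auto
  have "(\<lambda>n. ip (scale a (g n)) (h n)) \<longlonglongrightarrow> a * completion_ip v w"
    using r by (auto simp: ip_scale_left intro!: tendsto_mult tendsto_completion_ip)
  then show "inprod completion (a \<odot>\<^bsub>completion\<^esub> v) w = a * inprod completion v w"
    using LIMSEQ_unique[OF tendsto_completion_ip[OF represents_scale[OF r(1)] r(2)]] by simp
next
  fix v w assume "v \<in> carrier completion" "w \<in> carrier completion"
  then obtain g h where r: "represents g v" "represents h w" by auto
  have "(\<lambda>n. ip (h n) (g n)) \<longlonglongrightarrow> cnj (completion_ip v w)"
    using tendsto_cnj[OF tendsto_completion_ip[OF r]] by (simp add: ip_commute[symmetric])
  then show "inprod completion w v = cnj (inprod completion v w)"
    using LIMSEQ_unique[OF tendsto_completion_ip[OF r(2,1)]] by simp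
next
  fix v assume "v \<in> carrier completion" and nz: "v \<noteq> \<zero>\<^bsub>completion\<^esub>"
  then obtain f where f: "represents f v" by auto
  have lim: "(\<lambda>n. (nrm (f n))\<^sup>2) \<longlonglongrightarrow> Re (completion_ip v v)"
    using tendsto_Re[OF tendsto_completion_ip[OF f f]] by (simp add: ip_self)
  then have "Re (completion_ip v v) \<ge> 0" by (rule LIMSEQ_le_const) auto
  moreover have "Re (completion_ip v v) \<noteq> 0"
  proof
    assume "Re (completion_ip v v) = 0"
    then have "(\<lambda>n. nrm (f n)) \<longlonglongrightarrow> 0" using tendsto_real_sqrt[OF lim] by simp
    then have "(\<lambda>n. ip (f n) w) \<longlonglongrightarrow> 0" for w
      using tendsto_ip_null(1)[OF _ cauchy_seq_const] by blast
    then have "v w = 0" for w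
      using f LIMSEQ_unique unfolding represents_def by blast
    then show False using nz by auto
  qed
  ultimately show "Re (inprod completion v v) > 0" by simp
qed

interpretation completion: complex_inner_space completion
  by (rule complex_inner_space_completion)

interpretation completion: Metric_space "carrier completion" "hdist completion"
  by (rule completion.hdist_Metric_space)

lemma tendsto_hdist_completion:
  assumes f: "represents f u" and g: "represents g v"
  shows "(\<lambda>n. nrm (sub (f n) (g n))) \<longlonglongrightarrow> hdist completion u v"
proof -
  have u: "u \<in> carrier completion" "v \<in> carrier completion" using f g by auto
  have neg: "\<ominus>\<^bsub>completion\<^esub> v = (\<lambda>w. - v w)"
    by (rule completion.M.minus_equality) (use u represents_scale[OF g, of "-1"] in auto)
  have "represents (\<lambda>n. sub (f n) (g n)) (u \<ominus>\<^bsub>completion\<^esub> v)"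
    using represents_plus[OF f represents_scale[OF g, of "-1"]]
    by (simp add: sub_def a_minus_def neg)
  from tendsto_Re[OF tendsto_completion_ip[OF this this]]
  have "(\<lambda>n. (nrm (sub (f n) (g n)))\<^sup>2) \<longlonglongrightarrow>
      Re (inprod completion (u \<ominus>\<^bsub>completion\<^esub> v) (u \<ominus>\<^bsub>completion\<^esub> v))"
    by (simp add: ip_self)
  from tendsto_real_sqrt[OF this] show ?thesis
    using u by (simp add: hdist_def del: completion_simps)
qed

lemma hdist_completion_dense:
  assumes f: "represents f u"
  shows "(\<lambda>n. hdist completion (ip (f n)) u) \<longlonglongrightarrow> 0"
proof (rule LIMSEQ_I)
  fix e :: real assume e: "e > 0"
  then obtain N where N: "\<forall>m\<ge>N. \<forall>n\<ge>N. nrm (sub (f m) (f n)) < e / 2"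
    using f unfolding represents_def cauchy_seq_def by (meson half_gt_zero)
  have "hdist completion (ip (f n)) u \<le> e / 2" if "n \<ge> N" for n
    by (rule LIMSEQ_le_const2[OF tendsto_hdist_completion[OF represents_const f]])
      (use N that in \<open>auto intro!: exI[of _ N] less_imp_le\<close>)
  then show "\<exists>no. \<forall>n\<ge>no. norm (hdist completion (ip (f n)) u - 0) < e"
    using e by (intro exI[of _ N]) (smt (verit) completion.nonneg field_sum_of_halves real_norm_def)
qed

text \<open>Diagonal argument: each member of a Cauchy sequence is replaced by a vector of the
  original space at distance below \<open>1 / real (Suc k)\<close>. The replacements form a Cauchy
  sequence there, and the functional it represents is the limit.\<close>

lemma hilbert_space_completion: "hilbert_space completion"
proof (intro hilbert_space.intro complex_inner_space_completion hilbert_space_axioms.intro)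
  show "completion.mcomplete"
    unfolding completion.mcomplete_def
  proof (intro allI impI)
    fix \<sigma> assume \<sigma>: "completion.MCauchy \<sigma>"
    have \<sigma>c: "\<sigma> k \<in> carrier completion" for k
      using \<sigma> unfolding completion.MCauchy_def by auto
    have "\<exists>g. hdist completion (ip g) (\<sigma> k) < 1 / real (Suc k)" for k
    proof -
      obtain f where f: "represents f (\<sigma> k)" using \<sigma>c[of k] by auto
      have "eventually (\<lambda>n. hdist completion (ip (f n)) (\<sigma> k) < 1 / real (Suc k)) sequentially"
        by (rule order_tendstoD(2)[OF hdist_completion_dense[OF f]]) simp
      then show ?thesis unfolding eventually_sequentially by blast
    qed
    then have "\<exists>g. \<forall>k. hdist completion (ip (g k)) (\<sigma> k) < 1 / real (Suc k)"
      by (intro choice allI)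
    then obtain g where g: "\<And>k. hdist completion (ip (g k)) (\<sigma> k) < 1 / real (Suc k)" by blast
    have gc: "ip w \<in> carrier completion" for w using represents_const by auto
    have inv: "(\<lambda>k. 1 / real (Suc k)) \<longlonglongrightarrow> 0"
      using LIMSEQ_inverse_real_of_nat by (simp add: inverse_eq_divide)
    have dist: "nrm (sub a b) = hdist completion (ip a) (ip b)" for a b
      by (rule LIMSEQ_unique[OF tendsto_const tendsto_hdist_completion[OF represents_const represents_const]])
    have cau: "cauchy_seq g"
      unfolding cauchy_seq_def
    proof (intro allI impI)
      fix e :: real assume "e > 0"
      then have e3: "e / 3 > 0" by simp
      then obtain N where N: "\<forall>m n. N \<le> m \<longrightarrow> N \<le> n \<longrightarrow> hdist completion (\<sigma> m) (\<sigma> n) < e / 3"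
        using \<sigma> unfolding completion.MCauchy_def by meson
      obtain M where M: "\<forall>n\<ge>M. 1 / real (Suc n) < e / 3"
        using order_tendstoD(2)[OF inv e3] unfolding eventually_sequentially by blast
      have "nrm (sub (g m) (g n)) < e" if mn: "m \<ge> max N M" "n \<ge> max N M" for m n
      proof -
        have "hdist completion (ip (g m)) (ip (g n)) \<le>
            hdist completion (ip (g m)) (\<sigma> m) + hdist completion (\<sigma> m) (ip (g n))"
          using gc \<sigma>c by (intro completion.triangle)
        also have "hdist completion (\<sigma> m) (ip (g n)) \<le>
            hdist completion (\<sigma> m) (\<sigma> n) + hdist completion (\<sigma> n) (ip (g n))"
          using gc \<sigma>c by (intro completion.triangle)
        finally have "nrm (sub (g m) (g n)) \<le> hdist completion (ip (g m)) (\<sigma> m) +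
            (hdist completion (\<sigma> m) (\<sigma> n) + hdist completion (ip (g n)) (\<sigma> n))"
          unfolding dist completion.commute[of "ip (g n)"] by simp
        also have "\<dots> < e / 3 + (e / 3 + e / 3)"
          using N M mn g[of m] g[of n] by (intro add_strict_mono) (auto intro: less_trans)
        finally show ?thesis by simp
      qed
      then show "\<exists>N. \<forall>m\<ge>N. \<forall>n\<ge>N. nrm (sub (g m) (g n)) < e" by blast
    qed
    define u where "u = (\<lambda>w. lim (\<lambda>n. ip (g n) w))"
    have u: "represents g u"
      unfolding represents_def u_def
      using cau convergent_ip[OF cau cauchy_seq_const] by (simp add: convergent_LIMSEQ_iff)
    have uc: "u \<in> carrier completion" using u by auto
    have "(\<lambda>k. hdist completion (\<sigma> k) u) \<longlonglongrightarrow> 0"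
    proof (rule Lim_null_comparison)
      show "(\<lambda>k. 1 / real (Suc k) + hdist completion (ip (g k)) u) \<longlonglongrightarrow> 0"
        using tendsto_add[OF inv hdist_completion_dense[OF u]] by simp
      show "\<forall>\<^sub>F k in sequentially. norm (hdist completion (\<sigma> k) u) \<le>
          1 / real (Suc k) + hdist completion (ip (g k)) u"
      proof (intro always_eventually allI)
        fix k
        show "norm (hdist completion (\<sigma> k) u) \<le> 1 / real (Suc k) + hdist completion (ip (g k)) u"
          using completion.triangle[OF \<sigma>c[of k] gc[of "g k"] uc] g[of k]
            completion.commute[of "\<sigma> k" "ip (g k)"] by simp
      qed
    qed
    then have "limitin completion.mtopology \<sigma> u sequentially"
      unfolding completion.limitin_metric_dist_null
      using \<sigma>c uc by (intro conjI always_eventually allI)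
    then show "\<exists>x. limitin completion.mtopology \<sigma> x sequentially" by blast
  qed
qed

end

section \<open>Orthogonal projections\<close>

context complex_inner_space
begin

text \<open>If \<open>inprod H v u \<noteq> 0\<close> for some \<open>u\<close> in \<open>A\<close>,
  Cauchy-Schwarz keeps the ball about \<open>v\<close> of radius
  \<open>cmod (inprod H v u) / N\<close>, where \<open>N\<close> is the norm of \<open>u\<close>,
  off the set.\<close>

lemma closed_subspace_orthogonal:
  assumes A: "A \<subseteq> carrier H"
  shows "closed_subspace {v \<in> carrier H. \<forall>u\<in>A. inprod H v u = 0} H"
proof -
  interpret MS: Metric_space "carrier H" "hdist H" by (rule hdist_Metric_space)
  define W where "W = {v \<in> carrier H. \<forall>u\<in>A. inprod H v u = 0}"
  have XH: "u \<in> carrier H" if "u \<in> A" for u using A that by blast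
  have "submodule W (ring_of_type_algebra :: complex ring) H"
    by (rule submoduleI) (auto simp: W_def inprod_add_left inprod_smult_left XH)
  moreover have "closedin MS.mtopology W"
    unfolding MS.closedin_metric
  proof (intro conjI allI impI)
    show "W \<subseteq> carrier H" by (auto simp: W_def)
    fix v assume "v \<in> carrier H - W"
    then obtain u where v: "v \<in> carrier H" and uX: "u \<in> A" and c: "inprod H v u \<noteq> 0"
      by (auto simp: W_def)
    have u: "u \<in> carrier H" by (rule XH[OF uX])
    define N where "N = sqrt (Re (inprod H u u))"
    have "N \<noteq> 0" using Cauchy_Schwarz[OF v u] c by (auto simp: N_def)
    then have N: "N > 0" using inprod_nonneg[OF u] by (simp add: N_def less_le)
    have "hdist H v w \<ge> cmod (inprod H v u) / N" if w: "w \<in> W" for w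
    proof -
      have wH: "w \<in> carrier H" and w0: "inprod H w u = 0" using w uX by (auto simp: W_def)
      have "cmod (inprod H v u) = cmod (inprod H (v \<ominus>\<^bsub>H\<^esub> w) u)"
        using v wH u w0 by (simp add: inprod_diff_left)
      also have "\<dots> \<le> hdist H v w * N"
        using Cauchy_Schwarz[of "v \<ominus>\<^bsub>H\<^esub> w" u] v wH u by (simp add: hdist_def N_def)
      finally show ?thesis using N by (simp add: pos_divide_le_eq)
    qed
    then have "disjnt W (MS.mball v (cmod (inprod H v u) / N))"
      by (force simp: disjnt_iff)
    then show "\<exists>r>0. disjnt W (MS.mball v r)" using N c by (intro exI conjI) auto
  qed
  ultimately show ?thesis unfolding W_def closed_subspace_def by blast
qed

lemma hdist_power2:
  "v \<in> carrier H \<Longrightarrow> w \<in> carrier H \<Longrightarrow> (hdist H v w)\<^sup>2 = Re (inprod H (v \<ominus>\<^bsub>H\<^esub> w) (v \<ominus>\<^bsub>H\<^esub> w))"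
  by (simp add: hdist_def inprod_nonneg)

lemma hdist_parallelogram:
  assumes "v \<in> carrier H" "a \<in> carrier H" "b \<in> carrier H"
  shows "(hdist H a b)\<^sup>2 =
    2 * (hdist H v a)\<^sup>2 + 2 * (hdist H v b)\<^sup>2 - 4 * (hdist H v ((1/2) \<odot>\<^bsub>H\<^esub> (a \<oplus>\<^bsub>H\<^esub> b)))\<^sup>2"
  using assms inprod_commute[of v a] inprod_commute[of v b] inprod_commute[of a b]
  by (simp add: hdist_power2 inprod_diff_left inprod_diff_right inprod_add_left inprod_add_right
      inprod_smult_left inprod_smult_right algebra_simps)

end

lemma (in hilbert_space) orthogonal_projection:
  assumes W: "closed_subspace W H" and v: "v \<in> carrier H"
  obtains w where "w \<in> W" "\<And>u. u \<in> W \<Longrightarrow> inprod H (v \<ominus>\<^bsub>H\<^esub> w) u = 0"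
proof -
  interpret MS: Metric_space "carrier H" "hdist H" by (rule hdist_Metric_space)
  have sub: "submodule W (ring_of_type_algebra :: complex ring) H"
    and clo: "closedin MS.mtopology W" using W by (auto simp: closed_subspace_def)
  have WH: "u \<in> carrier H" if "u \<in> W" for u using submoduleE(1)[OF sub] that by blast
  have W0: "\<zero>\<^bsub>H\<^esub> \<in> W" using subgroup.one_closed[OF submodule.axioms(1)[OF sub]] by simp
  have Wadd: "a \<oplus>\<^bsub>H\<^esub> b \<in> W" if "a \<in> W" "b \<in> W" for a b using submoduleE(5)[OF sub] that by simp
  have Wsm: "c \<odot>\<^bsub>H\<^esub> b \<in> W" if "b \<in> W" for b c using submoduleE(4)[OF sub] that by simp
  define D where "D = Inf ((\<lambda>w. (hdist H v w)\<^sup>2) ` W)"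
  have bdd: "bdd_below ((\<lambda>w. (hdist H v w)\<^sup>2) ` W)" by (rule bdd_belowI[of _ 0]) auto
  have D_le: "D \<le> (hdist H v w)\<^sup>2" if "w \<in> W" for w
    unfolding D_def by (rule cInf_lower[OF _ bdd]) (use that in auto)
  have "D \<ge> 0" unfolding D_def by (rule cInf_greatest) (use W0 in auto)
  have "\<exists>w\<in>W. (hdist H v w)\<^sup>2 < D + 1 / real (Suc n)" for n
  proof -
    have "\<exists>y\<in>(\<lambda>w. (hdist H v w)\<^sup>2) ` W. y < D + 1 / real (Suc n)"
      using W0 by (subst cInf_less_iff[OF _ bdd, symmetric]) (auto simp: D_def)
    then show ?thesis by auto
  qed
  then have "\<exists>w. \<forall>n. w n \<in> W \<and> (hdist H v (w n))\<^sup>2 < D + 1 / real (Suc n)"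
    by (intro choice allI) blast
  then obtain w where w: "\<And>n. w n \<in> W" and wD: "\<And>n. (hdist H v (w n))\<^sup>2 < D + 1 / real (Suc n)"
    by blast
  have inv: "(\<lambda>k. 1 / real (Suc k)) \<longlonglongrightarrow> 0"
    using LIMSEQ_inverse_real_of_nat by (simp add: inverse_eq_divide)
  have cau: "MS.MCauchy w"
    unfolding MS.MCauchy_def
  proof (intro conjI allI impI)
    show "range w \<subseteq> carrier H" using w WH by blast
    fix e :: real assume e: "e > 0"
    \<comment> \<open>By the parallelogram law, two members whose squared distances to
      \<open>v\<close> are within \<open>e\<^sup>2 / 4\<close> of the infimum \<open>D\<close> have
      squared distance below
      \<open>2 * (e\<^sup>2 / 4) + 2 * (e\<^sup>2 / 4) = e\<^sup>2\<close>.\<close>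
    then have "e\<^sup>2 / 4 > 0" by simp
    then obtain N where N: "\<forall>n\<ge>N. 1 / real (Suc n) < e\<^sup>2 / 4"
      using order_tendstoD(2)[OF inv] unfolding eventually_sequentially by blast
    have "hdist H (w m) (w n) < e" if "N \<le> m" "N \<le> n" for m n
    proof -
      have "(hdist H (w m) (w n))\<^sup>2 = 2 * (hdist H v (w m))\<^sup>2 + 2 * (hdist H v (w n))\<^sup>2
          - 4 * (hdist H v ((1/2) \<odot>\<^bsub>H\<^esub> (w m \<oplus>\<^bsub>H\<^esub> w n)))\<^sup>2"
        using v w WH by (intro hdist_parallelogram) auto
      also have "\<dots> \<le> 2 * (hdist H v (w m))\<^sup>2 + 2 * (hdist H v (w n))\<^sup>2 - 4 * D"
        using D_le[OF Wsm[OF Wadd[OF w w]]] by simp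
      also have "\<dots> < 2 * (e\<^sup>2 / 4) + 2 * (e\<^sup>2 / 4)"
      proof -
        have "1 / real (Suc m) < e\<^sup>2 / 4" "1 / real (Suc n) < e\<^sup>2 / 4" using N that by blast+
        then show ?thesis using wD[of m] wD[of n] by linarith
      qed
      finally have "(hdist H (w m) (w n))\<^sup>2 < e\<^sup>2" by simp
      then show ?thesis by (rule power2_less_imp_less) (use e in simp)
    qed
    then show "\<exists>N. \<forall>n n'. N \<le> n \<longrightarrow> N \<le> n' \<longrightarrow> hdist H (w n) (w n') < e" by blast
  qed
  then obtain p where p: "limitin MS.mtopology w p sequentially"
    using complete by (auto simp: MS.mcomplete_def)
  have pW: "p \<in> W"
    by (rule limitin_closedin[OF p clo]) (use w in auto)
  have "hdist H v p \<le> sqrt D"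
  proof (rule LIMSEQ_le_const[of "\<lambda>n. sqrt (D + 1 / real (Suc n)) + hdist H (w n) p"])
    have "(\<lambda>n. hdist H (w n) p) \<longlonglongrightarrow> 0"
      using p by (simp add: MS.limitin_metric_dist_null)
    moreover have "(\<lambda>n. sqrt (D + 1 / real (Suc n))) \<longlonglongrightarrow> sqrt (D + 0)"
      by (intro tendsto_intros inv)
    ultimately have "(\<lambda>n. sqrt (D + 1 / real (Suc n)) + hdist H (w n) p) \<longlonglongrightarrow> sqrt (D + 0) + 0"
      by (intro tendsto_add)
    then show "(\<lambda>n. sqrt (D + 1 / real (Suc n)) + hdist H (w n) p) \<longlonglongrightarrow> sqrt D" by simp
    have "hdist H v p \<le> sqrt (D + 1 / real (Suc n)) + hdist H (w n) p" for n
    proof -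
      have "hdist H v (w n) \<le> sqrt (D + 1 / real (Suc n))"
        by (rule real_le_rsqrt[OF less_imp_le[OF wD]])
      then show ?thesis using MS.triangle[OF v WH[OF w[of n]] WH[OF pW]] by simp
    qed
    then show "\<exists>N. \<forall>n\<ge>N. hdist H v p \<le> sqrt (D + 1 / real (Suc n)) + hdist H (w n) p" by blast
  qed
  then have "(hdist H v p)\<^sup>2 \<le> (sqrt D)\<^sup>2" by (intro power_mono) auto
  then have pD: "(hdist H v p)\<^sup>2 \<le> D" using \<open>D \<ge> 0\<close> by simp
  have "inprod H (v \<ominus>\<^bsub>H\<^esub> p) u = 0" if u: "u \<in> W" for u
  proof (rule ccontr)
    define z where "z = v \<ominus>\<^bsub>H\<^esub> p"
    define c where "c = inprod H z u"
    define N where "N = Re (inprod H u u)"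
    assume "inprod H (v \<ominus>\<^bsub>H\<^esub> p) u \<noteq> 0"
    then have c0: "cmod c > 0" by (simp add: c_def z_def)
    have uH: "u \<in> carrier H" and pH: "p \<in> carrier H" and zH: "z \<in> carrier H"
      using u pW WH v by (auto simp: z_def)
    have N0: "N \<ge> 0" and Nu: "inprod H u u = of_real N"
      using inprod_nonneg[OF uH] inprod_self_real[OF uH] by (auto simp: N_def)
    have uz: "inprod H u z = cnj c" using inprod_commute[OF zH uH] by (simp add: c_def)
    \<comment> \<open>Moving \<open>p\<close> by a multiple of \<open>u\<close> changes the squared
      distance by \<open>- (2 * s - s\<^sup>2 * N) * (cmod c)\<^sup>2\<close>. The
      \<open>+ 1\<close> keeps \<open>s * N < 1\<close>, so this is a decrease, and avoids a
      division by zero.\<close>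
    define s where "s = 1 / (N + 1)"
    define a where "a = of_real s * c"
    have "inprod H (v \<ominus>\<^bsub>H\<^esub> (p \<oplus>\<^bsub>H\<^esub> a \<odot>\<^bsub>H\<^esub> u)) (v \<ominus>\<^bsub>H\<^esub> (p \<oplus>\<^bsub>H\<^esub> a \<odot>\<^bsub>H\<^esub> u)) =
        inprod H (z \<ominus>\<^bsub>H\<^esub> a \<odot>\<^bsub>H\<^esub> u) (z \<ominus>\<^bsub>H\<^esub> a \<odot>\<^bsub>H\<^esub> u)"
      using v uH pH by (simp add: z_def inprod_diff_left inprod_diff_right inprod_add_left
          inprod_add_right inprod_smult_left inprod_smult_right algebra_simps)
    also have "\<dots> = inprod H z z - cnj a * c - a * cnj c + a * cnj a * inprod H u u"
      using zH uH by (simp add: inprod_diff_left inprod_diff_right inprod_smult_left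
          inprod_smult_right uz c_def[symmetric] algebra_simps)
    also have "\<dots> = inprod H z z - of_real (2 * s - s\<^sup>2 * N) * (c * cnj c)"
      by (simp add: a_def Nu power2_eq_square algebra_simps del: complex_mult_cnj)
    finally have "(hdist H v (p \<oplus>\<^bsub>H\<^esub> a \<odot>\<^bsub>H\<^esub> u))\<^sup>2 = (hdist H v p)\<^sup>2 - (2 * s - s\<^sup>2 * N) * (cmod c)\<^sup>2"
      unfolding complex_norm_square[symmetric]
      using v pH uH by (simp add: hdist_power2 z_def)
    moreover have "D \<le> (hdist H v (p \<oplus>\<^bsub>H\<^esub> a \<odot>\<^bsub>H\<^esub> u))\<^sup>2"
      using u pW by (intro D_le Wadd Wsm)
    ultimately have "(2 * s - s\<^sup>2 * N) * (cmod c)\<^sup>2 \<le> 0" using pD by linarith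
    moreover have "2 * s - s\<^sup>2 * N > 0"
    proof -
      have "s * N < 1" "s > 0" using N0 by (auto simp: s_def divide_less_eq)
      then have "s * (s * N) < s * 2" by (intro mult_strict_left_mono) auto
      then show ?thesis by (simp add: power2_eq_square mult_ac)
    qed
    ultimately show False using c0 by (simp add: mult_le_0_iff)
  qed
  then show thesis using pW that by blast
qed

section \<open>Functions of positive type\<close>

context group
begin

text \<open>
  A list \<open>f\<close> stands for the formal sum of the \<open>c \<cdot> x\<close> with \<open>(c, x)\<close> in \<open>f\<close>; terms with \<open>x\<close> off
  the carrier count as zero.
\<close>
definition ptterm :: "('a \<Rightarrow> complex) \<Rightarrow> complex \<times> 'a \<Rightarrow> complex \<times> 'a \<Rightarrow> complex" where
  "ptterm \<phi> a b = (if snd a \<in> carrier G \<and> snd b \<in> carrier G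
     then fst a * cnj (fst b) * \<phi> (inv (snd b) \<otimes> snd a) else 0)"

text \<open>This is \<open>\<phi>\<close>, extended linearly to the group algebra, at the element
  \<open>g^* f\<close>; thus \<open>positive_type\<close> asks that \<open>\<phi>\<close> be
  nonnegative at every \<open>f^* f\<close>.\<close>

definition ptform :: "('a \<Rightarrow> complex) \<Rightarrow> (complex \<times> 'a) list \<Rightarrow> (complex \<times> 'a) list \<Rightarrow> complex" where
  "ptform \<phi> f g = (\<Sum>a\<leftarrow>f. \<Sum>b\<leftarrow>g. ptterm \<phi> a b)"

definition positive_type :: "('a \<Rightarrow> complex) \<Rightarrow> bool" where
  "positive_type \<phi> \<longleftrightarrow> (\<forall>f. Im (ptform \<phi> f f) = 0 \<and> 0 \<le> Re (ptform \<phi> f f))"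

text \<open>The bound is imposed on the whole type, also off the carrier, where nothing else
  restrains \<open>\<phi>\<close>: it places the set in a product of discs, which gives
  compactness.\<close>

definition states :: "('a \<Rightarrow> complex) set" where
  "states = {\<phi>. positive_type \<phi> \<and> \<phi> \<one> = 1 \<and> (\<forall>x. cmod (\<phi> x) \<le> 1)}"

abbreviation scale_list :: "complex \<Rightarrow> (complex \<times> 'a) list \<Rightarrow> (complex \<times> 'a) list" where
  "scale_list a f \<equiv> map (\<lambda>b. (a * fst b, snd b)) f"

lemma ptform_Nil [simp]: "ptform \<phi> [] g = 0" "ptform \<phi> f [] = 0"
  by (simp_all add: ptform_def)

lemma ptform_append_left: "ptform \<phi> (f @ f') g = ptform \<phi> f g + ptform \<phi> f' g"
  by (simp add: ptform_def)

lemma ptform_append_right: "ptform \<phi> f (g @ g') = ptform \<phi> f g + ptform \<phi> f g'"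
  by (simp add: ptform_def sum_list_addf)

lemma ptform_Cons_left: "ptform \<phi> (a # f) g = (\<Sum>b\<leftarrow>g. ptterm \<phi> a b) + ptform \<phi> f g"
  by (simp add: ptform_def)

lemma ptform_Cons_right: "ptform \<phi> f (b # g) = (\<Sum>a\<leftarrow>f. ptterm \<phi> a b) + ptform \<phi> f g"
  by (simp add: ptform_def sum_list_addf)

lemma ptform_scale_left: "ptform \<phi> (scale_list a f) g = a * ptform \<phi> f g"
proof -
  have "ptterm \<phi> (a * fst b, snd b) = (\<lambda>c. a * ptterm \<phi> b c)" for b
    by (simp add: fun_eq_iff ptterm_def)
  then show ?thesis by (simp add: ptform_def sum_list_const_mult comp_def)
qed

lemma ptform_linear:
  assumes "\<And>x. x \<in> carrier G \<Longrightarrow> \<phi> x = s * \<psi> x + t * \<theta> x"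
  shows "ptform \<phi> f g = s * ptform \<psi> f g + t * ptform \<theta> f g"
proof -
  have "ptterm \<phi> = (\<lambda>a b. s * ptterm \<psi> a b + t * ptterm \<theta> a b)"
    using assms by (auto simp: fun_eq_iff ptterm_def algebra_simps)
  then show ?thesis by (simp add: ptform_def sum_list_addf sum_list_const_mult)
qed

text \<open>Polarisation: the form is real at \<open>x + \<one>\<close> and at
  \<open>\<i> x + \<one>\<close>, which compares the imaginary and the real parts
  respectively.\<close>

lemma positive_type_inv:
  assumes pt: "positive_type \<phi>" and x: "x \<in> carrier G"
  shows "\<phi> (inv x) = cnj (\<phi> x)"
proof -
  have im: "Im (ptform \<phi> f f) = 0" for f using pt by (simp add: positive_type_def)
  have 1: "Im (\<phi> \<one>) = 0" using im[of "[(1, \<one>)]"] by (simp add: ptform_def ptterm_def)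
  have "Im (\<phi> x + \<phi> (inv x)) = 0" using im[of "[(1, x), (1, \<one>)]"] x 1
    by (simp add: ptform_def ptterm_def)
  moreover have "Im (\<i> * \<phi> x - \<i> * \<phi> (inv x)) = 0" using im[of "[(\<i>, x), (1, \<one>)]"] x 1
    by (simp add: ptform_def ptterm_def)
  ultimately show ?thesis by (simp add: complex_eq_iff)
qed

lemma ptform_commute:
  assumes pt: "positive_type \<phi>"
  shows "ptform \<phi> g f = cnj (ptform \<phi> f g)"
proof -
  have tt: "ptterm \<phi> b a = cnj (ptterm \<phi> a b)" for a b
  proof (cases "snd a \<in> carrier G \<and> snd b \<in> carrier G")
    case True
    then have "inv (snd a) \<otimes> snd b = inv (inv (snd b) \<otimes> snd a)" by (simp add: inv_mult_group)
    then show ?thesis using True positive_type_inv[OF pt, of "inv (snd b) \<otimes> snd a"]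
      by (simp add: ptterm_def)
  qed (auto simp: ptterm_def)
  have cs: "(\<Sum>b\<leftarrow>g. cnj (h b)) = cnj (\<Sum>b\<leftarrow>g. h b)" for h :: "complex \<times> 'a \<Rightarrow> complex"
    by (induction g) auto
  show ?thesis
  proof (induction f)
    case (Cons a f)
    have "(\<Sum>b\<leftarrow>g. ptterm \<phi> b a) = (\<Sum>b\<leftarrow>g. cnj (ptterm \<phi> a b))" by (subst tt) simp
    then show ?case using Cons by (simp add: ptform_Cons_left ptform_Cons_right cs)
  qed simp
qed

lemma semi_inner_space_ptform:
  assumes "positive_type \<phi>"
  shows "semi_inner_space (ptform \<phi>) (@) scale_list"
proof
  show "ptform \<phi> (f @ g) h = ptform \<phi> f h + ptform \<phi> g h" for f g h
    by (rule ptform_append_left)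
  show "ptform \<phi> (scale_list a f) h = a * ptform \<phi> f h" for a f h
    by (rule ptform_scale_left)
  show "ptform \<phi> g f = cnj (ptform \<phi> f g)" for f g
    by (rule ptform_commute[OF assms])
  show "0 \<le> Re (ptform \<phi> f f)" for f
    using assms by (simp add: positive_type_def)
qed

end

section \<open>Irreducible representations from extreme functions of positive type\<close>

context unitary_rep
begin

lemma group_G: "group G"
  using group_hom group_hom.axioms(1) by blast

lemma rep_mult: "\<lbrakk>x \<in> carrier G; y \<in> carrier G; v \<in> carrier H\<rbrakk> \<Longrightarrow> \<pi> (x \<otimes>\<^bsub>G\<^esub> y) v = \<pi> x (\<pi> y v)"
  by (rule composition_rule)

lemma rep_one: "v \<in> carrier H \<Longrightarrow> \<pi> \<one>\<^bsub>G\<^esub> v = v"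
  using id_eq_one[symmetric] by simp

lemma inprod_rep_left:
  assumes "x \<in> carrier G" "v \<in> carrier H" "w \<in> carrier H"
  shows "inprod H (\<pi> x v) w = inprod H v (\<pi> (inv\<^bsub>G\<^esub> x) w)"
proof -
  interpret G: group G by (rule group_G)
  have "inprod H (\<pi> x v) w = inprod H (\<pi> (inv\<^bsub>G\<^esub> x) (\<pi> x v)) (\<pi> (inv\<^bsub>G\<^esub> x) w)"
    using assms by (simp add: rep_inprod rep_closed)
  also have "\<pi> (inv\<^bsub>G\<^esub> x) (\<pi> x v) = v"
    using assms rep_mult[of "inv\<^bsub>G\<^esub> x" x v] by (simp add: rep_one)
  finally show ?thesis .
qed

lemma inprod_eq_0_commute:
  "v \<in> carrier H \<Longrightarrow> w \<in> carrier H \<Longrightarrow> inprod H v w = 0 \<longleftrightarrow> inprod H w v = 0"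
  using inprod_commute[of v w] by simp

text \<open>The formal sum \<open>f\<close> acting on \<open>\<eta>\<close> through
  \<open>\<pi>\<close>; terms off the carrier contribute zero, in accordance with
  \<open>ptterm\<close>.\<close>

definition apply_list :: "'h \<Rightarrow> (complex \<times> 'a) list \<Rightarrow> 'h" where
  "apply_list \<eta> f =
     foldr (\<lambda>a v. (if snd a \<in> carrier G then fst a \<odot>\<^bsub>H\<^esub> \<pi> (snd a) \<eta> else \<zero>\<^bsub>H\<^esub>) \<oplus>\<^bsub>H\<^esub> v) f \<zero>\<^bsub>H\<^esub>"

lemma apply_list_closed: "\<eta> \<in> carrier H \<Longrightarrow> apply_list \<eta> f \<in> carrier H"
  unfolding apply_list_def by (induction f) (auto simp: rep_closed)

lemma inprod_zero_right [simp]: "w \<in> carrier H \<Longrightarrow> inprod H w \<zero>\<^bsub>H\<^esub> = 0"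
  using inprod_commute[of "\<zero>\<^bsub>H\<^esub>" w] by simp

lemma inprod_apply_list:
  assumes \<eta>: "\<eta> \<in> carrier H"
    and \<phi>: "\<And>x. x \<in> carrier G \<Longrightarrow> \<phi> x = inprod H (\<pi> x \<eta>) \<eta>"
  shows "inprod H (apply_list \<eta> f) (apply_list \<eta> g) = group.ptform G \<phi> f g"
proof -
  interpret G: group G by (rule group_G)
  define tv where "tv = (\<lambda>a. if snd a \<in> carrier G then fst a \<odot>\<^bsub>H\<^esub> \<pi> (snd a) \<eta> else \<zero>\<^bsub>H\<^esub>)"
  have tvH: "tv a \<in> carrier H" for a using \<eta> by (simp add: tv_def rep_closed)
  have Cons: "apply_list \<eta> (a # f) = tv a \<oplus>\<^bsub>H\<^esub> apply_list \<eta> f" for a f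
    by (simp add: apply_list_def tv_def)
  have Nil: "apply_list \<eta> [] = \<zero>\<^bsub>H\<^esub>" by (simp add: apply_list_def)
  have tt: "inprod H (tv a) (tv b) = G.ptterm \<phi> a b" for a b
  proof (cases "snd a \<in> carrier G \<and> snd b \<in> carrier G")
    case True
    then have "inprod H (\<pi> (snd a) \<eta>) (\<pi> (snd b) \<eta>) =
        inprod H (\<pi> (inv\<^bsub>G\<^esub> (snd b)) (\<pi> (snd a) \<eta>)) \<eta>"
      using \<eta> inprod_rep_left[of "inv\<^bsub>G\<^esub> (snd b)" "\<pi> (snd a) \<eta>" \<eta>] by (simp add: rep_closed)
    also have "\<dots> = \<phi> (inv\<^bsub>G\<^esub> (snd b) \<otimes>\<^bsub>G\<^esub> snd a)"
      using True \<eta> by (simp add: \<phi> rep_mult)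
    finally show ?thesis using True \<eta>
      by (simp add: tv_def G.ptterm_def inprod_smult_left inprod_smult_right rep_closed)
  next
    case False
    then show ?thesis using tvH[of a] tvH[of b] by (auto simp: tv_def G.ptterm_def)
  qed
  have row: "inprod H (tv a) (apply_list \<eta> g) = (\<Sum>b\<leftarrow>g. G.ptterm \<phi> a b)" for a
    by (induction g) (simp_all add: Cons Nil inprod_add_right tvH apply_list_closed \<eta> tt)
  show ?thesis
    by (induction f) (simp_all add: Cons Nil inprod_add_left tvH apply_list_closed \<eta> row G.ptform_Cons_left)
qed

definition coefficient :: "'h \<Rightarrow> 'a \<Rightarrow> complex" where
  "coefficient \<eta> x = (if x \<in> carrier G then inprod H (\<pi> x \<eta>) \<eta> else 0)"

lemma coefficient_states:
  assumes \<eta>: "\<eta> \<in> carrier H" and 1: "inprod H \<eta> \<eta> = 1"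
  shows "coefficient \<eta> \<in> group.states G"
proof -
  interpret G: group G by (rule group_G)
  have pt: "G.positive_type (coefficient \<eta>)"
    unfolding G.positive_type_def
  proof (intro allI)
    fix f
    have eq: "G.ptform (coefficient \<eta>) f f = inprod H (apply_list \<eta> f) (apply_list \<eta> f)"
      by (rule inprod_apply_list[OF \<eta>, symmetric]) (simp add: coefficient_def)
    show "Im (G.ptform (coefficient \<eta>) f f) = 0 \<and> 0 \<le> Re (G.ptform (coefficient \<eta>) f f)"
      unfolding eq using inprod_self_real[OF apply_list_closed[OF \<eta>], of f]
        inprod_nonneg[OF apply_list_closed[OF \<eta>], of f]
      by (metis Im_complex_of_real)
  qed
  have "cmod (coefficient \<eta> x) \<le> 1" for x
  proof (cases "x \<in> carrier G")
    case True
    then show ?thesis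
      using Cauchy_Schwarz[of "\<pi> x \<eta>" \<eta>] \<eta> 1 by (simp add: coefficient_def rep_inprod rep_closed)
  qed (simp add: coefficient_def)
  then show ?thesis using pt \<eta> 1 by (simp add: G.states_def coefficient_def rep_one)
qed

text \<open>The projection of \<open>\<xi>\<close> to an invariant \<open>W\<close> splits the
  coefficient of \<open>\<xi>\<close> into two multiples of states. Extremality makes both
  proportional to that coefficient, and by cyclicity the projection is a multiple of
  \<open>\<xi>\<close>. So either the projection is zero, and then \<open>W\<close> is zero, or
  \<open>\<xi>\<close> lies in \<open>W\<close>, and then \<open>W\<close> is everything.\<close>

lemma irreducible_if_extreme:
  assumes \<xi>: "\<xi> \<in> carrier H" and nrm: "inprod H \<xi> \<xi> = 1"
    and cyclic: "\<And>v. \<lbrakk>v \<in> carrier H; \<forall>x\<in>carrier G. inprod H v (\<pi> x \<xi>) = 0\<rbrakk> \<Longrightarrow> v = \<zero>\<^bsub>H\<^esub>"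
    and extreme: "\<And>\<psi> \<theta> t. \<lbrakk>\<psi> \<in> group.states G; \<theta> \<in> group.states G; 0 < t; t < 1;
      \<forall>x\<in>carrier G. coefficient \<xi> x = of_real t * \<psi> x + of_real (1 - t) * \<theta> x\<rbrakk>
      \<Longrightarrow> \<forall>x\<in>carrier G. \<psi> x = \<theta> x"
  shows "irreducible_unitary_rep G H \<pi>"
proof (intro irreducible_unitary_rep.intro unitary_rep_axioms irreducible_unitary_rep_axioms.intro)
  interpret G: group G by (rule group_G)
  show "carrier H \<noteq> {\<zero>\<^bsub>H\<^esub>}" using \<xi> nrm by auto
  fix W assume W: "closed_subspace W H" and invW: "\<forall>x\<in>carrier G. \<pi> x ` W \<subseteq> W"
  have sub: "submodule W (ring_of_type_algebra :: complex ring) H"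
    using W by (auto simp: closed_subspace_def)
  have WH: "u \<in> carrier H" if "u \<in> W" for u using submoduleE(1)[OF sub] that by blast
  have W0: "\<zero>\<^bsub>H\<^esub> \<in> W" using subgroup.one_closed[OF submodule.axioms(1)[OF sub]] by simp
  have Wsm: "c \<odot>\<^bsub>H\<^esub> b \<in> W" if "b \<in> W" for b c using submoduleE(4)[OF sub] that by simp
  have Winv: "\<pi> x u \<in> W" if "x \<in> carrier G" "u \<in> W" for x u using invW that by blast
  have all: "W = carrier H" if "\<xi> \<in> W"
  proof -
    have "v \<in> W" if v: "v \<in> carrier H" for v
    proof -
      obtain p where p: "p \<in> W" "\<And>u. u \<in> W \<Longrightarrow> inprod H (v \<ominus>\<^bsub>H\<^esub> p) u = 0"
        using orthogonal_projection[OF W v] by blast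
      have "v \<ominus>\<^bsub>H\<^esub> p = \<zero>\<^bsub>H\<^esub>"
        using v p WH Winv \<open>\<xi> \<in> W\<close> by (intro cyclic) auto
      then show ?thesis using minus_eq_zero_iff[OF v WH[OF p(1)]] p(1) by simp
    qed
    then show ?thesis using WH by blast
  qed
  obtain a where a: "a \<in> W" "\<And>u. u \<in> W \<Longrightarrow> inprod H (\<xi> \<ominus>\<^bsub>H\<^esub> a) u = 0"
    using orthogonal_projection[OF W \<xi>] by blast
  define b where "b = \<xi> \<ominus>\<^bsub>H\<^esub> a"
  have aH: "a \<in> carrier H" using a WH by blast
  have bH: "b \<in> carrier H" using aH \<xi> by (simp add: b_def)
  have \<xi>ab: "\<xi> = a \<oplus>\<^bsub>H\<^esub> b"
    using aH \<xi> by (simp add: b_def a_minus_def M.a_ac M.r_neg M.r_neg1 M.r_neg2)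
  have bW: "inprod H b u = 0" if "u \<in> W" for u using a(2)[OF that] by (simp add: b_def)
  \<comment> \<open>The cross terms vanish because the orbit of \<open>a\<close> stays in
    \<open>W\<close>, to which \<open>b\<close> is orthogonal.\<close>
  have ab: "inprod H (\<pi> x a) b = 0" if "x \<in> carrier G" for x
    using bW[OF Winv[OF that a(1)]] inprod_eq_0_commute[of "\<pi> x a" b] that aH bH
    by (simp add: rep_closed)
  have ba: "inprod H (\<pi> x b) a = 0" if "x \<in> carrier G" for x
    using bW[OF Winv[of "inv\<^bsub>G\<^esub> x", OF _ a(1)]] inprod_rep_left[OF that bH aH] that by simp
  have coef: "inprod H (\<pi> x \<xi>) \<xi> = inprod H (\<pi> x a) a + inprod H (\<pi> x b) b" if "x \<in> carrier G" for x
    using that aH bH by (simp add: \<xi>ab rep_add inprod_add_left inprod_add_right rep_closed ab ba)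
  define t where "t = Re (inprod H a a)"
  have ta: "inprod H a a = of_real t" using inprod_self_real[OF aH] by (simp add: t_def)
  have tb: "inprod H b b = of_real (1 - t)"
    using coef[OF G.one_closed] nrm ta aH bH \<xi> by (simp add: rep_one algebra_simps)
  consider "a = \<zero>\<^bsub>H\<^esub>" | "b = \<zero>\<^bsub>H\<^esub>" | "a \<noteq> \<zero>\<^bsub>H\<^esub>" "b \<noteq> \<zero>\<^bsub>H\<^esub>" by blast
  then show "W = {\<zero>\<^bsub>H\<^esub>} \<or> W = carrier H"
  proof cases
    case 1
    then have \<xi>b: "\<xi> = b" using \<xi>ab bH by simp
    have "w = \<zero>\<^bsub>H\<^esub>" if w: "w \<in> W" for w
    proof (rule cyclic[OF WH[OF w]], intro ballI)
      fix x assume x: "x \<in> carrier G"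
      have "inprod H (\<pi> x b) w = inprod H b (\<pi> (inv\<^bsub>G\<^esub> x) w)"
        by (rule inprod_rep_left[OF x bH WH[OF w]])
      also have "\<dots> = 0" using x w by (intro bW Winv) auto
      finally show "inprod H w (\<pi> x \<xi>) = 0"
        using inprod_eq_0_commute[of w "\<pi> x \<xi>"] x \<xi> w WH by (simp add: \<xi>b rep_closed)
    qed
    then show ?thesis using W0 by blast
  next
    case 2
    then have "\<xi> = a" using \<xi>ab aH by simp
    then show ?thesis using all a(1) by simp
  next
    case 3
    have t0: "t > 0" using inprod_pos[OF aH 3(1)] by (simp add: t_def)
    have t1: "1 - t > 0" using inprod_pos[OF bH 3(2)] tb by simp
    define \<psi> where "\<psi> = coefficient (of_real (1 / sqrt t) \<odot>\<^bsub>H\<^esub> a)"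
    define \<theta> where "\<theta> = coefficient (of_real (1 / sqrt (1 - t)) \<odot>\<^bsub>H\<^esub> b)"
    have sq: "of_real (1 / sqrt s) * (of_real (1 / sqrt s) * z) = z / of_real s" if "s > 0" for s and z :: complex
    proof -
      have "of_real (1 / sqrt s) * (of_real (1 / sqrt s) * z) = of_real (1 / sqrt s * (1 / sqrt s)) * z"
        by (simp only: of_real_mult mult.assoc)
      also have "1 / sqrt s * (1 / sqrt s) = 1 / s" using that by simp
      also have "of_real (1 / s) * z = z / of_real s" by simp
      finally show ?thesis .
    qed
    have \<psi>x: "\<psi> x = inprod H (\<pi> x a) a / of_real t" if "x \<in> carrier G" for x
      using that aH t0 unfolding \<psi>_def coefficient_def
      by (simp add: rep_smult rep_closed inprod_smult_left inprod_smult_right sq del: of_real_divide)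
    have \<theta>x: "\<theta> x = inprod H (\<pi> x b) b / of_real (1 - t)" if "x \<in> carrier G" for x
      using that bH t1 unfolding \<theta>_def coefficient_def
      by (simp add: rep_smult rep_closed inprod_smult_left inprod_smult_right sq del: of_real_divide of_real_diff)
    have "\<psi> \<in> G.states"
      unfolding \<psi>_def using aH t0 ta
      by (intro coefficient_states) (simp_all add: inprod_smult_left inprod_smult_right sq del: of_real_divide)
    moreover have "\<theta> \<in> G.states"
      unfolding \<theta>_def using bH t1 tb
      by (intro coefficient_states) (simp_all add: inprod_smult_left inprod_smult_right sq del: of_real_divide of_real_diff)
    moreover have conv: "\<forall>x\<in>carrier G. coefficient \<xi> x = of_real t * \<psi> x + of_real (1 - t) * \<theta> x"
      using t0 t1 by (simp add: coefficient_def coef \<psi>x \<theta>x del: of_real_diff)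
    ultimately have eq: "\<psi> x = \<theta> x" if "x \<in> carrier G" for x
      using extreme[of \<psi> \<theta> t] t0 t1 that by auto
    have multiple: "inprod H (\<pi> x a) a = of_real t * inprod H (\<pi> x \<xi>) \<xi>" if x: "x \<in> carrier G" for x
    proof -
      have "inprod H (\<pi> x \<xi>) \<xi> = \<psi> x"
        using bspec[OF conv x] x eq[OF x] by (simp add: coefficient_def algebra_simps)
      then show ?thesis using \<psi>x[OF x] t0 by simp
    qed
    have "a \<ominus>\<^bsub>H\<^esub> of_real t \<odot>\<^bsub>H\<^esub> \<xi> = \<zero>\<^bsub>H\<^esub>"
    proof (rule cyclic)
      show "a \<ominus>\<^bsub>H\<^esub> of_real t \<odot>\<^bsub>H\<^esub> \<xi> \<in> carrier H" using aH \<xi> by simp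
      show "\<forall>x\<in>carrier G. inprod H (a \<ominus>\<^bsub>H\<^esub> of_real t \<odot>\<^bsub>H\<^esub> \<xi>) (\<pi> x \<xi>) = 0"
      proof
        fix x assume x: "x \<in> carrier G"
        have "inprod H (\<pi> x \<xi>) a = inprod H (\<pi> x a) a"
          using x aH bH by (simp add: \<xi>ab rep_add inprod_add_left rep_closed ba)
        then have "inprod H (\<pi> x \<xi>) (a \<ominus>\<^bsub>H\<^esub> of_real t \<odot>\<^bsub>H\<^esub> \<xi>) = 0"
          using x aH \<xi> by (simp add: inprod_diff_right inprod_smult_right rep_closed multiple)
        then show "inprod H (a \<ominus>\<^bsub>H\<^esub> of_real t \<odot>\<^bsub>H\<^esub> \<xi>) (\<pi> x \<xi>) = 0"
          using inprod_eq_0_commute[of "\<pi> x \<xi>" "a \<ominus>\<^bsub>H\<^esub> of_real t \<odot>\<^bsub>H\<^esub> \<xi>"] x aH \<xi>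
          by (simp add: rep_closed)
      qed
    qed
    then have "a = of_real t \<odot>\<^bsub>H\<^esub> \<xi>" using minus_eq_zero_iff aH \<xi> by simp
    then have "of_real (1 / t) \<odot>\<^bsub>H\<^esub> a = \<xi>"
      using t0 \<xi> smult_assoc1[of "of_real (1 / t)" "of_real t" \<xi>] smult_one[OF \<xi>] by simp
    then have "\<xi> \<in> W" using Wsm[OF a(1)] by metis
    then show ?thesis using all by simp
  qed
qed

end

section \<open>The representation associated with a function of positive type\<close>

context group
begin

text \<open>Points off the carrier are left fixed, so that \<open>act\<close> is an action on all
  lists literally and not only up to \<open>ptform\<close>.\<close>

definition act :: "'a \<Rightarrow> (complex \<times> 'a) list \<Rightarrow> (complex \<times> 'a) list" where
  "act x f = map (\<lambda>b. (fst b, if snd b \<in> carrier G then x \<otimes> snd b else snd b)) f"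

lemma ptform_act:
  assumes x: "x \<in> carrier G"
  shows "ptform \<phi> (act x f) (act x g) = ptform \<phi> f g"
proof -
  have "ptterm \<phi> (fst a, if snd a \<in> carrier G then x \<otimes> snd a else snd a)
      (fst b, if snd b \<in> carrier G then x \<otimes> snd b else snd b) = ptterm \<phi> a b" for a b
  proof (cases "snd a \<in> carrier G \<and> snd b \<in> carrier G")
    case True
    then have "inv (x \<otimes> snd b) \<otimes> (x \<otimes> snd a) = inv (snd b) \<otimes> snd a"
      using x by (simp add: inv_mult_group m_assoc) (simp add: m_assoc[symmetric])
    then show ?thesis using True x by (simp add: ptterm_def)
  qed (use x in \<open>auto simp: ptterm_def\<close>)
  then show ?thesis by (simp add: ptform_def act_def comp_def)
qed

lemma act_mult: "x \<in> carrier G \<Longrightarrow> y \<in> carrier G \<Longrightarrow> act (x \<otimes> y) f = act x (act y f)"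
  by (simp add: act_def m_assoc)

lemma act_one: "act \<one> f = f"
  unfolding act_def by (rule map_idI) auto

lemma act_append: "act x (f @ g) = act x f @ act x g"
  by (simp add: act_def)

lemma act_scale: "act x (scale_list a f) = scale_list a (act x f)"
  by (simp add: act_def)

lemma act_inv_cancel:
  "x \<in> carrier G \<Longrightarrow> act x (act (inv x) f) = f"
  "x \<in> carrier G \<Longrightarrow> act (inv x) (act x f) = f"
  by (simp_all add: act_mult[symmetric] act_one)

text \<open>Left translation of formal sums is isometric for \<open>ptform \<phi>\<close>. On the
  completion, whose vectors are functionals, it becomes composition with the inverse translation.
  The last clause says that \<open>\<xi>\<close> is cyclic, in the form in which it is used.\<close>

lemma GNS:
  assumes \<phi>: "\<phi> \<in> states"
  obtains H :: "((complex \<times> 'a) list \<Rightarrow> complex) inner_space" and \<pi> \<xi> where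
    "unitary_rep G H \<pi>" "\<xi> \<in> carrier H" "inprod H \<xi> \<xi> = 1"
    "\<And>x. x \<in> carrier G \<Longrightarrow> inprod H (\<pi> x \<xi>) \<xi> = \<phi> x"
    "\<And>v. \<lbrakk>v \<in> carrier H; \<forall>x\<in>carrier G. inprod H v (\<pi> x \<xi>) = 0\<rbrakk> \<Longrightarrow> v = \<zero>\<^bsub>H\<^esub>"
proof -
  have pt: "positive_type \<phi>" and \<phi>1: "\<phi> \<one> = 1" using \<phi> by (auto simp: states_def)
  interpret S: semi_inner_space "ptform \<phi>" "(@)" scale_list
    by (rule semi_inner_space_ptform[OF pt])
  define H where "H = S.completion"
  define \<pi> where "\<pi> = (\<lambda>x. \<lambda>u\<in>carrier H. \<lambda>w. u (act (inv x) w))"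
  have H [simp]: "carrier H = {u. \<exists>f. S.represents f u}" "\<zero>\<^bsub>H\<^esub> = (\<lambda>_. 0)"
    "u \<oplus>\<^bsub>H\<^esub> v = (\<lambda>w. u w + v w)" "a \<odot>\<^bsub>H\<^esub> u = (\<lambda>w. a * u w)"
    "inprod H = S.completion_ip" for u v a
    by (simp_all add: H_def)
  interpret H: hilbert_space H unfolding H_def by (rule S.hilbert_space_completion)
  have nrm_act: "S.nrm (act x f) = S.nrm f" if "x \<in> carrier G" for x f
    by (simp add: S.nrm_def ptform_act[OF that])
  have sub_act: "S.sub (act x f) (act x g) = act x (S.sub f g)" for x f g
    by (simp only: S.sub_def act_append act_scale)
  have ip_act: "ptform \<phi> (act x f) w = ptform \<phi> f (act (inv x) w)" if "x \<in> carrier G" for x f w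
    using ptform_act[OF that, of \<phi> f "act (inv x) w"] that by (simp add: act_inv_cancel)
  have rep: "S.represents (\<lambda>n. act x (f n)) (\<lambda>w. u (act (inv x) w))"
    if "S.represents f u" "x \<in> carrier G" for x f u
    using that by (simp add: S.represents_def S.cauchy_seq_def sub_act nrm_act ip_act)
  have \<pi>: "\<pi> x u = (\<lambda>w. u (act (inv x) w))" if "u \<in> carrier H" for x u
    using that by (simp add: \<pi>_def del: H)
  have \<pi>_closed: "\<pi> x u \<in> carrier H" if "x \<in> carrier G" "u \<in> carrier H" for x u
    using that rep by (auto simp: \<pi>)
  have \<pi>_ext: "\<pi> x \<in> extensional (carrier H)" for x by (simp add: \<pi>_def del: H)
  have \<pi>_mult: "\<pi> (x \<otimes> y) u = \<pi> x (\<pi> y u)" if "x \<in> carrier G" "y \<in> carrier G" "u \<in> carrier H" for x y u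
    unfolding \<pi>[OF \<pi>_closed[OF that(2,3)]] unfolding \<pi>[OF that(3)]
    using that by (simp add: inv_mult_group act_mult)
  have \<pi>_one: "\<pi> \<one> u = u" if "u \<in> carrier H" for u
    using that by (simp add: \<pi> act_one del: H)
  have \<pi>_inv: "\<pi> (inv x) (\<pi> x u) = u" "\<pi> x (\<pi> (inv x) u) = u" if "x \<in> carrier G" "u \<in> carrier H" for x u
    using that by (simp_all add: \<pi>_mult[symmetric] \<pi>_one del: H)
  have \<pi>_Bij: "\<pi> x \<in> Bij (carrier H)" if "x \<in> carrier G" for x
    unfolding Bij_def using \<pi>_ext that
    by (intro IntI CollectI bij_betwI[where g = "\<pi> (inv x)"]) (auto simp: \<pi>_closed \<pi>_inv simp del: H)
  have ga: "group_action G (carrier H) \<pi>"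
  proof (intro group_action.intro group_hom.intro group_hom_axioms.intro homI)
    show "group G" by (rule is_group)
    show "group (BijGroup (carrier H))" by (rule group_BijGroup)
    show "\<pi> x \<in> carrier (BijGroup (carrier H))" if "x \<in> carrier G" for x
      using \<pi>_Bij[OF that] by (simp add: BijGroup_def)
    fix x y assume xy: "x \<in> carrier G" "y \<in> carrier G"
    have "\<pi> (x \<otimes> y) = compose (carrier H) (\<pi> x) (\<pi> y)"
      by (rule extensionalityI[OF \<pi>_ext compose_extensional])
        (use xy in \<open>simp add: compose_eq \<pi>_mult del: H\<close>)
    then show "\<pi> (x \<otimes> y) = \<pi> x \<otimes>\<^bsub>BijGroup (carrier H)\<^esub> \<pi> y"
      using xy \<pi>_Bij by (simp add: BijGroup_def)
  qed
  have unit: "unitary_rep G H \<pi>"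
  proof (intro unitary_rep.intro H.hilbert_space_axioms ga unitary_rep_axioms.intro)
    fix x v w assume xvw: "x \<in> carrier G" "v \<in> carrier H" "w \<in> carrier H"
    show "\<pi> x (v \<oplus>\<^bsub>H\<^esub> w) = \<pi> x v \<oplus>\<^bsub>H\<^esub> \<pi> x w"
      unfolding \<pi>[OF H.M.a_closed[OF xvw(2,3)]] \<pi>[OF xvw(2)] \<pi>[OF xvw(3)] by simp
    obtain f g where f: "S.represents f v" and g: "S.represents g w" using xvw by auto
    have "(\<lambda>n. ptform \<phi> (f n) (g n)) \<longlonglongrightarrow> S.completion_ip (\<pi> x v) (\<pi> x w)"
      using S.tendsto_completion_ip[OF rep[OF f xvw(1)] rep[OF g xvw(1)]]
      unfolding \<pi>[OF xvw(2)] \<pi>[OF xvw(3)] ptform_act[OF xvw(1)] .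
    then show "inprod H (\<pi> x v) (\<pi> x w) = inprod H v w"
      using LIMSEQ_unique[OF _ S.tendsto_completion_ip[OF f g]] by simp
  next
    fix x v a assume "x \<in> carrier G" and v: "v \<in> carrier H"
    then show "\<pi> x (a \<odot>\<^bsub>H\<^esub> v) = a \<odot>\<^bsub>H\<^esub> \<pi> x v"
      unfolding \<pi>[OF v] \<pi>[OF H.smult_closed[OF _ v, of a, simplified ring_of_type_algebra_simps, OF UNIV_I]] by simp
  qed
  define \<xi> where "\<xi> = ptform \<phi> [(1, \<one>)]"
  have ipH: "ptform \<phi> f \<in> carrier H" for f using S.represents_const by auto
  have \<pi>\<xi>: "\<pi> x \<xi> = ptform \<phi> [(1, x)]" if x: "x \<in> carrier G" for x
  proof -
    have "\<pi> x \<xi> = ptform \<phi> (act x [(1, \<one>)])"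
      unfolding \<pi>[OF ipH, of x "[(1, \<one>)]", folded \<xi>_def] unfolding \<xi>_def by (simp add: ip_act[OF x] fun_eq_iff)
    then show ?thesis using x by (simp add: act_def)
  qed
  have ip_const: "inprod H (ptform \<phi> f) (ptform \<phi> g) = ptform \<phi> f g" for f g
    using LIMSEQ_unique[OF S.tendsto_completion_ip[OF S.represents_const S.represents_const] tendsto_const, of f g]
    by simp
  have coef: "inprod H (\<pi> x \<xi>) \<xi> = \<phi> x" if "x \<in> carrier G" for x
    using that unfolding \<pi>\<xi>[OF that] unfolding \<xi>_def ip_const by (simp add: ptform_def ptterm_def)
  have nrm: "inprod H \<xi> \<xi> = 1"
    unfolding \<xi>_def ip_const by (simp add: ptform_def ptterm_def \<phi>1)
  \<comment> \<open>The number \<open>v w\<close> is the inner product of \<open>v\<close> with the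
    vector of \<open>w\<close>, so orthogonality to the orbit kills \<open>v\<close> on one-term
    lists with entry in the carrier. The form is additive and conjugate homogeneous in its second
    argument, which extends this to all lists.\<close>
  have cyc: "v = \<zero>\<^bsub>H\<^esub>" if v: "v \<in> carrier H" and orth: "\<forall>x\<in>carrier G. inprod H v (\<pi> x \<xi>) = 0" for v
  proof -
    obtain f where f: "S.represents f v" using v by auto
    then have lim: "(\<lambda>n. ptform \<phi> (f n) w) \<longlonglongrightarrow> v w" for w by (simp add: S.represents_def)
    have ev: "S.completion_ip v (ptform \<phi> w) = v w" for w
      by (rule LIMSEQ_unique[OF S.tendsto_completion_ip[OF f S.represents_const] lim])
    have gen: "v [(1, x)] = 0" if "x \<in> carrier G" for x
      using orth that ev[of "[(1, x)]"] by (simp add: \<pi>\<xi>)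
    have "v w = 0" for w
    proof (induction w)
      case Nil
      show ?case using lim[of "[]"] by (simp add: LIMSEQ_const_iff)
    next
      case (Cons b w)
      have "(\<lambda>n. ptform \<phi> (f n) [b]) \<longlonglongrightarrow> 0"
      proof (cases "snd b \<in> carrier G")
        case True
        have "ptterm \<phi> a b = cnj (fst b) * ptterm \<phi> a (1, snd b)" for a
          by (simp add: ptterm_def)
        then have "ptform \<phi> (f n) [b] = cnj (fst b) * ptform \<phi> (f n) [(1, snd b)]" for n
          by (simp add: ptform_def sum_list_const_mult)
        then show ?thesis
          using tendsto_mult_left[OF lim[of "[(1, snd b)]"], of "cnj (fst b)"] gen[OF True] by simp
      next
        case False
        then have "ptform \<phi> (f n) [b] = 0" for n by (simp add: ptform_def ptterm_def)
        then show ?thesis by simp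
      qed
      from tendsto_add[OF this lim[of w]] have "(\<lambda>n. ptform \<phi> (f n) (b # w)) \<longlonglongrightarrow> 0"
        using ptform_append_right[of \<phi> _ "[b]" w] Cons by simp
      then show ?case using LIMSEQ_unique[OF lim] by blast
    qed
    then show ?thesis by (simp add: fun_eq_iff)
  qed
  show thesis
    by (rule that[OF unit _ nrm coef cyc]) (use ipH \<xi>_def in auto)
qed

end

section \<open>Compactness of the set of states\<close>

context group
begin

lemma continuous_on_eval:
  fixes x :: 'a shows "continuous_on S (\<lambda>\<phi> :: 'a \<Rightarrow> complex. \<phi> x)"
  by (rule continuous_on_subset[OF continuous_on_product_coordinates]) simp

lemma continuous_on_ptform: "continuous_on S (\<lambda>\<phi>. ptform \<phi> f g)"
proof -
  have sl: "continuous_on S (\<lambda>\<phi>. \<Sum>a\<leftarrow>as. h \<phi> a)" if "\<And>a. continuous_on S (\<lambda>\<phi>. h \<phi> a)"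
    for as :: "(complex \<times> 'a) list" and h :: "('a \<Rightarrow> complex) \<Rightarrow> complex \<times> 'a \<Rightarrow> complex"
    by (induction as) (auto intro!: continuous_intros that)
  have "continuous_on S (\<lambda>\<phi>. ptterm \<phi> a b)" for a b
    by (cases "snd a \<in> carrier G \<and> snd b \<in> carrier G")
      (auto simp: ptterm_def intro!: continuous_intros continuous_on_eval)
  then show ?thesis unfolding ptform_def by (intro sl)
qed

text \<open>Each positivity condition involves only finitely many values of \<open>\<phi>\<close>
  and is therefore closed in the product topology, where Tychonoff's theorem applies to the
  discs.\<close>

lemma compact_states: "compact states"
proof -
  have "compactin (product_topology (\<lambda>_. euclidean) (UNIV :: 'a set)) (PiE UNIV (\<lambda>_. cball (0 :: complex) 1))"
    by (subst compactin_PiE) auto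
  then have "compact (PiE UNIV (\<lambda>_ :: 'a. cball (0 :: complex) 1))"
    unfolding euclidean_product_topology by simp
  moreover have "closed {\<phi>. positive_type \<phi> \<and> \<phi> \<one> = 1}"
  proof -
    have "{\<phi>. positive_type \<phi> \<and> \<phi> \<one> = 1} =
        (\<Inter>f. {\<phi>. Im (ptform \<phi> f f) = 0} \<inter> {\<phi>. 0 \<le> Re (ptform \<phi> f f)}) \<inter> {\<phi>. \<phi> \<one> = 1}"
      by (auto simp: positive_type_def)
    also have "closed \<dots>"
      by (intro closed_Int closed_INT ballI closed_Collect_eq closed_Collect_le continuous_intros
          continuous_on_ptform continuous_on_eval)
    finally show ?thesis .
  qed
  ultimately have "compact (PiE UNIV (\<lambda>_. cball 0 1) \<inter> {\<phi>. positive_type \<phi> \<and> \<phi> \<one> = 1})"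
    by (rule compact_Int_closed)
  also have "PiE UNIV (\<lambda>_. cball 0 1) \<inter> {\<phi>. positive_type \<phi> \<and> \<phi> \<one> = 1} = states"
    by (auto simp: states_def PiE_iff)
  finally show ?thesis .
qed

text \<open>
  The square-summable perturbation makes the maximised function strictly convex, so that it is
  maximal at an extreme point only.
\<close>
lemma exists_extreme_state:
  assumes cnt: "countable (carrier G)" and F: "finite F" and \<phi>\<^sub>0: "\<phi>\<^sub>0 \<in> states"
    and less: "(\<Sum>x\<in>F. Re (ptform \<phi>\<^sub>0 (a x) (a x))) < 1"
  obtains \<phi> where "\<phi> \<in> states" "(\<Sum>x\<in>F. Re (ptform \<phi> (a x) (a x))) < 1"
    "\<And>\<psi> \<theta> t. \<lbrakk>\<psi> \<in> states; \<theta> \<in> states; 0 < t; t < 1;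
       \<forall>x\<in>carrier G. \<phi> x = of_real t * \<psi> x + of_real (1 - t) * \<theta> x\<rbrakk> \<Longrightarrow> \<forall>x\<in>carrier G. \<psi> x = \<theta> x"
proof -
  define A where "A = (\<lambda>\<phi>. \<Sum>x\<in>F. Re (ptform \<phi> (a x) (a x)))"
  define g where "g = from_nat_into (carrier G)"
  have g: "g k \<in> carrier G" for k unfolding g_def by (rule from_nat_into) auto
  have surj: "\<exists>k. g k = x" if "x \<in> carrier G" for x
    using from_nat_into_surj[OF cnt that] by (simp add: g_def)
  \<comment> \<open>The weights sum to \<open>1\<close>, so that \<open>L\<close> lies between
    \<open>0\<close> and \<open>1\<close> on states. The enumeration \<open>g\<close> may repeat
    elements, but every element of the carrier gets a positive weight.\<close>
  define T where "T = (\<lambda>k (\<phi> :: 'a \<Rightarrow> complex). (1 / 2) ^ Suc k * (cmod (\<phi> (g k)))\<^sup>2)"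
  define L where "L = (\<lambda>\<phi>. suminf (\<lambda>k. T k \<phi>))"
  have half: "(\<lambda>k. (1 / 2 :: real) ^ Suc k) sums 1" by (rule power_half_series)
  have T_nonneg: "0 \<le> T k \<phi>" for k \<phi> by (simp add: T_def)
  have T_le: "T k \<phi> \<le> (1 / 2) ^ Suc k" if "\<phi> \<in> states" for k \<phi>
  proof -
    have "(cmod (\<phi> (g k)))\<^sup>2 \<le> 1" using that by (intro power_le_one) (auto simp: states_def)
    then show ?thesis unfolding T_def by (intro mult_left_le) auto
  qed
  have T_sum: "summable (\<lambda>k. T k \<phi>)" if "\<phi> \<in> states" for \<phi>
    by (rule summable_comparison_test[OF _ sums_summable[OF half]]) (use T_le[OF that] T_nonneg in auto)
  have L_nonneg: "0 \<le> L \<phi>" if "\<phi> \<in> states" for \<phi>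
    unfolding L_def by (rule suminf_nonneg[OF T_sum[OF that] T_nonneg])
  have L_le: "L \<phi> \<le> 1" if "\<phi> \<in> states" for \<phi>
    unfolding L_def using suminf_le[OF T_le[OF that] T_sum[OF that] sums_summable[OF half]]
    unfolding sums_unique[OF half, symmetric] .
  have "continuous_on states L"
    unfolding L_def
  proof (rule uniform_limit_theorem)
    show "uniform_limit states (\<lambda>n \<phi>. \<Sum>k<n. T k \<phi>) (\<lambda>\<phi>. suminf (\<lambda>k. T k \<phi>)) sequentially"
      by (rule Weierstrass_m_test[OF _ sums_summable[OF half]]) (use T_le T_nonneg in simp)
    show "\<forall>\<^sub>F n in sequentially. continuous_on states (\<lambda>\<phi>. \<Sum>k<n. T k \<phi>)"
      unfolding T_def by (intro always_eventually allI continuous_intros continuous_on_eval)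
  qed simp
  moreover have "continuous_on states A"
    unfolding A_def by (intro continuous_intros continuous_on_ptform)
  \<comment> \<open>Half of the available gap: the perturbation \<open>e * L\<close> moves the sum
    by at most \<open>e\<close>, which keeps it below \<open>1\<close> at the maximiser.\<close>
  moreover define e where "e = (1 - A \<phi>\<^sub>0) / 2"
  ultimately have "continuous_on states (\<lambda>\<phi>. e * L \<phi> - A \<phi>)" by (intro continuous_intros)
  then have "\<exists>\<phi>\<in>states. \<forall>\<psi>\<in>states. e * L \<psi> - A \<psi> \<le> e * L \<phi> - A \<phi>"
    by (rule continuous_attains_sup[OF compact_states, rotated]) (use \<phi>\<^sub>0 in auto)
  then obtain \<phi> where \<phi>: "\<phi> \<in> states" and max: "\<And>\<psi>. \<psi> \<in> states \<Longrightarrow> e * L \<psi> - A \<psi> \<le> e * L \<phi> - A \<phi>"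
    by blast
  have e: "e > 0" using less by (simp add: e_def A_def)
  have "A \<phi> \<le> A \<phi>\<^sub>0 + e * L \<phi> - e * L \<phi>\<^sub>0" using max[OF \<phi>\<^sub>0] by simp
  also have "\<dots> \<le> A \<phi>\<^sub>0 + e * 1 - e * 0"
    using e L_le[OF \<phi>] L_nonneg[OF \<phi>\<^sub>0] by (intro diff_mono add_left_mono mult_left_mono) auto
  also have "\<dots> < 1" using e by (simp add: e_def field_simps)
  finally have "A \<phi> < 1" .
  moreover have "\<psi> x = \<theta> x" if \<psi>: "\<psi> \<in> states" and \<theta>: "\<theta> \<in> states" and t: "0 < t" "t < 1"
    and eq: "\<forall>x\<in>carrier G. \<phi> x = of_real t * \<psi> x + of_real (1 - t) * \<theta> x" and x: "x \<in> carrier G"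
    for \<psi> \<theta> t x
  proof -
    have A: "A \<phi> = t * A \<psi> + (1 - t) * A \<theta>"
    proof -
      have "ptform \<phi> f f = of_real t * ptform \<psi> f f + of_real (1 - t) * ptform \<theta> f f" for f
        by (rule ptform_linear) (use eq in blast)
      then show ?thesis
        by (simp add: A_def sum.distrib sum_distrib_left del: of_real_diff)
    qed
    define d where "d = (\<lambda>x. \<psi> x - \<theta> x)"
    \<comment> \<open>The exact defect of convexity of the squared modulus. Summed with the weights,
      it bounds each difference of \<open>\<psi>\<close> and \<open>\<theta>\<close> by a quantity
      that maximality of \<open>\<phi>\<close> makes nonpositive.\<close>
    have cvx: "t * (cmod u)\<^sup>2 + (1 - t) * (cmod v)\<^sup>2 - (cmod (of_real t * u + of_real (1 - t) * v))\<^sup>2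
        = t * (1 - t) * (cmod (u - v))\<^sup>2" for u v :: complex
      unfolding cmod_power2 by (simp add: power2_eq_square algebra_simps)
    have T: "t * (1 - t) * T k d = t * T k \<psi> + (1 - t) * T k \<theta> - T k \<phi>" for k
    proof -
      have "t * T k \<psi> + (1 - t) * T k \<theta> - T k \<phi> = (1 / 2) ^ Suc k *
          (t * (cmod (\<psi> (g k)))\<^sup>2 + (1 - t) * (cmod (\<theta> (g k)))\<^sup>2 - (cmod (\<phi> (g k)))\<^sup>2)"
        by (simp add: T_def algebra_simps)
      also have "\<dots> = (1 / 2) ^ Suc k * (t * (1 - t) * (cmod (d (g k)))\<^sup>2)"
        unfolding bspec[OF eq g] cvx d_def ..
      finally show ?thesis by (simp add: T_def)
    qed
    have "(\<lambda>k. t * T k \<psi> + (1 - t) * T k \<theta> - T k \<phi>) sums (t * L \<psi> + (1 - t) * L \<theta> - L \<phi>)"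
      unfolding L_def
      by (intro sums_diff sums_add sums_mult summable_sums T_sum \<phi> \<psi> \<theta>)
    then have sums: "(\<lambda>k. t * (1 - t) * T k d) sums (t * L \<psi> + (1 - t) * L \<theta> - L \<phi>)"
      unfolding T .
    have "t * (e * L \<psi> - A \<psi>) + (1 - t) * (e * L \<theta> - A \<theta>) \<le> t * (e * L \<phi> - A \<phi>) + (1 - t) * (e * L \<phi> - A \<phi>)"
      using t max[OF \<psi>] max[OF \<theta>] by (intro add_mono mult_left_mono) auto
    then have "e * (t * L \<psi> + (1 - t) * L \<theta> - L \<phi>) \<le> 0"
      using A by (simp add: algebra_simps)
    then have le: "t * L \<psi> + (1 - t) * L \<theta> - L \<phi> \<le> 0" using e by (simp add: mult_le_0_iff)
    obtain k where k: "g k = x" using surj[OF x] by blast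
    have "t * (1 - t) * T k d \<le> t * L \<psi> + (1 - t) * L \<theta> - L \<phi>"
    proof -
      have "(\<Sum>i\<in>{k}. t * (1 - t) * T i d) \<le> suminf (\<lambda>i. t * (1 - t) * T i d)"
        by (rule sum_le_suminf[OF sums_summable[OF sums]]) (use t T_nonneg in auto)
      then show ?thesis using sums_unique[OF sums] by simp
    qed
    then have "t * (1 - t) * T k d \<le> 0" using le by simp
    then have "T k d \<le> 0" using t by (simp add: mult_le_0_iff)
    moreover have "T k d > 0" if "d x \<noteq> 0"
      unfolding T_def using that k by (intro mult_pos_pos zero_less_power) auto
    ultimately have "d x = 0" by force
    then show ?thesis by (simp add: d_def)
  qed
  ultimately show thesis using \<phi> that[of \<phi>] by (auto simp: A_def)
qed

text \<open>If all of the support of \<open>a x\<close> acted trivially, \<open>a x\<close> would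
  fix \<open>\<xi>\<close>, since its coefficients sum to \<open>1\<close>, and
  \<open>ptform \<phi> (a x) (a x)\<close> would be \<open>1\<close>. The other summands being
  nonnegative, the total could not stay below \<open>1\<close>.\<close>

lemma exists_irreducible_rep:
  assumes cnt: "countable (carrier G)" and F: "finite F" and \<phi>\<^sub>0: "\<phi>\<^sub>0 \<in> states"
    and less: "(\<Sum>x\<in>F. Re (ptform \<phi>\<^sub>0 (a x) (a x))) < 1"
    and a: "\<And>x. x \<in> F \<Longrightarrow> sum_list (map fst (a x)) = 1"
      "\<And>x. x \<in> F \<Longrightarrow> snd ` set (a x) \<subseteq> carrier G"
  obtains H :: "((complex \<times> 'a) list \<Rightarrow> complex) inner_space" and \<pi>
  where "irreducible_unitary_rep G H \<pi>"
    "\<And>x. x \<in> F \<Longrightarrow> \<exists>y\<in>snd ` set (a x). \<pi> y \<noteq> (\<lambda>v\<in>carrier H. v)"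
proof -
  obtain \<phi> where \<phi>: "\<phi> \<in> states" and less: "(\<Sum>x\<in>F. Re (ptform \<phi> (a x) (a x))) < 1"
    and ext: "\<And>\<psi> \<theta> t. \<lbrakk>\<psi> \<in> states; \<theta> \<in> states; 0 < t; t < 1;
       \<forall>x\<in>carrier G. \<phi> x = of_real t * \<psi> x + of_real (1 - t) * \<theta> x\<rbrakk> \<Longrightarrow> \<forall>x\<in>carrier G. \<psi> x = \<theta> x"
    using exists_extreme_state[OF cnt F \<phi>\<^sub>0 less] by blast
  obtain H :: "((complex \<times> 'a) list \<Rightarrow> complex) inner_space" and \<pi> \<xi> where
    u: "unitary_rep G H \<pi>" and \<xi>: "\<xi> \<in> carrier H" "inprod H \<xi> \<xi> = 1"
    and coef: "\<And>x. x \<in> carrier G \<Longrightarrow> inprod H (\<pi> x \<xi>) \<xi> = \<phi> x"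
    and cyc: "\<And>v. \<lbrakk>v \<in> carrier H; \<forall>x\<in>carrier G. inprod H v (\<pi> x \<xi>) = 0\<rbrakk> \<Longrightarrow> v = \<zero>\<^bsub>H\<^esub>"
    using GNS[OF \<phi>] by blast
  interpret unitary_rep G H \<pi> by (rule u)
  have "irreducible_unitary_rep G H \<pi>"
  proof (rule irreducible_if_extreme[OF \<xi> cyc])
    fix \<psi> \<theta> t
    assume *: "\<psi> \<in> states" "\<theta> \<in> states" "0 < t" "t < (1::real)"
      and eq: "\<forall>x\<in>carrier G. coefficient \<xi> x = of_real t * \<psi> x + of_real (1 - t) * \<theta> x"
    show "\<forall>x\<in>carrier G. \<psi> x = \<theta> x"
      by (rule ext[OF *]) (use eq coef in \<open>simp add: coefficient_def\<close>)
  qed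
  moreover have "\<exists>y\<in>snd ` set (a x). \<pi> y \<noteq> (\<lambda>v\<in>carrier H. v)" if x: "x \<in> F" for x
  proof (rule ccontr)
    assume "\<not> (\<exists>y\<in>snd ` set (a x). \<pi> y \<noteq> (\<lambda>v\<in>carrier H. v))"
    then have triv: "\<pi> (snd b) \<xi> = \<xi>" if "b \<in> set (a x)" for b
      using that \<xi>(1) by auto
    have "set f \<subseteq> set (a x) \<Longrightarrow> apply_list \<xi> f = sum_list (map fst f) \<odot>\<^bsub>H\<^esub> \<xi>" for f
    proof (induction f)
      case (Cons b f)
      then have "snd b \<in> carrier G" "\<pi> (snd b) \<xi> = \<xi>" using a(2)[OF x] triv by auto
      then show ?case using Cons \<xi> smult_l_distr[of "fst b" "sum_list (map fst f)" \<xi>]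
        by (simp add: apply_list_def)
    qed (use smult_l_null[OF \<xi>(1)] in \<open>simp add: apply_list_def\<close>)
    then have "apply_list \<xi> (a x) = \<xi>" using a(1)[OF x] smult_one[OF \<xi>(1)] by simp
    then have "ptform \<phi> (a x) (a x) = 1"
      using inprod_apply_list[OF \<xi>(1) coef[symmetric], of "a x" "a x"] \<xi>(2) by simp
    moreover have "Re (ptform \<phi> (a x) (a x)) \<le> (\<Sum>x\<in>F. Re (ptform \<phi> (a x) (a x)))"
      using \<phi> by (intro member_le_sum[OF x _ F]) (auto simp: states_def positive_type_def)
    ultimately show False using less by simp
  qed
  ultimately show thesis by (rule that)
qed

end

section \<open>States from finitely supported functions\<close>

context group
begin

lemma positive_type_bounded:
  assumes pt: "positive_type \<phi>" and 1: "\<phi> \<one> = 1" and x: "x \<in> carrier G"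
  shows "cmod (\<phi> x) \<le> 1"
proof -
  interpret S: semi_inner_space "ptform \<phi>" "(@)" scale_list
    by (rule semi_inner_space_ptform[OF pt])
  have "S.nrm [(1, y)] = 1" if "y \<in> carrier G" for y
    using that by (simp add: S.nrm_def ptform_def ptterm_def 1)
  then show ?thesis
    using S.cmod_ip_le[of "[(1, x)]" "[(1, \<one>)]"] x by (simp add: ptform_def ptterm_def)
qed

text \<open>The matrix coefficient of the right regular representation at the normalisation of
  \<open>q\<close>, for a finite \<open>D\<close> that contains the support of
  \<open>q\<close>.\<close>

definition autocorrelation :: "('a \<Rightarrow> complex) \<Rightarrow> 'a set \<Rightarrow> 'a \<Rightarrow> complex" where
  "autocorrelation q D x =
     (if x \<in> carrier G then (\<Sum>h\<in>D. q (h \<otimes> x) * cnj (q h)) / of_real (\<Sum>h\<in>D. (cmod (q h))\<^sup>2) else 0)"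

text \<open>The formal sum \<open>f\<close> applied to \<open>q\<close> in the right regular
  representation, evaluated at \<open>h\<close>.\<close>

definition translates :: "('a \<Rightarrow> complex) \<Rightarrow> (complex \<times> 'a) list \<Rightarrow> 'a \<Rightarrow> complex" where
  "translates q f h = (\<Sum>a\<leftarrow>f. if snd a \<in> carrier G then fst a * q (h \<otimes> snd a) else 0)"

lemma ptform_autocorrelation:
  assumes D: "finite D" "D \<subseteq> carrier G" and q: "\<And>h. h \<notin> D \<Longrightarrow> q h = 0"
  obtains E where "finite E" "E \<subseteq> carrier G"
    "ptform (autocorrelation q D) f g =
       (\<Sum>h\<in>E. translates q f h * cnj (translates q g h)) / of_real (\<Sum>h\<in>D. (cmod (q h))\<^sup>2)"
proof -
  define N where "N = (of_real (\<Sum>h\<in>D. (cmod (q h))\<^sup>2) :: complex)"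
  \<comment> \<open>Outside \<open>E\<close> every translate of \<open>q\<close> by a term of
    \<open>g\<close> vanishes. So \<open>E\<close> suffices for the inner product, wherever the
    translates by the terms of \<open>f\<close> are supported.\<close>
  define E where "E = (\<Union>y\<in>snd ` set g \<inter> carrier G. (\<lambda>d. d \<otimes> inv y) ` D)"
  have E: "finite E" "E \<subseteq> carrier G" using D by (auto simp: E_def)
  define u where "u = (\<lambda>h a. if snd a \<in> carrier G then fst a * q (h \<otimes> snd a) else (0::complex))"
  have tt: "ptterm (autocorrelation q D) a b = (\<Sum>h\<in>E. u h a * cnj (u h b)) / N" if b: "b \<in> set g" for a b
  proof (cases "snd a \<in> carrier G \<and> snd b \<in> carrier G")
    case True
    define x y where "x = snd a" and "y = snd b"
    have x: "x \<in> carrier G" and y: "y \<in> carrier G" using True by (auto simp: x_def y_def)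
    define r where "r = (\<lambda>h. q (h \<otimes> (inv y \<otimes> x)) * cnj (q h))"
    have "(\<Sum>h\<in>D. r h) = (\<Sum>h\<in>(\<lambda>h. h \<otimes> y) ` E. r h)"
    proof (rule sum.mono_neutral_left)
      show "D \<subseteq> (\<lambda>h. h \<otimes> y) ` E"
      proof
        fix d assume d: "d \<in> D"
        then have "d \<otimes> inv y \<in> E" "d = d \<otimes> inv y \<otimes> y"
          using b y D by (auto simp: E_def y_def m_assoc)
        then show "d \<in> (\<lambda>h. h \<otimes> y) ` E" by blast
      qed
    qed (use E q in \<open>auto simp: r_def\<close>)
    also have "\<dots> = (\<Sum>h\<in>E. r (h \<otimes> y))"
      by (subst sum.reindex) (use E y in \<open>auto simp: inj_on_def subset_iff\<close>)
    also have "\<dots> = (\<Sum>h\<in>E. q (h \<otimes> x) * cnj (q (h \<otimes> y)))"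
    proof (rule sum.cong[OF refl])
      fix h assume "h \<in> E"
      then have h: "h \<in> carrier G" using E by blast
      have "h \<otimes> y \<otimes> (inv y \<otimes> x) = h \<otimes> (y \<otimes> inv y) \<otimes> x"
        by (simp only: m_assoc m_closed inv_closed h x y)
      then have "h \<otimes> y \<otimes> (inv y \<otimes> x) = h \<otimes> x" using h x y by simp
      then show "r (h \<otimes> y) = q (h \<otimes> x) * cnj (q (h \<otimes> y))" by (simp add: r_def)
    qed
    finally have eq: "(\<Sum>h\<in>D. r h) = (\<Sum>h\<in>E. q (h \<otimes> x) * cnj (q (h \<otimes> y)))" .
    have "ptterm (autocorrelation q D) a b = fst a * cnj (fst b) * ((\<Sum>h\<in>D. r h) / N)"
      using x y by (simp add: ptterm_def autocorrelation_def r_def N_def x_def y_def)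
    also have "\<dots> = (\<Sum>h\<in>E. u h a * cnj (u h b)) / N"
      unfolding eq using x y
      by (simp add: u_def x_def y_def sum_distrib_left mult_ac)
    finally show ?thesis .
  qed (auto simp: ptterm_def u_def)
  have ls: "(\<Sum>h\<in>E. \<Sum>b\<leftarrow>g'. v h b) = (\<Sum>b\<leftarrow>g'. \<Sum>h\<in>E. v h b)"
    for v :: "'a \<Rightarrow> complex \<times> 'a \<Rightarrow> complex" and g'
    by (induction g') (auto simp: sum.distrib)
  have cl: "cnj (\<Sum>b\<leftarrow>g'. v b) = (\<Sum>b\<leftarrow>g'. cnj (v b))" for v :: "complex \<times> 'a \<Rightarrow> complex" and g'
    by (induction g') auto
  have tr: "translates q f' h = (\<Sum>a\<leftarrow>f'. u h a)" for f' h
    by (simp add: translates_def u_def)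
  have "ptform (autocorrelation q D) f g = (\<Sum>a\<leftarrow>f. \<Sum>b\<leftarrow>g. (\<Sum>h\<in>E. u h a * cnj (u h b)) / N)"
    unfolding ptform_def by (intro arg_cong[where f = sum_list] map_cong refl tt)
  also have "\<dots> = (\<Sum>h\<in>E. (\<Sum>a\<leftarrow>f. \<Sum>b\<leftarrow>g. u h a * cnj (u h b))) / N"
    unfolding ls divide_inverse sum_list_mult_const by (simp only: sum_list_mult_const)
  also have "\<dots> = (\<Sum>h\<in>E. translates q f h * cnj (translates q g h)) / N"
    unfolding tr cl
    by (simp only: sum_list_mult_const sum_list_const_mult)
  finally show thesis using that[OF E] by (simp add: N_def)
qed

lemma autocorrelation_states:
  assumes D: "finite D" "D \<subseteq> carrier G" and q: "\<And>h. h \<notin> D \<Longrightarrow> q h = 0" and nz: "\<exists>h. q h \<noteq> 0"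
  shows "autocorrelation q D \<in> states"
proof -
  define N where "N = (\<Sum>h\<in>D. (cmod (q h))\<^sup>2)"
  obtain h where h: "q h \<noteq> 0" using nz by blast
  then have "h \<in> D" using q by blast
  then have "N > 0" unfolding N_def using D h by (intro sum_pos2[of D h]) auto
  have pt: "positive_type (autocorrelation q D)"
    unfolding positive_type_def
  proof (intro allI)
    fix f
    show "Im (ptform (autocorrelation q D) f f) = 0 \<and> 0 \<le> Re (ptform (autocorrelation q D) f f)"
    proof (rule ptform_autocorrelation[OF D q, where f = f and g = f])
      fix E assume "ptform (autocorrelation q D) f f =
        (\<Sum>h\<in>E. translates q f h * cnj (translates q f h)) / of_real (\<Sum>h\<in>D. (cmod (q h))\<^sup>2)"
      also have "\<dots> = of_real ((\<Sum>h\<in>E. (cmod (translates q f h))\<^sup>2) / N)"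
        by (simp only: N_def complex_norm_square[symmetric] of_real_sum of_real_divide)
      finally show ?thesis using \<open>N > 0\<close> by (simp add: sum_nonneg)
    qed
  qed
  have one: "autocorrelation q D \<one> = 1"
  proof -
    have "(\<Sum>h\<in>D. q (h \<otimes> \<one>) * cnj (q h)) = (\<Sum>h\<in>D. of_real ((cmod (q h))\<^sup>2))"
      using D by (intro sum.cong) (auto simp: complex_norm_square subset_iff simp del: of_real_power)
    also have "\<dots> = of_real N" by (simp only: N_def of_real_sum)
    finally show ?thesis
      unfolding autocorrelation_def N_def[symmetric] using \<open>N > 0\<close> by simp
  qed
  have "cmod (autocorrelation q D x) \<le> 1" for x
    by (cases "x \<in> carrier G")
      (use positive_type_bounded[OF pt one] in \<open>simp_all add: autocorrelation_def\<close>)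
  then show ?thesis using pt one by (simp add: states_def)
qed

section \<open>Uniform probabilities on finite sets\<close>

definition uniform_list :: "'a set \<Rightarrow> (complex \<times> 'a) list" where
  "uniform_list Y = map (\<lambda>y. (1 / of_nat (card Y), y)) (SOME ys. set ys = Y \<and> distinct ys)"

lemma some_distinct_list:
  assumes "finite Y"
  shows "set (SOME ys. set ys = Y \<and> distinct ys) = Y" "distinct (SOME ys. set ys = Y \<and> distinct ys)"
  using someI_ex[OF finite_distinct_list[OF assms]] by auto

lemma sum_list_uniform:
  assumes "finite Y"
  shows "(\<Sum>a\<leftarrow>uniform_list Y. h a) = (\<Sum>y\<in>Y. h (1 / of_nat (card Y), y))"
  using some_distinct_list[OF assms]
  by (simp add: uniform_list_def comp_def sum_list_distinct_conv_sum_set)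

lemma set_uniform_list: "finite Y \<Longrightarrow> snd ` set (uniform_list Y) = Y"
  using some_distinct_list by (simp add: uniform_list_def image_image)

lemma sum_list_fst_uniform: "finite Y \<Longrightarrow> Y \<noteq> {} \<Longrightarrow> sum_list (map fst (uniform_list Y)) = 1"
  using sum_list_uniform[of Y fst] by simp

text \<open>For fixed \<open>z\<close> the products \<open>inv z \<otimes> y\<close> are distinct,
  so at most \<open>card T\<close> of them fall in \<open>T\<close>. Of the
  \<open>(card Y)\<^sup>2\<close> terms, each bounded by \<open>1 / (card Y)\<^sup>2\<close>, at
  most \<open>card Y * card T\<close> survive. With \<open>T\<close> the support of
  \<open>\<phi>\<close> and \<open>Y\<close> large, the value is small; with
  \<open>T = {\<one>}\<close> and \<open>Y\<close> a subgroup, it is at most the reciprocal of the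
  order.\<close>

lemma ptform_uniform_le:
  assumes \<phi>: "\<phi> \<in> states" and Y: "finite Y" "Y \<subseteq> carrier G" "Y \<noteq> {}" and T: "finite T"
    and supp: "\<And>y z. \<lbrakk>y \<in> Y; z \<in> Y; \<phi> (inv z \<otimes> y) \<noteq> 0\<rbrakk> \<Longrightarrow> inv z \<otimes> y \<in> T"
  shows "Re (ptform \<phi> (uniform_list Y) (uniform_list Y)) \<le> card T / card Y"
proof -
  define c where "c = real (card Y)"
  have c: "c > 0" using Y by (simp add: c_def card_gt_0_iff)
  have "ptform \<phi> (uniform_list Y) (uniform_list Y) =
      (\<Sum>y\<in>Y. \<Sum>z\<in>Y. of_real (1 / c) * of_real (1 / c) * \<phi> (inv z \<otimes> y))"
    unfolding ptform_def sum_list_uniform[OF Y(1)]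
    by (intro sum.cong refl) (use Y in \<open>auto simp: ptterm_def c_def subset_iff\<close>)
  also have "\<dots> = of_real (1 / c) * of_real (1 / c) * (\<Sum>y\<in>Y. \<Sum>z\<in>Y. \<phi> (inv z \<otimes> y))"
    by (simp only: sum_distrib_left)
  finally have "cmod (ptform \<phi> (uniform_list Y) (uniform_list Y)) =
      1 / c * (1 / c) * cmod (\<Sum>y\<in>Y. \<Sum>z\<in>Y. \<phi> (inv z \<otimes> y))"
    using c by (simp add: norm_mult norm_divide)
  then have Re_le: "Re (ptform \<phi> (uniform_list Y) (uniform_list Y)) \<le>
      1 / c * (1 / c) * cmod (\<Sum>y\<in>Y. \<Sum>z\<in>Y. \<phi> (inv z \<otimes> y))"
    using complex_Re_le_cmod by metis
  have "cmod (\<Sum>y\<in>Y. \<Sum>z\<in>Y. \<phi> (inv z \<otimes> y)) \<le> (\<Sum>z\<in>Y. \<Sum>y\<in>Y. cmod (\<phi> (inv z \<otimes> y)))"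
    by (subst sum.swap) (intro order_trans[OF norm_sum] sum_mono norm_sum)
  also have "\<dots> \<le> (\<Sum>z\<in>Y. real (card T))"
  proof (rule sum_mono)
    fix z assume z: "z \<in> Y"
    have inj: "inj_on (\<lambda>y. inv z \<otimes> y) Y" using z Y by (auto simp: inj_on_def subset_iff)
    have "(\<Sum>y\<in>Y. cmod (\<phi> (inv z \<otimes> y))) \<le> (\<Sum>y\<in>Y. if inv z \<otimes> y \<in> T then 1 else 0)"
      using supp[OF _ z] \<phi> by (intro sum_mono) (auto simp: states_def)
    also have "\<dots> = (\<Sum>w\<in>(\<lambda>y. inv z \<otimes> y) ` Y. if w \<in> T then 1 else 0)"
      by (simp add: sum.reindex[OF inj])
    also have "\<dots> = real (card (((\<lambda>y. inv z \<otimes> y) ` Y) \<inter> T))"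
      using Y by (simp add: sum.If_cases)
    also have "\<dots> \<le> real (card T)" using T by (simp add: card_mono)
    finally show "(\<Sum>y\<in>Y. cmod (\<phi> (inv z \<otimes> y))) \<le> real (card T)" .
  qed
  finally have "1 / c * (1 / c) * cmod (\<Sum>y\<in>Y. \<Sum>z\<in>Y. \<phi> (inv z \<otimes> y)) \<le> 1 / c * (1 / c) * (c * real (card T))"
    using c by (intro mult_left_mono) (auto simp: c_def)
  also have "\<dots> = card T / card Y" using c by (simp add: c_def)
  finally show ?thesis using Re_le by linarith
qed

text \<open>Vanishing coset sums say that averaging over \<open>M\<close> in the right regular
  representation annihilates \<open>q\<close>.\<close>

lemma ptform_uniform_eq_0:
  assumes D: "finite D" "D \<subseteq> carrier G" and q: "\<And>h. h \<notin> D \<Longrightarrow> q h = 0"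
    and M: "finite M" "M \<subseteq> carrier G" and sum: "\<And>g. g \<in> carrier G \<Longrightarrow> (\<Sum>m\<in>M. q (g \<otimes> m)) = 0"
  shows "ptform (autocorrelation q D) (uniform_list M) (uniform_list M) = 0"
proof -
  have tr: "translates q (uniform_list M) h = 0" if "h \<in> carrier G" for h
  proof -
    have "translates q (uniform_list M) h = (\<Sum>m\<in>M. 1 / of_nat (card M) * q (h \<otimes> m))"
      unfolding translates_def sum_list_uniform[OF M(1)] using M by (intro sum.cong) auto
    also have "\<dots> = 0" by (simp only: sum_distrib_left[symmetric] sum[OF that] mult_zero_right)
    finally show ?thesis .
  qed
  obtain E where "E \<subseteq> carrier G" and eq: "ptform (autocorrelation q D) (uniform_list M) (uniform_list M) =
       (\<Sum>h\<in>E. translates q (uniform_list M) h * cnj (translates q (uniform_list M) h))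
         / of_real (\<Sum>h\<in>D. (cmod (q h))\<^sup>2)"
    by (rule ptform_autocorrelation[OF D q, where f = "uniform_list M" and g = "uniform_list M"]) blast+
  then have "(\<Sum>h\<in>E. translates q (uniform_list M) h * cnj (translates q (uniform_list M) h)) = 0"
    by (intro sum.neutral) (auto simp: tr)
  then show ?thesis unfolding eq by simp
qed

end

section \<open>Products of normal subgroups\<close>

context group
begin

primrec set_mult_list :: "'a set list \<Rightarrow> 'a set" where
  "set_mult_list [] = {\<one>}"
| "set_mult_list (M # Ms) = M <#> set_mult_list Ms"

primrec independent_list :: "'a set list \<Rightarrow> bool" where
  "independent_list [] \<longleftrightarrow> True"
| "independent_list (M # Ms) \<longleftrightarrow> M \<inter> set_mult_list Ms = {\<one>} \<and> independent_list Ms"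

lemma inv_mult_cancel:
  assumes "x \<in> carrier G" "m \<in> carrier G"
  shows "inv x \<otimes> (x \<otimes> m) = m" "x \<otimes> (inv x \<otimes> m) = m"
  using assms by (simp_all add: m_assoc[symmetric])

lemma normal_set_mult:
  assumes "M \<lhd> G" "N \<lhd> G"
  shows "M <#> N \<lhd> G"
proof (rule normal_invI)
  interpret M: normal M G by fact
  interpret N: normal N G by fact
  show "subgroup (M <#> N) G"
    by (rule mult_norm_subgroup[OF assms(1) N.subgroup_axioms])
  fix x h assume x: "x \<in> carrier G" and "h \<in> M <#> N"
  then obtain m n where mn: "m \<in> M" "n \<in> N" "h = m \<otimes> n" by (auto simp: set_mult_def)
  have "x \<otimes> h \<otimes> inv x = (x \<otimes> m \<otimes> inv x) \<otimes> (x \<otimes> n \<otimes> inv x)"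
    using x mn by (simp add: m_assoc inv_mult_cancel)
  moreover have "x \<otimes> m \<otimes> inv x \<in> M" "x \<otimes> n \<otimes> inv x \<in> N"
    using x mn M.inv_op_closed2 N.inv_op_closed2 by auto
  ultimately show "x \<otimes> h \<otimes> inv x \<in> M <#> N" by (auto simp: set_mult_def)
qed

lemma normal_set_mult_list:
  "(\<And>M. M \<in> set Ms \<Longrightarrow> M \<lhd> G) \<Longrightarrow> set_mult_list Ms \<lhd> G"
  by (induction Ms) (auto simp: one_is_normal normal_set_mult)

lemma set_mult_list_commute:
  assumes "t \<in> carrier G" "\<And>M. M \<in> set Ms \<Longrightarrow> M \<subseteq> carrier G"
    and "\<And>M m. M \<in> set Ms \<Longrightarrow> m \<in> M \<Longrightarrow> t \<otimes> m = m \<otimes> t"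
    and "z \<in> set_mult_list Ms"
  shows "z \<in> carrier G \<and> t \<otimes> z = z \<otimes> t"
  using assms(2-4)
proof (induction Ms arbitrary: z)
  case Nil
  then show ?case using assms(1) by simp
next
  case (Cons M Ms)
  then obtain m y where z: "m \<in> M" "y \<in> set_mult_list Ms" "z = m \<otimes> y"
    by (auto simp: set_mult_def)
  have "y \<in> carrier G \<and> t \<otimes> y = y \<otimes> t"
    by (rule Cons.IH) (use Cons.prems z in auto)
  then have y: "y \<in> carrier G" "t \<otimes> y = y \<otimes> t" by auto
  have m: "m \<in> carrier G" "t \<otimes> m = m \<otimes> t" using Cons.prems(1)[of M] Cons.prems(2)[of M m] z by auto
  have "t \<otimes> z = (t \<otimes> m) \<otimes> y" by (simp only: z m_assoc assms(1) m(1) y(1))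
  also have "\<dots> = m \<otimes> (t \<otimes> y)" by (simp only: m(2) m_assoc assms(1) m(1) y(1))
  also have "\<dots> = z \<otimes> t" by (simp only: y(2) z m_assoc assms(1) m(1) y(1))
  finally show ?case using z m y by simp
qed

text \<open>
  Multiplying \<open>q\<close> on the right by \<open>\<one> - x\<close> in the group algebra makes all its sums over cosets of
  a normal subgroup containing \<open>x\<close> vanish, and preserves this property for every other normal
  subgroup.
\<close>
lemma exists_coset_sums_zero:
  assumes "\<And>M. M \<in> set Ms \<Longrightarrow> M \<lhd> G \<and> finite M \<and> M \<noteq> {\<one>}" "independent_list Ms"
  shows "\<exists>(q :: 'a \<Rightarrow> complex) D. finite D \<and> D \<subseteq> set_mult_list Ms \<and> (\<forall>h. h \<notin> D \<longrightarrow> q h = 0) \<and>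
    (\<exists>h. q h \<noteq> 0) \<and> (\<forall>M\<in>set Ms. \<forall>g\<in>carrier G. (\<Sum>m\<in>M. q (g \<otimes> m)) = 0)"
  using assms
proof (induction Ms)
  case Nil
  show ?case
    by (intro exI[of _ "\<lambda>h. if h = \<one> then 1 else 0"] exI[of _ "{\<one>}"]) auto
next
  case (Cons K Ms)
  define B where "B = set_mult_list Ms"
  have KN: "K \<lhd> G" and Kfin: "finite K" and K1: "K \<noteq> {\<one>}" and ind: "K \<inter> B = {\<one>}"
    using Cons by (auto simp: B_def)
  interpret K: normal K G by (rule KN)
  have BN: "B \<lhd> G" unfolding B_def using Cons by (intro normal_set_mult_list) auto
  interpret B: normal B G by (rule BN)
  have "\<exists>(q :: 'a \<Rightarrow> complex) D. finite D \<and> D \<subseteq> B \<and> (\<forall>h. h \<notin> D \<longrightarrow> q h = 0) \<and>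
    (\<exists>h. q h \<noteq> 0) \<and> (\<forall>M\<in>set Ms. \<forall>g\<in>carrier G. (\<Sum>m\<in>M. q (g \<otimes> m)) = 0)"
    unfolding B_def by (rule Cons.IH) (use Cons.prems in auto)
  then obtain q :: "'a \<Rightarrow> complex" and D h\<^sub>0 where D: "finite D" "D \<subseteq> B" and q: "\<And>h. h \<notin> D \<Longrightarrow> q h = 0"
    and h\<^sub>0: "q h\<^sub>0 \<noteq> 0" and sums: "\<And>M g. M \<in> set Ms \<Longrightarrow> g \<in> carrier G \<Longrightarrow> (\<Sum>m\<in>M. q (g \<otimes> m)) = 0"
    by blast
  obtain x where x: "x \<in> K" "x \<noteq> \<one>" using K1 K.one_closed by auto
  have xG: "x \<in> carrier G" using x by simp
  \<comment> \<open>Off the carrier \<open>g \<otimes> inv x\<close> is unspecified and might fall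
    in \<open>D\<close>, so \<open>q'\<close> is set to zero there.\<close>
  define q' where "q' = (\<lambda>g. if g \<in> carrier G then q g - q (g \<otimes> inv x) else 0)"
  define D' where "D' = D \<union> (\<lambda>d. d \<otimes> x) ` D"
  have BK: "B \<subseteq> K <#> B"
  proof
    fix b assume b: "b \<in> B"
    then have "b = \<one> \<otimes> b" by simp
    then show "b \<in> K <#> B" unfolding set_mult_def using b K.one_closed by blast
  qed
  have dx: "d \<otimes> x \<in> K <#> B" if d: "d \<in> B" for d
  proof -
    have "(d \<otimes> x \<otimes> inv d) \<otimes> d \<in> K <#> B"
      unfolding set_mult_def using K.inv_op_closed2[of d x] d x by auto
    then show ?thesis using d x by (simp add: m_assoc)
  qed
  have "finite D'" "D' \<subseteq> set_mult_list (K # Ms)"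
    using D BK dx by (auto simp: D'_def B_def[symmetric])
  moreover have "q' h = 0" if h: "h \<notin> D'" for h
  proof (cases "h \<in> carrier G")
    case True
    have "h \<otimes> inv x \<notin> D"
    proof
      assume "h \<otimes> inv x \<in> D"
      then have "h \<otimes> inv x \<otimes> x \<in> D'" by (auto simp: D'_def)
      then show False using h True xG by (simp add: m_assoc)
    qed
    then show ?thesis using h q by (simp add: q'_def D'_def)
  qed (simp add: q'_def)
  \<comment> \<open>Independence keeps \<open>q'\<close> from vanishing: \<open>x\<close> is not in
    \<open>B\<close>, so the translate of \<open>q\<close> by \<open>x\<close> lives on another
    coset of \<open>B\<close> than \<open>q\<close> itself.\<close>
  moreover have "q' h\<^sub>0 \<noteq> 0"
  proof -
    have hB: "h\<^sub>0 \<in> B" using h\<^sub>0 q D by blast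
    have "h\<^sub>0 \<otimes> inv x \<notin> B"
    proof
      assume "h\<^sub>0 \<otimes> inv x \<in> B"
      then have "inv (h\<^sub>0 \<otimes> inv x) \<otimes> h\<^sub>0 \<in> B" using hB by auto
      then have "x \<in> B" using hB xG by (simp add: inv_mult_group m_assoc)
      then show False using x ind by blast
    qed
    then have "q (h\<^sub>0 \<otimes> inv x) = 0" using q D by blast
    then show ?thesis using h\<^sub>0 hB by (simp add: q'_def)
  qed
  moreover have "(\<Sum>m\<in>M. q' (g \<otimes> m)) = 0" if M: "M \<in> set (K # Ms)" and g: "g \<in> carrier G" for M g
  proof -
    interpret M: normal M G using M Cons by auto
    have "(\<Sum>m\<in>M. q' (g \<otimes> m)) = (\<Sum>m\<in>M. q (g \<otimes> m)) - (\<Sum>m\<in>M. q (g \<otimes> m \<otimes> inv x))"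
      unfolding sum_subtractf[symmetric] using g by (intro sum.cong) (auto simp: q'_def)
    also have "\<dots> = 0"
    proof (cases "M = K")
      case True
      have "(\<Sum>m\<in>K. q (g \<otimes> m \<otimes> inv x)) = (\<Sum>m\<in>K. q (g \<otimes> m))"
        by (rule sum.reindex_bij_witness[where i = "\<lambda>m. m \<otimes> x" and j = "\<lambda>m. m \<otimes> inv x"])
          (use x g in \<open>auto simp: m_assoc\<close>)
      then show ?thesis using True by simp
    next
      case False
      then have MMs: "M \<in> set Ms" using M by auto
      \<comment> \<open>Conjugation by \<open>x\<close> permutes the normal subgroup
        \<open>M\<close> and turns the translated sum into a coset sum of \<open>q\<close> based at
        \<open>g \<otimes> inv x\<close>.\<close>
      have "(\<Sum>m\<in>M. q (g \<otimes> m \<otimes> inv x)) = (\<Sum>m\<in>M. q (g \<otimes> inv x \<otimes> m))"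
      proof (rule sum.reindex_bij_witness[where i = "\<lambda>m. inv x \<otimes> m \<otimes> x" and j = "\<lambda>m. x \<otimes> m \<otimes> inv x"])
        fix m assume m: "m \<in> M"
        then have mG: "m \<in> carrier G" by simp
        show "inv x \<otimes> (x \<otimes> m \<otimes> inv x) \<otimes> x = m" "x \<otimes> (inv x \<otimes> m \<otimes> x) \<otimes> inv x = m"
          using mG xG by (simp_all add: m_assoc inv_mult_cancel)
        show "x \<otimes> m \<otimes> inv x \<in> M" "inv x \<otimes> m \<otimes> x \<in> M"
          using m xG M.inv_op_closed1 M.inv_op_closed2 by auto
        show "q (g \<otimes> inv x \<otimes> (x \<otimes> m \<otimes> inv x)) = q (g \<otimes> m \<otimes> inv x)"
        proof -
          have "g \<otimes> inv x \<otimes> (x \<otimes> m \<otimes> inv x) = g \<otimes> (inv x \<otimes> x) \<otimes> (m \<otimes> inv x)"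
            by (simp only: m_assoc m_closed inv_closed g mG xG)
          then show ?thesis using g mG xG by (simp add: m_assoc)
        qed
      qed
      then show ?thesis using sums[OF MMs g] sums[OF MMs, of "g \<otimes> inv x"] g xG by simp
    qed
    finally show ?thesis .
  qed
  ultimately show ?case by (intro exI[of _ q'] exI[of _ D'] conjI) auto
qed

end

section \<open>Finite minimal normal subgroups\<close>

context group
begin

text \<open>Commutativity is left open, in contrast to \<open>minimal_finite_abelian_normal\<close>:
  the noncommutative case is handled by having trivial centre, the commutative one by being
  central.\<close>

definition finite_minimal_normal :: "'a set \<Rightarrow> bool" where
  "finite_minimal_normal M \<longleftrightarrow> M \<lhd> G \<and> finite M \<and> M \<noteq> {\<one>} \<and>
     (\<forall>K. K \<lhd> G \<and> K \<noteq> {\<one>} \<and> K \<subseteq> M \<longrightarrow> K = M)"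

lemma finite_minimal_normal_subset: "finite_minimal_normal M \<Longrightarrow> M \<subseteq> carrier G"
  using normal_imp_subgroup subgroup.subset unfolding finite_minimal_normal_def by blast

lemma finite_minimal_normal_normal: "finite_minimal_normal M \<Longrightarrow> M \<lhd> G"
  by (simp add: finite_minimal_normal_def)

lemma finite_minimal_normal_exists:
  assumes "finite N" "N \<lhd> G" "N \<noteq> {\<one>}"
  shows "\<exists>M. M \<subseteq> N \<and> finite_minimal_normal M"
  using assms
proof (induction N rule: finite_psubset_induct)
  case (psubset N)
  show ?case
  proof (cases "finite_minimal_normal N")
    case False
    then obtain K where K: "K \<lhd> G" "K \<noteq> {\<one>}" "K \<subset> N"
      using psubset unfolding finite_minimal_normal_def by blast
    then show ?thesis using psubset.IH[OF K(3) K(1,2)] by blast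
  qed blast
qed

lemma finite_minimal_normal_disjoint:
  assumes M: "finite_minimal_normal M" and N: "finite_minimal_normal N" and "M \<noteq> N"
  shows "M \<inter> N = {\<one>}"
proof (rule ccontr)
  assume ne: "M \<inter> N \<noteq> {\<one>}"
  have "M \<inter> N \<lhd> G" using M N by (auto simp: finite_minimal_normal_def intro: normal_subgroup_intersect)
  then have "M \<inter> N = M" "M \<inter> N = N"
    using M N ne unfolding finite_minimal_normal_def by (meson inf_le1 inf_le2)+
  then show False using \<open>M \<noteq> N\<close> by simp
qed

lemma finite_minimal_normal_commute:
  assumes "finite_minimal_normal M" "finite_minimal_normal N" "M \<noteq> N" "x \<in> M" "y \<in> N"
  shows "x \<otimes> y = y \<otimes> x"
  using assms finite_minimal_normal_disjoint[OF assms(1-3)]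
  by (intro normal_imp_commuting[of M N]) (auto simp: finite_minimal_normal_def)

definition commutative_subset :: "'a set \<Rightarrow> bool" where
  "commutative_subset M \<longleftrightarrow> (\<forall>x\<in>M. \<forall>y\<in>M. x \<otimes> y = y \<otimes> x)"

text \<open>The elements of \<open>M\<close> that commute with all of \<open>M\<close> form a normal
  subgroup of \<open>G\<close>, proper because \<open>M\<close> is noncommutative; minimality makes
  it trivial.\<close>

lemma finite_minimal_normal_centreless:
  assumes M: "finite_minimal_normal M" and nc: "\<not> commutative_subset M"
    and z: "z \<in> M" "\<And>m. m \<in> M \<Longrightarrow> z \<otimes> m = m \<otimes> z"
  shows "z = \<one>"
proof -
  interpret M: normal M G using M by (simp add: finite_minimal_normal_def)
  define Z where "Z = {z \<in> M. \<forall>m\<in>M. z \<otimes> m = m \<otimes> z}"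
  have "Z \<lhd> G"
  proof (rule normal_invI)
    show "subgroup Z G"
    proof (rule subgroupI)
      show "Z \<noteq> {}" using M.one_closed by (auto simp: Z_def intro!: exI[of _ \<one>])
      show "inv a \<in> Z" if "a \<in> Z" for a
      proof -
        have a: "a \<in> M" "\<And>m. m \<in> M \<Longrightarrow> a \<otimes> m = m \<otimes> a" using that by (auto simp: Z_def)
        have "inv a \<otimes> m = m \<otimes> inv a" if m: "m \<in> M" for m
        proof -
          have "inv a \<otimes> m = inv a \<otimes> (m \<otimes> a) \<otimes> inv a" using a m by (simp add: m_assoc)
          also have "\<dots> = inv a \<otimes> (a \<otimes> m) \<otimes> inv a" using a(2)[OF m] by simp
          also have "\<dots> = m \<otimes> inv a" using a(1) m by (simp add: inv_mult_cancel)
          finally show ?thesis .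
        qed
        then show ?thesis using a by (simp add: Z_def)
      qed
      show "a \<otimes> b \<in> Z" if "a \<in> Z" "b \<in> Z" for a b
      proof -
        have "a \<otimes> b \<otimes> m = m \<otimes> (a \<otimes> b)" if m: "m \<in> M" for m
        proof -
          have ab: "a \<in> M" "b \<in> M" "a \<otimes> m = m \<otimes> a" "b \<otimes> m = m \<otimes> b"
            using \<open>a \<in> Z\<close> \<open>b \<in> Z\<close> m by (auto simp: Z_def)
          have "a \<otimes> b \<otimes> m = a \<otimes> (m \<otimes> b)" using ab m by (simp add: m_assoc)
          also have "\<dots> = (a \<otimes> m) \<otimes> b" using ab(1,2) m by (simp add: m_assoc)
          also have "\<dots> = m \<otimes> (a \<otimes> b)" unfolding ab(3) using ab(1,2) m by (simp add: m_assoc)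
          finally show ?thesis .
        qed
        moreover have "a \<otimes> b \<in> M" using that unfolding Z_def by blast
        ultimately show ?thesis unfolding Z_def by blast
      qed
    qed (auto simp: Z_def)
    fix x h assume x: "x \<in> carrier G" and h: "h \<in> Z"
    have hM: "h \<in> M" and hc: "\<And>m. m \<in> M \<Longrightarrow> h \<otimes> m = m \<otimes> h" using h by (auto simp: Z_def)
    have "x \<otimes> h \<otimes> inv x \<otimes> m = m \<otimes> (x \<otimes> h \<otimes> inv x)" if m: "m \<in> M" for m
    proof -
      define m' where "m' = inv x \<otimes> m \<otimes> x"
      have m': "m' \<in> M" using M.inv_op_closed1[OF x m] by (simp add: m'_def)
      have mG: "m \<in> carrier G" "m' \<in> carrier G" "h \<in> carrier G" using m m' hM by auto
      have mm: "m = x \<otimes> m' \<otimes> inv x" using x mG by (simp add: m'_def m_assoc inv_mult_cancel)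
      have "x \<otimes> h \<otimes> inv x \<otimes> m = x \<otimes> (h \<otimes> m') \<otimes> inv x"
        unfolding mm using x mG by (simp add: m_assoc inv_mult_cancel)
      also have "\<dots> = x \<otimes> (m' \<otimes> h) \<otimes> inv x" using hc[OF m'] by simp
      also have "\<dots> = m \<otimes> (x \<otimes> h \<otimes> inv x)"
        unfolding mm using x mG by (simp add: m_assoc inv_mult_cancel)
      finally show ?thesis .
    qed
    then show "x \<otimes> h \<otimes> inv x \<in> Z" using M.inv_op_closed2[OF x hM] by (simp add: Z_def)
  qed
  moreover have "Z \<noteq> M" using nc by (auto simp: Z_def commutative_subset_def)
  ultimately have "Z = {\<one>}" using M unfolding finite_minimal_normal_def Z_def by blast
  then show ?thesis using z by (auto simp: Z_def)
qed

section \<open>Central subgroups of prime order\<close>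

lemma central_imp_normal:
  assumes "subgroup K G" "\<And>x g. x \<in> K \<Longrightarrow> g \<in> carrier G \<Longrightarrow> x \<otimes> g = g \<otimes> x"
  shows "K \<lhd> G"
proof (rule normal_invI[OF assms(1)])
  fix x h assume x: "x \<in> carrier G" and h: "h \<in> K"
  have "x \<otimes> h \<otimes> inv x = h \<otimes> x \<otimes> inv x" using assms(2)[OF h x] by simp
  then show "x \<otimes> h \<otimes> inv x \<in> K" using x h subgroup.mem_carrier[OF assms(1) h] by (simp add: m_assoc)
qed

text \<open>Subgroups of a central subgroup are normal in \<open>G\<close>, so by minimality every
  nontrivial element generates \<open>M\<close>. For a prime \<open>p\<close> dividing
  \<open>card M\<close> the power \<open>x [^] (card M div p)\<close> is nontrivial and hence of
  order \<open>card M\<close>, but its \<open>p\<close>-th power is \<open>\<one>\<close>; this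
  leaves \<open>card M = p\<close>.\<close>

lemma central_minimal_prime_card:
  assumes M: "finite_minimal_normal M" and c: "central_subgroup M G"
  shows "Factorial_Ring.prime (card M)" "\<And>x. x \<in> M \<Longrightarrow> x [^] card M = \<one>"
    "\<And>x. x \<in> M \<Longrightarrow> x \<noteq> \<one> \<Longrightarrow> M = (\<lambda>k. x [^] k) ` {..<card M} \<and> ord x = card M"
proof -
  interpret M: normal M G using M by (simp add: finite_minimal_normal_def)
  have fin: "finite M" using M by (simp add: finite_minimal_normal_def)
  have cc: "x \<otimes> g = g \<otimes> x" if "x \<in> M" "g \<in> carrier G" for x g
    using c that by (auto simp: central_subgroup_def)
  have gen: "generate G {x} = M \<and> ord x = card M" if x: "x \<in> M" "x \<noteq> \<one>" for x
  proof -
    have xG: "x \<in> carrier G" using x by simp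
    have sub: "generate G {x} \<subseteq> M" by (rule generate_subgroup_incl) (use x M.subgroup_axioms in auto)
    have "generate G {x} \<lhd> G"
      by (rule central_imp_normal[OF generate_is_subgroup]) (use xG sub cc in auto)
    moreover have "x \<in> generate G {x}" by (rule generate.incl) simp
    ultimately have "generate G {x} = M" using M x sub unfolding finite_minimal_normal_def by blast
    then show ?thesis using generate_pow_card[OF xG] by simp
  qed
  obtain x where x: "x \<in> M" "x \<noteq> \<one>" using M M.one_closed by (auto simp: finite_minimal_normal_def)
  have xG: "x \<in> carrier G" using x by simp
  have cardpos: "card M > 0" using fin x by (auto simp: card_gt_0_iff)
  have "card M \<noteq> 1"
    using x M.one_closed card_1_singletonE by (metis singletonD)
  then obtain p where p: "Factorial_Ring.prime p" "p dvd card M" using prime_factor_nat by blast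
  define y where "y = x [^] (card M div p)"
  have "x [^] (k :: nat) \<in> M" for k by (induction k) (use x(1) in auto)
  then have yM: "y \<in> M" by (simp add: y_def)
  have ordx: "ord x = card M" using gen[OF x] by simp
  have "y \<noteq> \<one>"
  proof
    assume "y = \<one>"
    then have "card M dvd card M div p" using pow_eq_id[OF xG] ordx by (simp add: y_def)
    moreover have "card M div p < card M" "card M div p > 0"
      using cardpos p prime_gt_1_nat[OF p(1)] by (auto simp: dvd_imp_le div_greater_zero_iff)
    ultimately show False using nat_dvd_not_less by blast
  qed
  then have "ord y = card M" using gen[OF yM] by simp
  moreover have "y [^] p = \<one>"
    unfolding y_def using xG p ordx pow_ord_eq_1[OF xG] by (simp add: nat_pow_pow)
  ultimately have "card M dvd p" using pow_eq_id[of y p] yM by simp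
  then show "Factorial_Ring.prime (card M)" using p dvd_antisym by metis
  show "z [^] card M = \<one>" if "z \<in> M" for z
    using gen[of z] pow_ord_eq_1[of z] that by (cases "z = \<one>") auto
  show "M = (\<lambda>k. z [^] k) ` {..<card M} \<and> ord z = card M" if z: "z \<in> M" "z \<noteq> \<one>" for z
  proof
    show "ord z = card M" using gen[OF z] by simp
    have "M = {z [^] k | k. k \<in> (UNIV :: nat set)}"
      using gen[OF z] cardpos generate_pow_nat[of z] z by auto
    also have "\<dots> = {z [^] k | k. k \<in> {0..ord z - 1}}"
      by (rule ord_elems_inf_carrier) (use gen[OF z] cardpos z in auto)
    also have "\<dots> = (\<lambda>k. z [^] k) ` {0..ord z - 1}" by (rule Setcompr_eq_image)
    also have "{0..ord z - 1} = {..<card M}" using gen[OF z] cardpos by auto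
    finally show "M = (\<lambda>k. z [^] k) ` {..<card M}" .
  qed
qed

text \<open>Let a central \<open>z\<close> be \<open>t \<otimes> y\<close> with \<open>t\<close> in
  \<open>T\<close> and \<open>y\<close> in the product of the others. Since \<open>y\<close>
  commutes with \<open>T\<close>, so does \<open>t\<close>, and \<open>T\<close> has trivial centre,
  so \<open>t = \<one>\<close>. This confines the central part of the support of a state to the
  factors \<open>Cs\<close>.\<close>

lemma finite_minimal_normal_centreless_list:
  assumes "\<And>T. T \<in> set Ts \<Longrightarrow> finite_minimal_normal T \<and> \<not> commutative_subset T"
    and "\<And>C. C \<in> set Cs \<Longrightarrow> finite_minimal_normal C"
    and "distinct Ts" "set Ts \<inter> set Cs = {}"
    and "z \<in> set_mult_list (Ts @ Cs)" "\<And>g. g \<in> carrier G \<Longrightarrow> z \<otimes> g = g \<otimes> z"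
  shows "z \<in> set_mult_list Cs"
  using assms
proof (induction Ts)
  case (Cons T Ts)
  obtain t y where t: "t \<in> T" and y: "y \<in> set_mult_list (Ts @ Cs)" and z: "z = t \<otimes> y"
    using Cons.prems by (auto simp: set_mult_def)
  have T: "finite_minimal_normal T" using Cons.prems(1) by simp
  interpret T: normal T G using T by (simp add: finite_minimal_normal_def)
  have com: "y \<in> carrier G \<and> m \<otimes> y = y \<otimes> m" if m: "m \<in> T" for m
  proof (rule set_mult_list_commute[OF _ _ _ y])
    fix M assume M: "M \<in> set (Ts @ Cs)"
    have MM: "finite_minimal_normal M" and "M \<noteq> T" using M Cons.prems by auto
    show "M \<subseteq> carrier G" by (rule finite_minimal_normal_subset[OF MM])
    show "m \<otimes> x = x \<otimes> m" if "x \<in> M" for x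
      by (rule finite_minimal_normal_commute[OF T MM \<open>M \<noteq> T\<close>[symmetric] m that])
  qed (use m in simp)
  have yG: "y \<in> carrier G" using com[OF t] by simp
  have tG: "t \<in> carrier G" using t by simp
  have "t \<otimes> m = m \<otimes> t" if m: "m \<in> T" for m
  proof -
    have mG: "m \<in> carrier G" using m by simp
    have "t \<otimes> m \<otimes> y = t \<otimes> y \<otimes> m" using com[OF m] tG mG yG by (simp add: m_assoc)
    also have "\<dots> = m \<otimes> (t \<otimes> y)" using Cons.prems(6)[OF mG] z by simp
    also have "\<dots> = m \<otimes> t \<otimes> y" using tG mG yG by (simp add: m_assoc)
    finally show ?thesis using tG mG yG by simp
  qed
  then have "t = \<one>" using finite_minimal_normal_centreless[OF T _ t] Cons.prems(1)[of T] by simp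
  then have "z = y" using z yG by simp
  then show ?case using Cons.IH Cons.prems y by simp
qed simp

text \<open>Distinct minimal normal subgroups commute elementwise. An element of \<open>T\<close> in
  the product of the remaining ones therefore commutes with all of \<open>T\<close>, and a
  noncommutative \<open>T\<close> has trivial centre.\<close>

lemma independent_list_append:
  assumes "\<And>T. T \<in> set Ts \<Longrightarrow> finite_minimal_normal T \<and> \<not> commutative_subset T"
    and "\<And>C. C \<in> set Cs \<Longrightarrow> finite_minimal_normal C"
    and "distinct Ts" "set Ts \<inter> set Cs = {}" "independent_list Cs"
  shows "independent_list (Ts @ Cs)"
  using assms
proof (induction Ts)
  case (Cons T Ts)
  have T: "finite_minimal_normal T" "\<not> commutative_subset T" using Cons.prems(1) by auto
  interpret T: normal T G using T by (simp add: finite_minimal_normal_def)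
  have mem: "finite_minimal_normal M \<and> M \<noteq> T" if "M \<in> set (Ts @ Cs)" for M
    using that Cons.prems by auto
  interpret P: normal "set_mult_list (Ts @ Cs)" G
    by (rule normal_set_mult_list[OF finite_minimal_normal_normal]) (use mem in simp)
  have "t = \<one>" if t: "t \<in> T" "t \<in> set_mult_list (Ts @ Cs)" for t
  proof (rule finite_minimal_normal_centreless[OF T t(1)])
    fix m assume m: "m \<in> T"
    have "m \<otimes> t = t \<otimes> m"
    proof (rule conjunct2[OF set_mult_list_commute[OF _ _ _ t(2)]])
      fix M assume M: "M \<in> set (Ts @ Cs)"
      show "M \<subseteq> carrier G" using finite_minimal_normal_subset mem[OF M] by blast
      show "m \<otimes> x = x \<otimes> m" if "x \<in> M" for x
        using mem[OF M] finite_minimal_normal_commute[OF T(1) _ _ m that] by blast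
    qed (use m in simp)
    then show "t \<otimes> m = m \<otimes> t" by simp
  qed
  then have "T \<inter> set_mult_list (Ts @ Cs) = {\<one>}" using T.one_closed P.one_closed by auto
  moreover have "independent_list (Ts @ Cs)" using Cons by auto
  ultimately show ?case by simp
qed simp

lemma central_set_mult_list_pow:
  assumes "\<And>C. C \<in> set Cs \<Longrightarrow> central_subgroup C G \<and> (\<forall>x\<in>C. x [^] card C = \<one>)"
    and "z \<in> set_mult_list Cs"
  shows "z \<in> carrier G \<and> z [^] prod_list (map card Cs) = \<one>"
  using assms
proof (induction Cs arbitrary: z)
  case (Cons C Cs)
  obtain c y where c: "c \<in> C" and y: "y \<in> set_mult_list Cs" and z: "z = c \<otimes> y"
    using Cons.prems by (auto simp: set_mult_def)
  define N where "N = prod_list (map card Cs)"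
  have yN: "y \<in> carrier G" "y [^] N = \<one>" using Cons.IH[OF _ y] Cons.prems(1) by (auto simp: N_def)
  have C: "subgroup C G" "c [^] card C = \<one>" "c \<otimes> y = y \<otimes> c"
    using Cons.prems(1)[of C] c yN(1) by (auto simp: central_subgroup_def)
  have cG: "c \<in> carrier G" using subgroup.mem_carrier[OF C(1) c] .
  have "z [^] (card C * N) = c [^] (card C * N) \<otimes> y [^] (card C * N)"
    unfolding z using C(3) cG yN(1) by (rule pow_mult_distrib)
  also have "c [^] (card C * N) = \<one>" using cG C(2) by (simp add: nat_pow_pow[symmetric])
  also have "y [^] (card C * N) = \<one>"
    using yN by (simp add: nat_pow_pow[symmetric] mult.commute[of "card C"])
  finally show ?case using cG yN(1) z by (simp add: N_def)
qed simp

text \<open>Elements of the product have order dividing the product of the \<open>card C\<close>,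
  which is coprime to \<open>p\<close>.\<close>

lemma prime_order_not_in_set_mult_list:
  assumes Cs: "\<And>C. C \<in> set Cs \<Longrightarrow> central_subgroup C G \<and> (\<forall>x\<in>C. x [^] card C = \<one>) \<and>
      Factorial_Ring.prime (card C) \<and> card C \<noteq> p"
    and p: "Factorial_Ring.prime p" and x: "x \<in> set_mult_list Cs" "x [^] p = \<one>"
  shows "x = \<one>"
proof -
  have xG: "x \<in> carrier G" and xN: "x [^] prod_list (map card Cs) = \<one>"
    using central_set_mult_list_pow[OF _ x(1)] Cs by auto
  have "coprime p (prod_list (map card Cs))"
    using Cs
  proof (induction Cs)
    case (Cons C Cs)
    then have "coprime p (card C)" using p by (intro primes_coprime) auto
    then show ?case using Cons by simp
  qed simp
  moreover have "ord x dvd p" "ord x dvd prod_list (map card Cs)"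
    using pow_eq_id[OF xG] x(2) xN by auto
  ultimately have "ord x = 1" using coprime_common_divisor_nat by blast
  then show ?thesis using ord_eq_1[OF xG] by simp
qed

text \<open>The orders are primes, so distinct orders are coprime and no factor can meet the product
  of the later ones.\<close>

lemma independent_central_list:
  assumes "\<And>C. C \<in> set Cs \<Longrightarrow> finite_minimal_normal C \<and> central_subgroup C G"
    and "inj_on card (set Cs)" "distinct Cs"
  shows "independent_list Cs"
  using assms
proof (induction Cs)
  case (Cons C Cs)
  have C: "finite_minimal_normal C" "central_subgroup C G" using Cons.prems(1) by auto
  interpret C: normal C G using C by (simp add: finite_minimal_normal_def)
  interpret P: normal "set_mult_list Cs" G
    by (rule normal_set_mult_list[OF finite_minimal_normal_normal]) (use Cons.prems(1) in simp)
  have "x = \<one>" if x: "x \<in> C" "x \<in> set_mult_list Cs" for x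
  proof (rule prime_order_not_in_set_mult_list[OF _ central_minimal_prime_card(1)[OF C] x(2)])
    show "x [^] card C = \<one>" by (rule central_minimal_prime_card(2)[OF C x(1)])
    fix D assume D: "D \<in> set Cs"
    then have "card D \<noteq> card C" using Cons.prems(2,3) by (auto simp: inj_on_def)
    then show "central_subgroup D G \<and> (\<forall>x\<in>D. x [^] card D = \<one>) \<and>
      Factorial_Ring.prime (card D) \<and> card D \<noteq> card C"
      using Cons.prems(1)[of D] D central_minimal_prime_card(1,2)[of D] by auto
  qed
  then have "C \<inter> set_mult_list Cs = {\<one>}" using C.one_closed P.one_closed by auto
  moreover have "independent_list Cs" using Cons by auto
  ultimately show ?case by simp
qed simp

end

section \<open>Central elements in irreducible representations\<close>

context irreducible_unitary_rep
begin

text \<open>An instance of Schur's lemma for the eigenvalue \<open>1\<close>, obtained without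
  spectral theory: the vectors fixed by a central \<open>z\<close> form an invariant subspace, which
  is closed as the orthogonal complement of the range of \<open>\<pi> (inv z) - id\<close>.
  Irreducibility leaves only zero or everything.\<close>

lemma central_fixed_vector:
  assumes z: "z \<in> carrier G" "\<And>g. g \<in> carrier G \<Longrightarrow> z \<otimes>\<^bsub>G\<^esub> g = g \<otimes>\<^bsub>G\<^esub> z"
    and v: "v \<in> carrier H" "v \<noteq> \<zero>\<^bsub>H\<^esub>" "\<pi> z v = v"
  shows "\<pi> z = (\<lambda>v\<in>carrier H. v)"
proof -
  interpret G: group G by (rule group_G)
  define A where "A = (\<lambda>w. \<pi> (inv\<^bsub>G\<^esub> z) w \<ominus>\<^bsub>H\<^esub> w) ` carrier H"
  define W where "W = {u \<in> carrier H. \<forall>a\<in>A. inprod H u a = 0}"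
  have AH: "A \<subseteq> carrier H" using z by (auto simp: A_def rep_closed)
  have W: "u \<in> W \<longleftrightarrow> \<pi> z u = u" if u: "u \<in> carrier H" for u
  proof -
    have eq: "inprod H u (\<pi> (inv\<^bsub>G\<^esub> z) w \<ominus>\<^bsub>H\<^esub> w) = inprod H (\<pi> z u \<ominus>\<^bsub>H\<^esub> u) w" if "w \<in> carrier H" for w
      using z u that inprod_rep_left[of z u w]
      by (simp add: inprod_diff_left inprod_diff_right rep_closed)
    have zu: "\<pi> z u \<ominus>\<^bsub>H\<^esub> u \<in> carrier H" using z u by (simp add: rep_closed)
    have "u \<in> W \<longleftrightarrow> (\<forall>w\<in>carrier H. inprod H (\<pi> z u \<ominus>\<^bsub>H\<^esub> u) w = 0)"
      using u eq by (auto simp: W_def A_def)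
    also have "\<dots> \<longleftrightarrow> \<pi> z u \<ominus>\<^bsub>H\<^esub> u = \<zero>\<^bsub>H\<^esub>"
    proof
      assume "\<forall>w\<in>carrier H. inprod H (\<pi> z u \<ominus>\<^bsub>H\<^esub> u) w = 0"
      then have "Re (inprod H (\<pi> z u \<ominus>\<^bsub>H\<^esub> u) (\<pi> z u \<ominus>\<^bsub>H\<^esub> u)) = 0" using zu by simp
      then show "\<pi> z u \<ominus>\<^bsub>H\<^esub> u = \<zero>\<^bsub>H\<^esub>" using inprod_self_eq_0[OF zu] by blast
    qed simp
    also have "\<dots> \<longleftrightarrow> \<pi> z u = u" using z u by (intro minus_eq_zero_iff) (auto simp: rep_closed)
    finally show ?thesis .
  qed
  have "\<pi> x u \<in> W" if x: "x \<in> carrier G" and u: "u \<in> W" for x u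
  proof -
    have uH: "u \<in> carrier H" using u by (simp add: W_def)
    have "\<pi> z (\<pi> x u) = \<pi> (x \<otimes>\<^bsub>G\<^esub> z) u"
      unfolding z(2)[OF x, symmetric] by (rule rep_mult[symmetric, OF z(1) x uH])
    also have "\<dots> = \<pi> x u" using W[OF uH] u by (simp add: rep_mult x z(1) uH)
    finally show ?thesis using W[of "\<pi> x u"] x uH by (simp add: rep_closed)
  qed
  then have "W = {\<zero>\<^bsub>H\<^esub>} \<or> W = carrier H"
    using closed_subspace_orthogonal[OF AH] by (intro irreducible) (auto simp: W_def)
  moreover have "v \<in> W" using W[OF v(1)] v(3) by simp
  ultimately have "W = carrier H" using v(2) by blast
  then have "\<pi> z u = u" if "u \<in> carrier H" for u using W[OF that] that by blast
  moreover have "\<pi> z \<in> extensional (carrier H)"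
    using bij_prop0[OF z(1)] by (simp add: Bij_def)
  ultimately show ?thesis by (intro extensionalityI[of _ "carrier H"]) auto
qed

text \<open>The sum of the vectors \<open>\<pi> (z [^] k) v\<close> over a period is fixed by
  \<open>z\<close>, hence zero when \<open>z\<close> acts nontrivially. Pairing with
  \<open>w\<close> turns this into an identity of complex numbers.\<close>

lemma central_orbit_sum:
  assumes z: "z \<in> carrier G" "\<And>g. g \<in> carrier G \<Longrightarrow> z \<otimes>\<^bsub>G\<^esub> g = g \<otimes>\<^bsub>G\<^esub> z"
    and nt: "\<pi> z \<noteq> (\<lambda>v\<in>carrier H. v)" and p: "z [^]\<^bsub>G\<^esub> (p :: nat) = \<one>\<^bsub>G\<^esub>"
    and v: "v \<in> carrier H" and w: "w \<in> carrier H"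
  shows "(\<Sum>k<p. inprod H (\<pi> (z [^]\<^bsub>G\<^esub> k) v) w) = 0"
proof -
  interpret G: group G by (rule group_G)
  define s where "s = rec_nat \<zero>\<^bsub>H\<^esub> (\<lambda>k u. u \<oplus>\<^bsub>H\<^esub> \<pi> (z [^]\<^bsub>G\<^esub> k) v)"
  have s: "s 0 = \<zero>\<^bsub>H\<^esub>" "s (Suc k) = s k \<oplus>\<^bsub>H\<^esub> \<pi> (z [^]\<^bsub>G\<^esub> k) v" for k
    by (simp_all add: s_def)
  have sH: "s k \<in> carrier H" for k by (induction k) (use z v in \<open>auto simp: s rep_closed\<close>)
  have sum: "inprod H (s m) w = (\<Sum>k<m. inprod H (\<pi> (z [^]\<^bsub>G\<^esub> k) v) w)" for m
    by (induction m) (use z v w sH in \<open>auto simp: s inprod_add_left rep_closed\<close>)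
  \<comment> \<open>Applying \<open>\<pi> z\<close> shifts the indices by one, so both sides are
    \<open>s (Suc m)\<close>. At \<open>m = p\<close> the last term is \<open>v\<close> again and
    cancels.\<close>
  have shift: "\<pi> z (s m) \<oplus>\<^bsub>H\<^esub> v = s m \<oplus>\<^bsub>H\<^esub> \<pi> (z [^]\<^bsub>G\<^esub> m) v" for m
  proof (induction m)
    case 0
    have "\<pi> z \<zero>\<^bsub>H\<^esub> = \<zero>\<^bsub>H\<^esub>"
      using rep_smult[OF z(1), of "\<zero>\<^bsub>H\<^esub>" 0] smult_l_null[of "\<zero>\<^bsub>H\<^esub>"] smult_l_null[of "\<pi> z \<zero>\<^bsub>H\<^esub>"]
        rep_closed[OF z(1), of "\<zero>\<^bsub>H\<^esub>"] by simp
    then show ?case using v by (simp add: s rep_one)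
  next
    case (Suc m)
    have c: "\<pi> z (s m) \<in> carrier H" "\<pi> (z [^]\<^bsub>G\<^esub> k) v \<in> carrier H" for k :: nat
      using z v sH by (auto simp: rep_closed)
    have swap: "(a \<oplus>\<^bsub>H\<^esub> b) \<oplus>\<^bsub>H\<^esub> v = (a \<oplus>\<^bsub>H\<^esub> v) \<oplus>\<^bsub>H\<^esub> b" if "a \<in> carrier H" "b \<in> carrier H" for a b
      using that v by (simp add: M.a_ac)
    have "\<pi> z (s (Suc m)) = \<pi> z (s m) \<oplus>\<^bsub>H\<^esub> \<pi> (z [^]\<^bsub>G\<^esub> Suc m) v"
      using z v sH by (simp add: s rep_add rep_closed rep_mult[symmetric] G.nat_pow_Suc2[symmetric] del: G.nat_pow_Suc)
    then have "\<pi> z (s (Suc m)) \<oplus>\<^bsub>H\<^esub> v = (\<pi> z (s m) \<oplus>\<^bsub>H\<^esub> v) \<oplus>\<^bsub>H\<^esub> \<pi> (z [^]\<^bsub>G\<^esub> Suc m) v"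
      using swap[OF c(1) c(2)[of "Suc m"]] by (simp only:)
    then show ?case unfolding Suc by (simp only: s)
  qed
  have "\<pi> z (s p) \<oplus>\<^bsub>H\<^esub> v = s p \<oplus>\<^bsub>H\<^esub> v" using shift[of p] v by (simp add: p rep_one)
  then have "\<pi> z (s p) = s p" using z v sH by (simp add: rep_closed)
  then have "s p = \<zero>\<^bsub>H\<^esub>" using central_fixed_vector[OF z sH] nt by blast
  then show ?thesis using sum[of p] w by simp
qed

end

lemma sum_mult_mod_prime:
  fixes p k :: nat and g :: "nat \<Rightarrow> complex"
  assumes p: "Factorial_Ring.prime p" and k: "0 < k" "k < p"
  shows "(\<Sum>j<p. g (j * k mod p)) = (\<Sum>j<p. g j)"
proof -
  have inj: "inj_on (\<lambda>j. j * k mod p) {..<p}"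
  proof (rule linorder_inj_onI)
    fix i j assume ij: "i < j" "i \<in> {..<p}" "j \<in> {..<p}"
    show "i * k mod p \<noteq> j * k mod p"
    proof
      assume "i * k mod p = j * k mod p"
      then have "p dvd j * k - i * k"
        using mod_eq_dvd_iff_nat[of "i * k" "j * k" p] ij by simp
      then have "p dvd (j - i) * k" by (simp add: diff_mult_distrib)
      then have "p dvd j - i \<or> p dvd k" using p prime_dvd_mult_iff by blast
      then show False using ij k dvd_imp_le[of p "j - i"] dvd_imp_le[of p k] by auto
    qed
  qed auto
  have "(\<lambda>j. j * k mod p) ` {..<p} = {..<p}"
    by (rule endo_inj_surj[OF _ _ inj]) (use k in auto)
  then show ?thesis using sum.reindex[OF inj, of g] by simp
qed

lemma (in group) central_Cp_square_not_property_P: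
  assumes p: "Factorial_Ring.prime (p :: nat)" "p \<le> n - 1" and K: "central_subgroup K G"
    and iso: "G\<lparr>carrier := K\<rparr> \<cong> integer_mod_group p \<times>\<times> integer_mod_group p"
  shows "\<not> property_P n G"
proof
  assume P: "property_P n G"
  have p0: "p > 0" "p > 1" using prime_gt_1_nat[OF p(1)] by auto
  have subK: "subgroup K G" and cK: "\<And>x g. x \<in> K \<Longrightarrow> g \<in> carrier G \<Longrightarrow> x \<otimes> g = g \<otimes> x"
    using K by (auto simp: central_subgroup_def)
  have KG: "x \<in> carrier G" if "x \<in> K" for x using subgroup.mem_carrier[OF subK that] .
  interpret GK: group "G\<lparr>carrier := K\<rparr>" using subgroup.subgroup_is_group[OF subK is_group] .
  obtain h where h: "h \<in> iso (integer_mod_group p \<times>\<times> integer_mod_group p) (G\<lparr>carrier := K\<rparr>)"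
    using GK.iso_sym[OF iso] by (auto simp: is_iso_def)
  define C where "C = {0..<int p} \<times> {0..<int p}"
  have hC: "bij_betw h C K"
    and hm: "\<And>a b c d. (a, b) \<in> C \<Longrightarrow> (c, d) \<in> C \<Longrightarrow> h ((a + c) mod int p, (b + d) mod int p) = h (a, b) \<otimes> h (c, d)"
    using h p0 by (auto simp: iso_def hom_def C_def carrier_integer_mod_group)
  define x where "x = h (1, 0)"
  define y where "y = h (0, 1)"
  have xK: "x \<in> K" and yK: "y \<in> K" using hC p0 by (auto simp: x_def y_def bij_betw_def C_def)
  have h0: "h (0, 0) = \<one>"
  proof -
    have "h (0, 0) \<otimes> h (0, 0) = h (0, 0)" using hm[of 0 0 0 0] p0 by (simp add: C_def)
    moreover have "h (0, 0) \<in> carrier G" using hC p0 KG by (auto simp: bij_betw_def C_def)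
    ultimately show ?thesis by (simp add: r_cancel_one')
  qed
  have hx: "x [^] a = h (int a mod int p, 0)" for a
  proof (induction a)
    case (Suc a)
    then show ?case using hm[of "int a mod int p" 0 1 0] p0
      by (simp add: C_def x_def mod_simps add.commute)
  qed (simp add: h0)
  have hy: "y [^] b = h (0, int b mod int p)" for b
  proof (induction b)
    case (Suc b)
    then show ?case using hm[of 0 "int b mod int p" 0 1] p0
      by (simp add: C_def y_def mod_simps add.commute)
  qed (simp add: h0)
  have hxy: "x [^] a \<otimes> y [^] b = h (int a mod int p, int b mod int p)" for a b
    unfolding hx hy using hm[of "int a mod int p" 0 0 "int b mod int p"] p0 by (simp add: C_def)
  have eq_one: "int a mod int p = 0 \<and> int b mod int p = 0" if "x [^] a \<otimes> y [^] b = \<one>" for a b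
  proof -
    have "h (int a mod int p, int b mod int p) = h (0, 0)" using that hxy h0 by simp
    then have "(int a mod int p, int b mod int p) = (0, 0)"
      by (rule inj_onD[OF bij_betw_imp_inj_on[OF hC]]) (use p0 in \<open>simp_all add: C_def\<close>)
    then show ?thesis by simp
  qed
  have xG: "x \<in> carrier G" and yG: "y \<in> carrier G" using xK yK KG by auto
  have ymod: "y [^] (b mod p) = y [^] b" for b unfolding hy by (simp add: zmod_int)
  have xp: "x [^] p = \<one>" and yp: "y [^] p = \<one>" unfolding hx hy by (simp_all add: h0)
  \<comment> \<open>One generator for each of the \<open>p + 1\<close> subgroups of order
    \<open>p\<close> in the square.\<close>
  define F where "F = insert y ((\<lambda>j. x \<otimes> y [^] j) ` {..<p})"
  have "card F \<le> Suc p"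
    unfolding F_def using card_image_le[of "{..<p}" "\<lambda>j. x \<otimes> y [^] j"]
    by (intro order_trans[OF card_insert_le_m1]) (auto simp: card_insert_if)
  also have "Suc p \<le> n" using p p0 by simp
  finally have "card F \<le> n" .
  moreover have "F \<subseteq> carrier G" "finite F" using xG yG by (auto simp: F_def)
  ultimately have "irreducibly_faithful G F"
    using P unfolding property_P_def by blast
  then obtain H :: "('a \<Rightarrow> complex) inner_space" and \<pi> where irr: "irreducible_unitary_rep G H \<pi>"
    and nt: "\<And>f. f \<in> F \<Longrightarrow> f \<noteq> \<one> \<Longrightarrow> \<pi> f \<noteq> (\<lambda>v\<in>carrier H. v)"
    unfolding irreducibly_faithful_def by blast
  have pw: "(x \<otimes> y [^] j) [^] k = x [^] k \<otimes> y [^] (j * k)" for j k :: nat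
    using pow_mult_distrib[of x "y [^] j" k] cK[OF xK] xG yG by (simp add: nat_pow_pow)
  have one: "(x \<otimes> y [^] j) [^] p = \<one>" for j :: nat
    unfolding pw using xp yp yG by (simp add: nat_pow_pow[symmetric] mult.commute[of j])
  interpret irreducible_unitary_rep G H \<pi> by (rule irr)
  obtain v where v: "v \<in> carrier H" "v \<noteq> \<zero>\<^bsub>H\<^esub>" using nonzero M.zero_closed by blast
  define \<psi> where "\<psi> = (\<lambda>g. inprod H (\<pi> g v) v)"
  have "y \<noteq> \<one>" using eq_one[of 0 1] p0 yG by auto
  \<comment> \<open>The vector \<open>w\<close> stays arbitrary because powers of \<open>x\<close>
    will be moved into the second argument.\<close>
  then have yt: "(\<Sum>j<p. inprod H (\<pi> (y [^] j) v) w) = 0" if "w \<in> carrier H" for w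
    using central_orbit_sum[OF yG cK[OF yK] nt yp v(1) that] by (simp add: F_def)
  have xyt: "(\<Sum>k<p. \<psi> (x [^] k \<otimes> y [^] (j * k))) = 0" if j: "j < p" for j
  proof -
    have yjK: "y [^] j \<in> K" by (induction j) (use subK yK in \<open>auto intro: subgroup.m_closed subgroup.one_closed\<close>)
    then have xyK: "x \<otimes> y [^] j \<in> K" using xK subK by (auto intro: subgroup.m_closed)
    have ne: "x \<otimes> y [^] j \<noteq> \<one>" using eq_one[of 1 j] p0 xG by auto
    show ?thesis
      using central_orbit_sum[OF KG[OF xyK] cK[OF xyK] nt one v(1) v(1)] ne j
      by (simp add: F_def pw \<psi>_def)
  qed
  \<comment> \<open>For \<open>k \<noteq> 0\<close> the exponent \<open>j * k\<close> runs through
    all residues modulo \<open>p\<close>, and what remains is an orbit sum of \<open>y\<close>,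
    which vanishes; for \<open>k = 0\<close> all \<open>p\<close> terms equal
    \<open>inprod H v v\<close>. Interchanging the double sum then contradicts \<open>xyt\<close>,
    by which its rows vanish.\<close>
  have inner: "(\<Sum>j<p. \<psi> (x [^] k \<otimes> y [^] (j * k))) = (if k = 0 then of_nat p * inprod H v v else 0)"
    if k: "k < p" for k
  proof (cases "k = 0")
    case True
    then show ?thesis using v by (simp add: \<psi>_def rep_one)
  next
    case False
    have "(\<Sum>j<p. \<psi> (x [^] k \<otimes> y [^] (j * k))) = (\<Sum>j<p. \<psi> (x [^] k \<otimes> y [^] (j * k mod p)))"
      by (simp only: ymod)
    also have "\<dots> = (\<Sum>j<p. \<psi> (x [^] k \<otimes> y [^] j))"
      by (rule sum_mult_mod_prime[OF p(1)]) (use False k in auto)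
    also have "\<dots> = (\<Sum>j<p. inprod H (\<pi> (y [^] j) v) (\<pi> (inv (x [^] k)) v))"
      using xG yG v by (intro sum.cong) (auto simp: \<psi>_def rep_mult inprod_rep_left rep_closed)
    also have "\<dots> = 0" using xG v by (intro yt) (simp add: rep_closed)
    finally show ?thesis using False by simp
  qed
  have "0 = (\<Sum>j<p. \<Sum>k<p. \<psi> (x [^] k \<otimes> y [^] (j * k)))" using xyt by simp
  also have "\<dots> = (\<Sum>k<p. \<Sum>j<p. \<psi> (x [^] k \<otimes> y [^] (j * k)))" by (rule sum.swap)
  also have "\<dots> = (\<Sum>k<p. if k = 0 then of_nat p * inprod H v v else 0)" using inner by simp
  also have "\<dots> = of_nat p * inprod H v v" using p0 by (simp add: sum.delta)
  finally have "inprod H v v = 0" using p0 by simp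
  then show False using inprod_pos[OF v] by simp
qed

section \<open>Central subgroups of type \<open>C\<^sub>p \<times> C\<^sub>p\<close>\<close>

context group
begin

lemma int_pow_mod:
  assumes x: "x \<in> carrier G" and p: "x [^] (p :: nat) = \<one>"
  shows "x [^] (a mod int p) = x [^] a"
proof -
  have "x [^] a = x [^] (int p * (a div int p) + a mod int p)" by simp
  also have "\<dots> = (x [^] int p) [^] (a div int p) \<otimes> x [^] (a mod int p)"
    using x by (simp only: int_pow_mult int_pow_pow)
  also have "x [^] int p = \<one>" using p by (simp add: int_pow_int)
  finally show ?thesis using x by simp
qed

text \<open>Distinct minimal normal subgroups meet trivially, so the product of two central ones of
  order \<open>p\<close> is direct. Once squares are excluded for all primes below \<open>n\<close>,
  there is at most one central minimal subgroup of each order below \<open>n\<close>.\<close>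

lemma central_Cp_square_exists:
  assumes M: "finite_minimal_normal M" "central_subgroup M G"
    and N: "finite_minimal_normal N" "central_subgroup N G"
    and ne: "M \<noteq> N" and card: "card M = p" "card N = p"
  obtains K where "central_subgroup K G" "G\<lparr>carrier := K\<rparr> \<cong> integer_mod_group p \<times>\<times> integer_mod_group p"
proof -
  interpret M: normal M G by (rule finite_minimal_normal_normal[OF M(1)])
  interpret N: normal N G by (rule finite_minimal_normal_normal[OF N(1)])
  have MN: "M \<inter> N = {\<one>}" by (rule finite_minimal_normal_disjoint[OF M(1) N(1) ne])
  have p: "Factorial_Ring.prime p" using central_minimal_prime_card(1)[OF M] card by simp
  then have p0: "p > 0" by (rule prime_gt_0_nat)
  obtain x y where x: "x \<in> M" "x \<noteq> \<one>" and y: "y \<in> N" "y \<noteq> \<one>"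
    using M(1) N(1) M.one_closed N.one_closed unfolding finite_minimal_normal_def by blast
  have xG: "x \<in> carrier G" and yG: "y \<in> carrier G" using x y by auto
  have ord: "ord x = p" "ord y = p"
    using central_minimal_prime_card(3)[OF M x] central_minimal_prime_card(3)[OF N y] card by auto
  have pow: "x [^] p = \<one>" "y [^] p = \<one>"
    using pow_ord_eq_1[OF xG] pow_ord_eq_1[OF yG] ord by auto
  have cM: "u \<otimes> g = g \<otimes> u" if "u \<in> M" "g \<in> carrier G" for u g
    using M(2) that by (auto simp: central_subgroup_def)
  have cN: "u \<otimes> g = g \<otimes> u" if "u \<in> N" "g \<in> carrier G" for u g
    using N(2) that by (auto simp: central_subgroup_def)
  have xM: "x [^] (a :: int) \<in> M" and yN: "y [^] (a :: int) \<in> N" for a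
    using x y subgroup_int_pow_closed M.subgroup_axioms N.subgroup_axioms by auto
  define C where "C = integer_mod_group p \<times>\<times> integer_mod_group p"
  \<comment> \<open>Integer exponents match the carrier of \<open>integer_mod_group p\<close>, which
    consists of integers; \<open>int_pow_mod\<close> absorbs the reduction modulo
    \<open>p\<close>.\<close>
  define f where "f = (\<lambda>(a, b). x [^] (a :: int) \<otimes> y [^] (b :: int))"
  have Cc: "carrier C = {0..<int p} \<times> {0..<int p}"
    using p0 by (simp add: C_def carrier_integer_mod_group)
  have gC: "group C" unfolding C_def by (intro DirProd_group group_integer_mod_group)
  have hom: "f \<in> hom C G"
  proof (rule homI)
    show "f u \<in> carrier G" if "u \<in> carrier C" for u
      using xG yG by (cases u) (simp add: f_def)
    fix u v assume "u \<in> carrier C" "v \<in> carrier C"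
    obtain a b c d where uv: "u = (a, b)" "v = (c, d)" by (metis surj_pair)
    have "f (u \<otimes>\<^bsub>C\<^esub> v) = x [^] (a + c) \<otimes> y [^] (b + d)"
      using int_pow_mod[OF xG pow(1)] int_pow_mod[OF yG pow(2)] by (simp add: uv f_def C_def)
    also have "\<dots> = x [^] a \<otimes> (x [^] c \<otimes> y [^] b) \<otimes> y [^] d"
      using xG yG by (simp add: int_pow_mult m_assoc)
    also have "x [^] c \<otimes> y [^] b = y [^] b \<otimes> x [^] c" using cM[OF xM] yG by simp
    also have "x [^] a \<otimes> (y [^] b \<otimes> x [^] c) \<otimes> y [^] d = f u \<otimes> f v"
      using xG yG by (simp add: uv f_def m_assoc)
    finally show "f (u \<otimes>\<^bsub>C\<^esub> v) = f u \<otimes> f v" .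
  qed
  then interpret f: group_hom C G f by (intro group_hom.intro group_hom_axioms.intro gC is_group)
  define K where "K = f ` carrier C"
  have "inj_on f (carrier C)"
  proof (rule f.inj_on_one_iff[THEN iffD2], intro allI impI)
    fix u assume u: "u \<in> carrier C" and 1: "f u = \<one>"
    obtain a b where ab: "u = (a, b)" by (cases u)
    have "x [^] a = inv (y [^] b)"
      using 1 xG yG by (intro inv_equality[symmetric]) (simp_all add: ab f_def)
    then have "x [^] a \<in> M \<inter> N" using xM[of a] N.m_inv_closed[OF yN[of b]] by simp
    then have xa: "x [^] a = \<one>" using MN by blast
    then have yb: "y [^] b = \<one>" using 1 yG by (simp add: ab f_def)
    have "int p dvd a" "int p dvd b"
      using xa yb int_pow_eq_id[OF xG] int_pow_eq_id[OF yG] ord by auto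
    then have "a = 0" "b = 0" using u p0 zdvd_not_zless by (auto simp: ab Cc dest: zdvd_imp_le)
    then show "u = \<one>\<^bsub>C\<^esub>" by (simp add: ab C_def)
  qed
  then have "f \<in> iso C (G\<lparr>carrier := K\<rparr>)"
    using hom by (auto simp: iso_def hom_def K_def bij_betw_def)
  then have "G\<lparr>carrier := K\<rparr> \<cong> C"
    using group.iso_sym[OF gC] by (auto simp: is_iso_def)
  moreover have "central_subgroup K G"
    unfolding central_subgroup_def
  proof (intro conjI ballI)
    show "subgroup K G" unfolding K_def by (rule f.img_is_subgroup)
    fix z g assume "z \<in> K" and g: "g \<in> carrier G"
    then obtain a b where z: "z = x [^] (a :: int) \<otimes> y [^] (b :: int)" by (auto simp: K_def f_def)
    have G: "x [^] a \<in> carrier G" "y [^] b \<in> carrier G" using xG yG by auto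
    have "z \<otimes> g = x [^] a \<otimes> (y [^] b \<otimes> g)" using z G g by (simp add: m_assoc)
    also have "\<dots> = (x [^] a \<otimes> g) \<otimes> y [^] b" using cN[OF yN g] G g by (simp add: m_assoc)
    also have "\<dots> = g \<otimes> z" using cM[OF xM g] z G g by (simp add: m_assoc)
    finally show "z \<otimes> g = g \<otimes> z" .
  qed
  ultimately show thesis using that by (simp add: C_def)
qed

section \<open>Construction of the starting state\<close>

lemma commutative_imp_central:
  assumes "\<And>N. minimal_finite_abelian_normal N G \<Longrightarrow> central_subgroup N G"
    and M: "finite_minimal_normal M" and c: "commutative_subset M"
  shows "central_subgroup M G"
proof (rule assms(1))
  interpret M: normal M G by (rule finite_minimal_normal_normal[OF M])
  have "comm_group (G\<lparr>carrier := M\<rparr>)"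
    by (rule group.group_comm_groupI[OF M.subgroup_is_group[OF is_group]])
      (use c in \<open>auto simp: commutative_subset_def\<close>)
  then show "minimal_finite_abelian_normal M G"
    using M by (auto simp: minimal_finite_abelian_normal_def finite_minimal_normal_def)
qed

text \<open>One state annihilates the averages over all chosen subgroups, while its central support
  stays in the product of \<open>\<C>\<close>. The last clause serves the central subgroups outside
  \<open>\<C>\<close>: on one that meets this product trivially, the state vanishes away from
  \<open>\<one>\<close>.\<close>

lemma exists_separating_state:
  assumes T: "finite \<T>" "\<And>M. M \<in> \<T> \<Longrightarrow> finite_minimal_normal M \<and> \<not> commutative_subset M"
    and C: "finite \<C>" "\<And>M. M \<in> \<C> \<Longrightarrow> finite_minimal_normal M \<and> central_subgroup M G"
    and inj: "inj_on card \<C>"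
  obtains \<phi> S Cs where "\<phi> \<in> states" "finite S" "\<And>x. \<phi> x \<noteq> 0 \<Longrightarrow> x \<in> S"
    "\<And>M. M \<in> \<T> \<union> \<C> \<Longrightarrow> ptform \<phi> (uniform_list M) (uniform_list M) = 0"
    "set Cs = \<C>" "distinct Cs"
    "\<And>z. \<lbrakk>\<phi> z \<noteq> 0; \<And>g. g \<in> carrier G \<Longrightarrow> z \<otimes> g = g \<otimes> z\<rbrakk> \<Longrightarrow> z \<in> set_mult_list Cs"
proof -
  obtain Ts where Ts: "set Ts = \<T>" "distinct Ts" using finite_distinct_list[OF T(1)] by blast
  obtain Cs where Cs: "set Cs = \<C>" "distinct Cs" using finite_distinct_list[OF C(1)] by blast
  have cc: "commutative_subset M" if "M \<in> \<C>" for M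
    using C(2)[OF that] finite_minimal_normal_subset[of M]
    unfolding central_subgroup_def commutative_subset_def by blast
  have disj: "set Ts \<inter> set Cs = {}" using T(2) cc Ts(1) Cs(1) by blast
  have T': "finite_minimal_normal M \<and> \<not> commutative_subset M" if "M \<in> set Ts" for M
    using T(2) that Ts(1) by blast
  have C': "finite_minimal_normal M \<and> central_subgroup M G" if "M \<in> set Cs" for M
    using C(2) that Cs(1) by blast
  have "independent_list Cs"
    by (rule independent_central_list) (use C' inj Cs in auto)
  then have ind: "independent_list (Ts @ Cs)"
    by (intro independent_list_append T' Ts(2) disj) (use C' in blast)+
  have all: "finite_minimal_normal M" if "M \<in> set (Ts @ Cs)" for M
    using that T' C' by auto
  then have "\<And>M. M \<in> set (Ts @ Cs) \<Longrightarrow> M \<lhd> G \<and> finite M \<and> M \<noteq> {\<one>}"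
    unfolding finite_minimal_normal_def by blast
  from exists_coset_sums_zero[OF this ind]
  obtain q :: "'a \<Rightarrow> complex" and D where D: "finite D" "D \<subseteq> set_mult_list (Ts @ Cs)"
    and q: "\<And>h. h \<notin> D \<Longrightarrow> q h = 0" "\<exists>h. q h \<noteq> 0"
    and sums: "\<And>M g. M \<in> set (Ts @ Cs) \<Longrightarrow> g \<in> carrier G \<Longrightarrow> (\<Sum>m\<in>M. q (g \<otimes> m)) = 0"
    by blast
  interpret B: normal "set_mult_list (Ts @ Cs)" G
    by (rule normal_set_mult_list[OF finite_minimal_normal_normal[OF all]])
  have DG: "D \<subseteq> carrier G" using D(2) B.subset by blast
  define \<phi> where "\<phi> = autocorrelation q D"
  \<comment> \<open>A point of the support is a quotient of two elements of \<open>D\<close>, so the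
    support is finite and stays in the product of the list.\<close>
  have supp: "z \<in> (\<lambda>(d, e). inv d \<otimes> e) ` (D \<times> D) \<and> z \<in> set_mult_list (Ts @ Cs)" if "\<phi> z \<noteq> 0" for z
  proof -
    have z: "z \<in> carrier G" using that by (auto simp: \<phi>_def autocorrelation_def split: if_splits)
    have "(\<Sum>h\<in>D. q (h \<otimes> z) * cnj (q h)) \<noteq> 0"
      using that by (auto simp: \<phi>_def autocorrelation_def split: if_splits)
    then obtain h where "h \<in> D" "q (h \<otimes> z) * cnj (q h) \<noteq> 0"
      by (rule sum.not_neutral_contains_not_neutral)
    then have h: "h \<in> D" "q (h \<otimes> z) \<noteq> 0" by auto
    then have hz: "h \<otimes> z \<in> D" using q(1) by blast
    have "z = inv h \<otimes> (h \<otimes> z)" using h z DG by (simp add: inv_mult_cancel subset_iff)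
    moreover have "inv h \<otimes> (h \<otimes> z) \<in> set_mult_list (Ts @ Cs)" using h hz D(2) by blast
    ultimately show ?thesis using h(1) hz by force
  qed
  show thesis
  proof (rule that[of \<phi> "(\<lambda>(d, e). inv d \<otimes> e) ` (D \<times> D)" Cs])
    show "\<phi> \<in> states" unfolding \<phi>_def by (rule autocorrelation_states[OF D(1) DG q])
    show "ptform \<phi> (uniform_list M) (uniform_list M) = 0" if "M \<in> \<T> \<union> \<C>" for M
    proof -
      have M: "M \<in> set (Ts @ Cs)" using that Ts Cs by auto
      show ?thesis
        unfolding \<phi>_def using all[OF M] finite_minimal_normal_subset[OF all[OF M]] sums[OF M]
        by (intro ptform_uniform_eq_0[OF D(1) DG q(1)]) (auto simp: finite_minimal_normal_def)
    qed
    show "z \<in> set_mult_list Cs" if "\<phi> z \<noteq> 0" "\<And>g. g \<in> carrier G \<Longrightarrow> z \<otimes> g = g \<otimes> z" for z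
      using supp[OF that(1)] that(2)
      by (intro finite_minimal_normal_centreless_list[OF T' _ Ts(2) disj]) (use C' in blast)+
  qed (use D supp Cs in auto)
qed

section \<open>Normal closures and the forward direction\<close>

definition normal_closure :: "'a \<Rightarrow> 'a set" where
  "normal_closure x = \<Inter>{N. N \<lhd> G \<and> x \<in> N}"

lemma normal_closure:
  assumes "x \<in> carrier G"
  shows "normal_closure x \<lhd> G" "x \<in> normal_closure x"
proof -
  have "carrier G \<lhd> G" by (rule normal_invI) (auto intro: subgroup_self)
  then have ne: "{N. N \<lhd> G \<and> x \<in> N} \<noteq> {}" using assms by blast
  show "normal_closure x \<lhd> G"
  proof (rule normal_invI)
    show "subgroup (normal_closure x) G" unfolding normal_closure_def
      by (rule subgroups_Inter) (use ne in \<open>auto intro: normal_imp_subgroup\<close>)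
    show "g \<otimes> h \<otimes> inv g \<in> normal_closure x" if "g \<in> carrier G" "h \<in> normal_closure x" for g h
      unfolding normal_closure_def
    proof (intro InterI, elim CollectE conjE)
      fix N assume "N \<lhd> G" "x \<in> N"
      then show "g \<otimes> h \<otimes> inv g \<in> N"
        using that by (intro normal.inv_op_closed2) (auto simp: normal_closure_def)
    qed
  qed
  show "x \<in> normal_closure x" by (auto simp: normal_closure_def)
qed

end

lemma (in unitary_rep) rep_trivial_normal_closure:
  assumes x: "x \<in> carrier G" "\<pi> x = (\<lambda>v\<in>carrier H. v)" and y: "y \<in> group.normal_closure G x"
  shows "\<pi> y = (\<lambda>v\<in>carrier H. v)"
proof -
  interpret G: group G by (rule group_G)
  interpret hom: group_hom G "BijGroup (carrier H)" \<pi> by (rule group_hom)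
  have "kernel G (BijGroup (carrier H)) \<pi> \<lhd> G" by (rule hom.normal_kernel)
  moreover have "x \<in> kernel G (BijGroup (carrier H)) \<pi>"
    using x by (simp add: kernel_def BijGroup_def)
  ultimately have "y \<in> kernel G (BijGroup (carrier H)) \<pi>"
    using y unfolding G.normal_closure_def by blast
  then show ?thesis by (simp add: kernel_def BijGroup_def)
qed

text \<open>Each nontrivial \<open>x\<close> receives a finite subset of its normal closure with
  value at most \<open>1 / n\<close>. As there may be exactly \<open>n\<close> such elements,
  everything depends on one strict inequality, and this governs which subgroups are
  annihilated.\<close>

lemma (in group) irreducibly_faithful_if_no_Cp_square:
  assumes cnt: "countable (carrier G)"
    and cen: "\<And>N. minimal_finite_abelian_normal N G \<Longrightarrow> central_subgroup N G"
    and n: "n \<ge> 1" and F: "F \<subseteq> carrier G" "finite F" "card F \<le> n"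
    and no: "\<And>p K. \<lbrakk>Factorial_Ring.prime (p :: nat); p \<le> n - 1; central_subgroup K G\<rbrakk>
      \<Longrightarrow> \<not> G\<lparr>carrier := K\<rparr> \<cong> integer_mod_group p \<times>\<times> integer_mod_group p"
  shows "irreducibly_faithful G F"
proof -
  define F' where "F' = F - {\<one>}"
  have F': "finite F'" "F' \<subseteq> carrier G" "card F' \<le> n"
    using F card_mono[OF F(2), of F'] by (auto simp: F'_def)
  have nc: "normal_closure x \<lhd> G" "normal_closure x \<noteq> {\<one>}" if "x \<in> F'" for x
    using normal_closure[of x] that F' by (auto simp: F'_def)
  \<comment> \<open>The element \<open>x\<close> need not lie in \<open>M x\<close>: a
    representation trivial on \<open>x\<close> is trivial on its normal closure, so acting
    nontrivially somewhere on \<open>M x\<close> suffices.\<close>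
  define M where "M = (\<lambda>x. SOME M. M \<subseteq> normal_closure x \<and> finite_minimal_normal M)"
  define B where "B = {x \<in> F'. finite (normal_closure x)}"
  have M: "M x \<subseteq> normal_closure x" "finite_minimal_normal (M x)" if "x \<in> B" for x
    using someI_ex[OF finite_minimal_normal_exists[of "normal_closure x"]] nc[of x] that
    by (auto simp: M_def B_def)
  have Mfin: "finite (M x)" "M x \<noteq> {}" "M x \<subseteq> carrier G" if "x \<in> B" for x
    using M(2)[OF that] finite_minimal_normal_subset[OF M(2)[OF that]]
      subgroup.one_closed[OF normal_imp_subgroup[OF finite_minimal_normal_normal[OF M(2)[OF that]]]]
    by (auto simp: finite_minimal_normal_def)
  \<comment> \<open>The elements whose subgroups may fail to be independent: several central
    subgroups of order at least \<open>n\<close> can share the same prime.\<close>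
  define big where "big = {x \<in> B. commutative_subset (M x) \<and> n \<le> card (M x)}"
  define \<T> where "\<T> = M ` {x \<in> B. \<not> commutative_subset (M x)}"
  have Mcen: "central_subgroup (M x) G" if "x \<in> B" "commutative_subset (M x)" for x
    using commutative_imp_central[OF cen M(2)[OF that(1)] that(2)] .
  \<comment> \<open>The family must have distinct orders, to be independent. It must also meet every
    big subgroup outside it trivially, by smaller orders or by being a single subgroup, and make one
    element cost less than \<open>1 / n\<close>.\<close>
  have "\<exists>\<C>. finite \<C> \<and> \<C> \<subseteq> M ` {x \<in> B. commutative_subset (M x)} \<and> inj_on card \<C> \<and>
     (\<forall>x\<in>B - big. M x \<in> \<T> \<union> \<C>) \<and>
     (\<forall>x\<in>big. M x \<in> \<C> \<or> (\<forall>C\<in>\<C>. card C < card (M x)) \<or> (\<exists>C. \<C> = {C})) \<and>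
     (F' = {} \<or> (\<exists>x\<in>F'. x \<notin> big \<or> M x \<in> \<C>))"
  proof (cases "F' \<noteq> {} \<and> F' \<subseteq> big")
    case True
    \<comment> \<open>When all elements are big there is nothing else to annihilate, so the strict
      inequality is bought with the subgroup of one of them. A singleton family is independent, and
      every other minimal subgroup meets it trivially.\<close>
    then obtain x where x: "x \<in> F'" "x \<in> big" by blast
    have "B \<subseteq> big" using True by (auto simp: B_def)
    then show ?thesis using x by (intro exI[of _ "{M x}"]) (auto simp: big_def)
  next
    case False
    define \<C> where "\<C> = M ` {x \<in> B. commutative_subset (M x) \<and> card (M x) < n}"
    \<comment> \<open>Two members of equal order would generate an excluded square, since their
      common order is a prime below \<open>n\<close>.\<close>
    have "inj_on card \<C>"
    proof (rule inj_onI, rule ccontr)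
      fix C D assume C: "C \<in> \<C>" and D: "D \<in> \<C>" and eq: "card C = card D" and ne: "C \<noteq> D"
      have CC: "finite_minimal_normal C" "central_subgroup C G" "card C < n"
        and DD: "finite_minimal_normal D" "central_subgroup D G"
        using C D M Mcen by (auto simp: \<C>_def)
      obtain K where "central_subgroup K G"
        "G\<lparr>carrier := K\<rparr> \<cong> integer_mod_group (card C) \<times>\<times> integer_mod_group (card C)"
        using central_Cp_square_exists[OF CC(1,2) DD ne refl eq[symmetric]] by blast
      then show False using no[OF central_minimal_prime_card(1)[OF CC(1,2)]] CC(3) by auto
    qed
    moreover have "finite \<C>" using F' by (auto simp: \<C>_def B_def)
    moreover have "\<forall>x\<in>B - big. M x \<in> \<T> \<union> \<C>" by (auto simp: \<C>_def \<T>_def big_def)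
    moreover have "\<forall>x\<in>big. \<forall>C\<in>\<C>. card C < card (M x)" by (auto simp: \<C>_def big_def)
    moreover have "F' = {} \<or> (\<exists>x\<in>F'. x \<notin> big)" using False by blast
    ultimately show ?thesis by (intro exI[of _ \<C>]) (auto simp: \<C>_def)
  qed
  then obtain \<C> where \<C>: "finite \<C>" "\<C> \<subseteq> M ` {x \<in> B. commutative_subset (M x)}" "inj_on card \<C>"
    and killed: "\<And>x. x \<in> B \<Longrightarrow> x \<notin> big \<Longrightarrow> M x \<in> \<T> \<union> \<C>"
    and indep: "\<And>x. x \<in> big \<Longrightarrow> M x \<in> \<C> \<or> (\<forall>C\<in>\<C>. card C < card (M x)) \<or> (\<exists>C. \<C> = {C})"
    and strict: "F' = {} \<or> (\<exists>x\<in>F'. x \<notin> big \<or> M x \<in> \<C>)"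
    by (elim exE conjE) (rule that, simp_all)
  have \<C>cen: "finite_minimal_normal C \<and> central_subgroup C G" if "C \<in> \<C>" for C
    using that \<C>(2) M Mcen by blast
  have \<T>: "finite \<T>" "\<And>M. M \<in> \<T> \<Longrightarrow> finite_minimal_normal M \<and> \<not> commutative_subset M"
    using F' M by (auto simp: \<T>_def B_def)
  obtain \<phi> S Cs where \<phi>: "\<phi> \<in> states" and S: "finite S" "\<And>x. \<phi> x \<noteq> 0 \<Longrightarrow> x \<in> S"
    and zero: "\<And>M. M \<in> \<T> \<union> \<C> \<Longrightarrow> ptform \<phi> (uniform_list M) (uniform_list M) = 0"
    and Cs: "set Cs = \<C>" "distinct Cs"
    and supp: "\<And>z. \<lbrakk>\<phi> z \<noteq> 0; \<And>g. g \<in> carrier G \<Longrightarrow> z \<otimes> g = g \<otimes> z\<rbrakk> \<Longrightarrow> z \<in> set_mult_list Cs"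
    using exists_separating_state[OF \<T> \<C>(1) \<C>cen \<C>(3)] by blast
  define val where "val = (\<lambda>Y. Re (ptform \<phi> (uniform_list Y) (uniform_list Y)))"
  have n0: "1 / real n > 0" using n by simp
  have "\<exists>Y. finite Y \<and> Y \<noteq> {} \<and> Y \<subseteq> normal_closure x \<and> val Y \<le> 1 / n \<and>
      (x \<notin> big \<or> M x \<in> \<C> \<longrightarrow> val Y < 1 / n)" if x: "x \<in> F'" for x
  proof -
    consider "x \<notin> B" | "x \<in> B" "M x \<in> \<T> \<union> \<C>" | "x \<in> big" "M x \<notin> \<C>"
      using killed by blast
    then show ?thesis
    proof cases
      case 1
      then have "infinite (normal_closure x)" using x by (simp add: B_def)
      \<comment> \<open>A set of \<open>n * card S\<close> elements would only give equality with
        \<open>1 / n\<close>; the \<open>Suc\<close> makes the inequality strict.\<close>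
      then obtain Y where Y: "finite Y" "card Y = Suc (n * card S)" "Y \<subseteq> normal_closure x"
        using infinite_arbitrarily_large by blast
      have YG: "Y \<subseteq> carrier G" using Y(3) normal_imp_subgroup[OF nc(1)[OF x]] subgroup.subset by blast
      have Y0: "Y \<noteq> {}" using Y(2) by auto
      have "val Y \<le> card S / card Y"
        unfolding val_def by (rule ptform_uniform_le[OF \<phi> Y(1) YG Y0 S(1)]) (use S(2) in blast)
      also have "\<dots> < 1 / n"
      proof -
        have "real n * real (card S) < real (card Y)" unfolding Y(2) by simp
        moreover have "real (card Y) > 0" "real n > 0"
          unfolding of_nat_0_less_iff Y(2) using n by simp_all
        ultimately show ?thesis
          by (simp add: pos_divide_less_eq pos_less_divide_eq mult.commute)
      qed
      finally show ?thesis using Y Y0 by (intro exI[of _ Y]) auto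
    next
      case 2
      then show ?thesis
        using M(1)[OF 2(1)] Mfin[OF 2(1)] zero[OF 2(2)] n0 by (intro exI[of _ "M x"]) (auto simp: val_def)
    next
      case 3
      then have xB: "x \<in> B" and com: "commutative_subset (M x)" and le: "n \<le> card (M x)"
        by (auto simp: big_def)
      interpret Mx: normal "M x" G by (rule finite_minimal_normal_normal[OF M(2)[OF xB]])
      have cs: "central_subgroup (M x) G" by (rule Mcen[OF xB com])
      have one: "m = \<one>" if m: "m \<in> M x" "\<phi> m \<noteq> 0" for m
      proof -
        have mc: "m \<in> set_mult_list Cs"
          by (rule supp[OF m(2)]) (use cs m(1) in \<open>auto simp: central_subgroup_def\<close>)
        \<comment> \<open>A point of the support in the central \<open>M x\<close> lies in the
          product of \<open>\<C>\<close>; coprime orders, or the trivial intersection with the only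
          member, leave \<open>\<one>\<close> alone.\<close>
        from indep[OF 3(1)] 3(2) consider "\<forall>C\<in>\<C>. card C < card (M x)" | C where "\<C> = {C}" by blast
        then show ?thesis
        proof cases
          case 1
          show ?thesis
          proof (rule prime_order_not_in_set_mult_list[OF _ _ mc])
            show "Factorial_Ring.prime (card (M x))" "m [^] card (M x) = \<one>"
              using central_minimal_prime_card(1,2)[OF M(2)[OF xB] cs] m(1) by auto
            show "central_subgroup C G \<and> (\<forall>x\<in>C. x [^] card C = \<one>) \<and>
              Factorial_Ring.prime (card C) \<and> card C \<noteq> card (M x)" if C: "C \<in> set Cs" for C
            proof -
              have CC: "finite_minimal_normal C" "central_subgroup C G" and lt: "card C < card (M x)"
                using \<C>cen[of C] 1 C Cs(1) by auto
              show ?thesis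
                using CC(2) central_minimal_prime_card(1,2)[OF CC] lt by simp
            qed
          qed
        next
          case 2
          then have "length Cs = 1" using distinct_card[OF Cs(2)] Cs(1) by simp
          then obtain C' where "Cs = [C']" by (auto simp: length_Suc_conv)
          then have "Cs = [C]" using Cs(1) 2 by simp
          moreover have "C \<subseteq> carrier G" using finite_minimal_normal_subset \<C>cen[of C] 2 by simp
          ultimately have "m \<in> C" using mc by (auto simp: set_mult_def subset_iff)
          then show ?thesis
            using finite_minimal_normal_disjoint[OF M(2)[OF xB], of C] \<C>cen[of C] 2 3(2) m(1) by auto
        qed
      qed
      \<comment> \<open>On \<open>M x\<close> the state is supported at \<open>\<one>\<close>, so
        only the diagonal of the double sum remains.\<close>
      have "val (M x) \<le> card {\<one>} / card (M x)"
        unfolding val_def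
      proof (rule ptform_uniform_le[OF \<phi> Mfin(1)[OF xB] Mfin(3)[OF xB] Mfin(2)[OF xB]])
        fix y z assume yz: "y \<in> M x" "z \<in> M x" "\<phi> (inv z \<otimes> y) \<noteq> 0"
        then have "inv z \<otimes> y = \<one>" by (intro one) auto
        then show "inv z \<otimes> y \<in> {\<one>}" by simp
      qed simp
      also have "\<dots> \<le> 1 / n" using le n by (simp add: frac_le)
      finally show ?thesis using M(1)[OF xB] Mfin[OF xB] 3 by (intro exI[of _ "M x"]) auto
    qed
  qed
  then have "\<exists>Y. \<forall>x\<in>F'. finite (Y x) \<and> Y x \<noteq> {} \<and> Y x \<subseteq> normal_closure x \<and> val (Y x) \<le> 1 / n \<and>
      (x \<notin> big \<or> M x \<in> \<C> \<longrightarrow> val (Y x) < 1 / n)"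
    by (intro bchoice ballI)
  then obtain Y where Y: "\<And>x. x \<in> F' \<Longrightarrow> finite (Y x)" "\<And>x. x \<in> F' \<Longrightarrow> Y x \<noteq> {}"
    "\<And>x. x \<in> F' \<Longrightarrow> Y x \<subseteq> normal_closure x" "\<And>x. x \<in> F' \<Longrightarrow> val (Y x) \<le> 1 / n"
    "\<And>x. x \<in> F' \<Longrightarrow> x \<notin> big \<or> M x \<in> \<C> \<Longrightarrow> val (Y x) < 1 / n"
    by blast
  have YG: "Y x \<subseteq> carrier G" if "x \<in> F'" for x
    using Y(3)[OF that] normal_imp_subgroup[OF nc(1)[OF that]] subgroup.subset by blast
  have "(\<Sum>x\<in>F'. val (Y x)) < 1"
  proof (cases "F' = {}")
    case False
    then obtain x where x: "x \<in> F'" "x \<notin> big \<or> M x \<in> \<C>" using strict by blast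
    have "(\<Sum>x\<in>F'. val (Y x)) < (\<Sum>x\<in>F'. 1 / real n)"
    proof (rule sum_strict_mono_ex1[OF F'(1)])
      show "\<forall>x\<in>F'. val (Y x) \<le> 1 / real n" using Y(4) by blast
      show "\<exists>x\<in>F'. val (Y x) < 1 / real n" using Y(5)[OF x] x(1) by blast
    qed
    also have "\<dots> \<le> 1" using F' n by (simp add: divide_le_eq)
    finally show ?thesis .
  qed simp
  then have less: "(\<Sum>x\<in>F'. Re (ptform \<phi> (uniform_list (Y x)) (uniform_list (Y x)))) < 1"
    by (simp add: val_def)
  obtain H :: "((complex \<times> 'a) list \<Rightarrow> complex) inner_space" and \<pi>
    where irr: "irreducible_unitary_rep G H \<pi>"
      and nt: "\<And>x. x \<in> F' \<Longrightarrow> \<exists>y\<in>snd ` set (uniform_list (Y x)). \<pi> y \<noteq> (\<lambda>v\<in>carrier H. v)"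
    by (rule exists_irreducible_rep[OF cnt F'(1) \<phi> less])
      (use Y YG in \<open>auto simp: sum_list_fst_uniform set_uniform_list\<close>)
  interpret irreducible_unitary_rep G H \<pi> by (rule irr)
  show ?thesis
  proof (rule irreducibly_faithful_any_type[OF irr F(1)], intro ballI impI)
    fix x assume "x \<in> F" "x \<noteq> \<one>"
    then have x: "x \<in> F'" by (simp add: F'_def)
    obtain y where y: "y \<in> Y x" "\<pi> y \<noteq> (\<lambda>v\<in>carrier H. v)"
      using nt[OF x] set_uniform_list[OF Y(1)[OF x]] by auto
    then show "\<pi> x \<noteq> (\<lambda>v\<in>carrier H. v)"
      using rep_trivial_normal_closure[of x y] Y(3)[OF x] x F'(2) by blast
  qed
qed

theorem corollary1p3:
  fixes n :: nat and G :: "('a, 'b) monoid_scheme"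
  assumes "n \<ge> 1"
    and "group G"
    and "countable (carrier G)"
    and "\<And>N. minimal_finite_abelian_normal N G \<Longrightarrow> central_subgroup N G"
  shows "\<not> property_P n G \<longleftrightarrow>
    (\<exists>(p::nat) K. Factorial_Ring.prime p \<and> p \<le> n - 1 \<and> central_subgroup K G \<and>
       G\<lparr>carrier := K\<rparr> \<cong> integer_mod_group p \<times>\<times> integer_mod_group p)"
proof
  interpret group G by fact
  assume "\<not> property_P n G"
  then obtain F where F: "F \<subseteq> carrier G" "finite F" "card F \<le> n" "\<not> irreducibly_faithful G F"
    by (auto simp: property_P_def)
  show "\<exists>(p::nat) K. Factorial_Ring.prime p \<and> p \<le> n - 1 \<and> central_subgroup K G \<and>
       G\<lparr>carrier := K\<rparr> \<cong> integer_mod_group p \<times>\<times> integer_mod_group p"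
    using irreducibly_faithful_if_no_Cp_square[OF assms(3,4,1) F(1-3)] F(4) by blast
next
  interpret group G by fact
  assume "\<exists>(p::nat) K. Factorial_Ring.prime p \<and> p \<le> n - 1 \<and> central_subgroup K G \<and>
       G\<lparr>carrier := K\<rparr> \<cong> integer_mod_group p \<times>\<times> integer_mod_group p"
  then show "\<not> property_P n G" using central_Cp_square_not_property_P by blast
qed

end
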